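(* Let $G=(X,b,m)$ be a connected, locally finite weighted graph, let $x_0\in X$, and let $\kappa_\pm$ denote the outer and inner curvatures with respect to $x_0$. Let $f:X\to(0,\infty)$ be spherically symmetric with respect to $x_0$, such that for some $R$ one has $\widehat f(r):=f(r)-f(r+1)>0$ for all $r>R$, and such that $f(r)\to0$ as $r\to\infty$. If for some $\lambda<0$ $$\kappa_+(x)-\kappa_-(x)\,\frac{\widehat f(r-1)}{\widehat f(r)}\;\ge\;\lambda\,\frac{f(r)}{\widehat f(r)}\qquad\text{for all }x\in S_r(x_0)\text{ and all } r>R,$$ then $G$ is Feller.
   Context: Weighted graph: $G=(X,b,m)$ where $X$ is a countably infinite set (vertices), $b:X\times X\to[0,\infty)$ satisfies $b(x,y)=b(y,x)$, $b(x,x)=0$ and $|\{y : b(x,y)>0\}|<\infty$ for all $x$ (local finiteness), and $m:X\to(0,\infty)$ is a vertex measure. Write $x\sim y$ if $b(x,y)>0$. $G$ is connected if any two vertices are joined by a finite path $x=x_0\sim x_1\sim\dots\sim x_n=y$; $d(x,y)$ is the least number $n$ of edges of such a path (combinatorial graph metric). Laplacian and heat semigroup: the formal Laplacian is $\widetilde\Delta f(x)=\frac1{m(x)}\sum_{y\in X}b(x,y)(f(x)-f(y))$ for $f:X\to\mathbb{R}$. $C_c(X)$ is the space of finitely supported real functions, and $\ell^2(X,m)$ is the Hilbert space of real functions with $\sum_x f(x)^2m(x)<\infty$, with inner product $\langle f,g\rangle=\sum_x f(x)g(x)m(x)$. $\Delta$ is the Friedrichs extension in $\ell^2(X,m)$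 of $\widetilde\Delta|_{C_c(X)}$, i.e. the self-adjoint operator of the closure of the form $\frac12\sum_{x,y}b(x,y)(f(x)-f(y))(g(x)-g(y))$ on $C_c(X)$. The semigroup $P_t=e^{-t\Delta}$ has a heat kernel $p_t(x,y)\ge 0$ and acts on bounded functions by $P_tf(x)=\sum_{y\in X}p_t(x,y)f(y)m(y)$. Feller: $C_0(X)$ is the space of functions vanishing at infinity, i.e. the closure of $C_c(X)$ in the sup norm. $G$ is Feller if $P_t$ maps $C_0(X)$ into $C_0(X)$ for all $t\ge0$. Curvatures: for $x_0\in X$ and integer $r$ let $S_r(x_0)=\{y : d(y,x_0)=r\}$ (empty if $r<0$). For $x\in S_r(x_0)$, the outer ($+$) and inner ($-$) curvatures with respect to $x_0$ are $\kappa_\pm(x)=\frac1{m(x)}\sum_{y\in S_{r\pm1}(x_0)}b(x,y)$. A function $f$ on $X$ is spherically symmetric with respect to $x_0$ if its values depend only on the distance $d(\cdot,x_0)$; then $f(r)$ denotes the common value of $f$ on $S_r(x_0)$. Here $r$ and $R$ denote nonnegative integers. *)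

theory Defs
  imports "HOL-Analysis.Analysis"
begin

text \<open>The vertex set is the whole type \<open>'a\<close>, which is required to be countably infinite.\<close>

definition weighted_graph :: "('a \<Rightarrow> 'a \<Rightarrow> real) \<Rightarrow> ('a \<Rightarrow> real) \<Rightarrow> bool" where
  "weighted_graph b m \<longleftrightarrow>
     countable (UNIV :: 'a set) \<and> infinite (UNIV :: 'a set) \<and>
     (\<forall>x y. 0 \<le> b x y) \<and> (\<forall>x y. b x y = b y x) \<and> (\<forall>x. b x x = 0) \<and>
     (\<forall>x. finite {y. b x y > 0}) \<and> (\<forall>x. 0 < m x)"

definition adj :: "('a \<Rightarrow> 'a \<Rightarrow> real) \<Rightarrow> ('a \<times> 'a) set" where
  "adj b = {(x, y). b x y > 0}"

definition graph_connected :: "('a \<Rightarrow> 'a \<Rightarrow> real) \<Rightarrow> bool" where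
  "graph_connected b \<longleftrightarrow> (\<forall>x y. (x, y) \<in> (adj b)\<^sup>*)"

text \<open>\<open>(x, y) \<in> adj b ^^ n\<close> says that \<open>x\<close> and \<open>y\<close> are joined by a path with \<open>n\<close> edges.\<close>

definition graph_dist :: "('a \<Rightarrow> 'a \<Rightarrow> real) \<Rightarrow> 'a \<Rightarrow> 'a \<Rightarrow> nat" where
  "graph_dist b x y = (LEAST n. (x, y) \<in> adj b ^^ n)"

definition graph_sphere :: "('a \<Rightarrow> 'a \<Rightarrow> real) \<Rightarrow> 'a \<Rightarrow> int \<Rightarrow> 'a set" where
  "graph_sphere b x0 r = {y. int (graph_dist b y x0) = r}"

text \<open>In a connected, locally finite graph all spheres are finite, so the sums below are
  genuine.\<close>

definition outer_curvature :: "('a \<Rightarrow> 'a \<Rightarrow> real) \<Rightarrow> ('a \<Rightarrow> real) \<Rightarrow> 'a \<Rightarrow> 'a \<Rightarrow> real" where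
  "outer_curvature b m x0 x =
     (\<Sum>y\<in>graph_sphere b x0 (int (graph_dist b x x0) + 1). b x y) / m x"

definition inner_curvature :: "('a \<Rightarrow> 'a \<Rightarrow> real) \<Rightarrow> ('a \<Rightarrow> real) \<Rightarrow> 'a \<Rightarrow> 'a \<Rightarrow> real" where
  "inner_curvature b m x0 x =
     (\<Sum>y\<in>graph_sphere b x0 (int (graph_dist b x x0) - 1). b x y) / m x"

definition spherically_symmetric ::
    "('a \<Rightarrow> 'a \<Rightarrow> real) \<Rightarrow> 'a \<Rightarrow> ('a \<Rightarrow> real) \<Rightarrow> bool" where
  "spherically_symmetric b x0 f \<longleftrightarrow>
     (\<forall>x y. graph_dist b x x0 = graph_dist b y x0 \<longrightarrow> f x = f y)"

text \<open>The common value of \<open>f\<close> on the sphere of radius \<open>r\<close>.  No sphere is empty when the graph is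
  infinite, connected and locally finite.\<close>

definition radial :: "('a \<Rightarrow> 'a \<Rightarrow> real) \<Rightarrow> 'a \<Rightarrow> ('a \<Rightarrow> real) \<Rightarrow> nat \<Rightarrow> real" where
  "radial b x0 f r = (THE c. f ` graph_sphere b x0 (int r) = {c})"

definition radial_diff :: "('a \<Rightarrow> 'a \<Rightarrow> real) \<Rightarrow> 'a \<Rightarrow> ('a \<Rightarrow> real) \<Rightarrow> nat \<Rightarrow> real" where
  "radial_diff b x0 f r = radial b x0 f r - radial b x0 f (r + 1)"


section \<open>The Friedrichs Laplacian\<close>

definition Cc :: "('a \<Rightarrow> real) set" where
  "Cc = {f. finite {x. f x \<noteq> 0}}"

definition l2 :: "('a \<Rightarrow> real) \<Rightarrow> ('a \<Rightarrow> real) set" where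
  "l2 m = {f. (\<lambda>x. (f x)\<^sup>2 * m x) summable_on UNIV}"

definition l2_inner :: "('a \<Rightarrow> real) \<Rightarrow> ('a \<Rightarrow> real) \<Rightarrow> ('a \<Rightarrow> real) \<Rightarrow> real" where
  "l2_inner m f g = (\<Sum>\<^sub>\<infinity>x. f x * g x * m x)"

definition l2_norm :: "('a \<Rightarrow> real) \<Rightarrow> ('a \<Rightarrow> real) \<Rightarrow> real" where
  "l2_norm m f = sqrt (l2_inner m f f)"

text \<open>This form is only used on \<open>Cc\<close>, where local finiteness leaves finitely many nonzero terms.\<close>

definition energy :: "('a \<Rightarrow> 'a \<Rightarrow> real) \<Rightarrow> ('a \<Rightarrow> real) \<Rightarrow> ('a \<Rightarrow> real) \<Rightarrow> real" where
  "energy b f g = (1/2) * (\<Sum>\<^sub>\<infinity>(x, y). b x y * (f x - f y) * (g x - g y))"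

text \<open>The closure of the form \<open>energy b\<close> on \<open>Cc\<close>: its domain consists of the limits in \<open>l2\<close> of
  energy-Cauchy sequences in \<open>Cc\<close>, and its values are the limits of the values along such
  sequences (independent of the sequences, because the form is closable).\<close>

definition form_approx ::
    "('a \<Rightarrow> 'a \<Rightarrow> real) \<Rightarrow> ('a \<Rightarrow> real) \<Rightarrow> (nat \<Rightarrow> 'a \<Rightarrow> real) \<Rightarrow> ('a \<Rightarrow> real) \<Rightarrow> bool" where
  "form_approx b m \<phi> f \<longleftrightarrow>
     f \<in> l2 m \<and> (\<forall>n. \<phi> n \<in> Cc) \<and>
     (\<lambda>n. l2_norm m (\<lambda>x. \<phi> n x - f x)) \<longlonglongrightarrow> 0 \<and>
     (\<forall>\<epsilon>>0. \<exists>N. \<forall>i\<ge>N. \<forall>j\<ge>N.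
        energy b (\<lambda>x. \<phi> i x - \<phi> j x) (\<lambda>x. \<phi> i x - \<phi> j x) < \<epsilon>)"

definition form_dom :: "('a \<Rightarrow> 'a \<Rightarrow> real) \<Rightarrow> ('a \<Rightarrow> real) \<Rightarrow> ('a \<Rightarrow> real) set" where
  "form_dom b m = {f. \<exists>\<phi>. form_approx b m \<phi> f}"

definition closed_form ::
    "('a \<Rightarrow> 'a \<Rightarrow> real) \<Rightarrow> ('a \<Rightarrow> real) \<Rightarrow> ('a \<Rightarrow> real) \<Rightarrow> ('a \<Rightarrow> real) \<Rightarrow> real" where
  "closed_form b m f g =
     (THE c. \<forall>\<phi> \<psi>. form_approx b m \<phi> f \<longrightarrow> form_approx b m \<psi> g \<longrightarrow>
                (\<lambda>n. energy b (\<phi> n) (\<psi> n)) \<longlonglongrightarrow> c)"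

text \<open>\<open>friedrichs_laplacian b m f g\<close>: \<open>f\<close> lies in the domain of the self-adjoint operator
  \<open>\<Delta>\<close> of the closed form, and \<open>\<Delta> f = g\<close>.\<close>

definition friedrichs_laplacian ::
    "('a \<Rightarrow> 'a \<Rightarrow> real) \<Rightarrow> ('a \<Rightarrow> real) \<Rightarrow> ('a \<Rightarrow> real) \<Rightarrow> ('a \<Rightarrow> real) \<Rightarrow> bool" where
  "friedrichs_laplacian b m f g \<longleftrightarrow>
     f \<in> form_dom b m \<and> g \<in> l2 m \<and>
     (\<forall>h \<in> form_dom b m. closed_form b m f h = l2_inner m g h)"


section \<open>The heat semigroup\<close>

definition C0_semigroup ::
    "('a \<Rightarrow> real) \<Rightarrow> (real \<Rightarrow> ('a \<Rightarrow> real) \<Rightarrow> ('a \<Rightarrow> real)) \<Rightarrow> bool" where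
  "C0_semigroup m P \<longleftrightarrow>
     (\<forall>t\<ge>0. \<forall>f \<in> l2 m. P t f \<in> l2 m) \<and>
     (\<forall>t\<ge>0. \<forall>f \<in> l2 m. \<forall>g \<in> l2 m. \<forall>c d.
        P t (\<lambda>x. c * f x + d * g x) = (\<lambda>x. c * P t f x + d * P t g x)) \<and>
     (\<forall>t\<ge>0. \<exists>K. \<forall>f \<in> l2 m. l2_norm m (P t f) \<le> K * l2_norm m f) \<and>
     (\<forall>f \<in> l2 m. P 0 f = f) \<and>
     (\<forall>s\<ge>0. \<forall>t\<ge>0. \<forall>f \<in> l2 m. P (s + t) f = P s (P t f)) \<and>
     (\<forall>f \<in> l2 m. ((\<lambda>t. l2_norm m (\<lambda>x. P t f x - f x)) \<longlongrightarrow> 0) (at_right 0))"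

text \<open>\<open>f\<close> is in the domain of the infinitesimal generator of \<open>P\<close>, which maps \<open>f\<close> to \<open>g\<close>.\<close>

definition generator ::
    "('a \<Rightarrow> real) \<Rightarrow> (real \<Rightarrow> ('a \<Rightarrow> real) \<Rightarrow> ('a \<Rightarrow> real)) \<Rightarrow>
     ('a \<Rightarrow> real) \<Rightarrow> ('a \<Rightarrow> real) \<Rightarrow> bool" where
  "generator m P f g \<longleftrightarrow>
     f \<in> l2 m \<and> g \<in> l2 m \<and>
     ((\<lambda>t. l2_norm m (\<lambda>x. (P t f x - f x) / t - g x)) \<longlongrightarrow> 0) (at_right 0)"

text \<open>\<open>exp (- t \<Delta>)\<close> is the strongly continuous semigroup on \<open>l2\<close> with generator \<open>- \<Delta>\<close>.  It exists
  and is unique; the choice operator only leaves open the irrelevant values of \<open>P t f\<close> for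
  \<open>t < 0\<close> or \<open>f \<notin> l2 m\<close>.\<close>

definition heat_semigroup ::
    "('a \<Rightarrow> 'a \<Rightarrow> real) \<Rightarrow> ('a \<Rightarrow> real) \<Rightarrow> real \<Rightarrow> ('a \<Rightarrow> real) \<Rightarrow> ('a \<Rightarrow> real)" where
  "heat_semigroup b m =
     (SOME P. C0_semigroup m P \<and>
        (\<forall>f g. generator m P f g \<longleftrightarrow> friedrichs_laplacian b m f (\<lambda>x. - g x)))"

text \<open>The kernel of \<open>exp (- t \<Delta>)\<close> with respect to \<open>m\<close>: the identity
  \<open>P t f x = (\<Sum>\<^sub>\<infinity>y. p t x y * f y * m y)\<close> for the indicator \<open>f\<close> of \<open>{y}\<close> determines \<open>p t x y\<close>.\<close>

definition heat_kernel ::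
    "('a \<Rightarrow> 'a \<Rightarrow> real) \<Rightarrow> ('a \<Rightarrow> real) \<Rightarrow> real \<Rightarrow> 'a \<Rightarrow> 'a \<Rightarrow> real" where
  "heat_kernel b m t x y = heat_semigroup b m t (indicator {y}) x / m y"

definition heat_action ::
    "('a \<Rightarrow> 'a \<Rightarrow> real) \<Rightarrow> ('a \<Rightarrow> real) \<Rightarrow> real \<Rightarrow> ('a \<Rightarrow> real) \<Rightarrow> ('a \<Rightarrow> real)" where
  "heat_action b m t f = (\<lambda>x. \<Sum>\<^sub>\<infinity>y. heat_kernel b m t x y * f y * m y)"

text \<open>The closure of \<open>Cc\<close> in the supremum norm, i.e. the functions vanishing at infinity.\<close>

definition C0 :: "('a \<Rightarrow> real) set" where
  "C0 = {f. \<forall>\<epsilon>>0. \<exists>\<phi>\<in>Cc. \<forall>x. \<bar>f x - \<phi> x\<bar> \<le> \<epsilon>}"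

definition feller :: "('a \<Rightarrow> 'a \<Rightarrow> real) \<Rightarrow> ('a \<Rightarrow> real) \<Rightarrow> bool" where
  "feller b m \<longleftrightarrow> (\<forall>t\<ge>0. \<forall>f\<in>C0. heat_action b m t f \<in> C0)"

end

theory Submission
  imports Defs
begin

text \<open>Multiplied by the positive number \<open>f(r) - f(r + 1)\<close>, the curvature condition says that
  \<open>(\<Delta> + \<alpha>) f \<ge> 0\<close> outside a ball, where \<open>\<alpha> = - l > 0\<close>, because the Laplacian of a radial
  function only involves the neighbouring spheres (\<open>lap_radial\<close>). So \<open>f\<close> is a positive
  supersolution outside a finite set that vanishes at infinity. It dominates the heat kernel:
  \<open>p\<^sub>t(x, y) m(y) \<le> c exp (2 \<alpha> t) f(x)\<close> with \<open>c\<close> depending on \<open>y\<close>. Hence each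
  function \<open>p\<^sub>t(\<cdot>, y)\<close> vanishes at infinity, and since the kernel is nonnegative with row sums
  at most one, so does \<open>P\<^sub>t g\<close> for every \<open>g\<close> vanishing at infinity
  (\<open>feller_if_supersolution\<close>).

  The domination is proved for the implicit Euler scheme. A step \<open>(1 + h \<Delta>)\<inverse> g\<close> minimises
  \<open>\<phi> \<mapsto> |\<phi> - g|\<^sup>2 + h E(\<phi>, \<phi>)\<close> over finitely supported functions, and truncating at a
  function \<open>v\<close> with \<open>v + h \<Delta>v \<ge> g\<close> does not increase this functional; so the step stays below
  \<open>v\<close> (\<open>res_le\<close>). With \<open>v = 0\<close> and \<open>v = 1\<close> this gives positivity and the
  bound on the row sums. With \<open>v = min (c f) 1\<close>, for which no exceptional set remains
  once \<open>c f \<ge> 1\<close> on the exceptional finite set, it gives the domination by \<open>f\<close>, the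
  constant growing by at most the factor \<open>1 + 2 \<alpha> h\<close> in each step (\<open>res_le_min\<close>).

  The heat semigroup is characterised by its generator, so it has to be identified with the limit
  of the Euler scheme (\<open>heat_semigroup_eq\<close>). This takes three general facts. The minimisation
  above yields the resolvents of the Friedrichs extension of a nonnegative symmetric operator
  (\<open>res_mem_friedrichs\<close>). For contractive resolvents the dyadic Euler scheme converges to a
  contraction semigroup with the expected generator, because
  \<open>(1 + a A) (1 + b A) = 1 + (a + b) A + a b A\<^sup>2\<close> makes the scheme consistent to second order
  (\<open>norm_J_add_minus_le\<close>, \<open>semi_deriv\<close>, \<open>semi_deriv_imp_A\<close>). Finally, no other
  strongly continuous semigroup has the same generator (\<open>semi_unique\<close>).\<close>

section \<open>The Hilbert space of square summable functions\<close>

lemma summable_on_mult_of_squares: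
  fixes f g :: "'a \<Rightarrow> real"
  assumes "(\<lambda>x. (f x)\<^sup>2) summable_on UNIV" and "(\<lambda>x. (g x)\<^sup>2) summable_on UNIV"
  shows "(\<lambda>x. f x * g x) summable_on UNIV"
proof -
  have "(\<lambda>x. norm (f x * g x)) summable_on UNIV"
    by (rule abs_summable_product) (use assms in \<open>simp_all add: power2_eq_square\<close>)
  then show ?thesis
    by (rule abs_summable_summable)
qed

lemma summable_on_square_add:
  fixes f g :: "'a \<Rightarrow> real"
  assumes "(\<lambda>x. (f x)\<^sup>2) summable_on UNIV" and "(\<lambda>x. (g x)\<^sup>2) summable_on UNIV"
  shows "(\<lambda>x. (f x + g x)\<^sup>2) summable_on UNIV"
proof -
  have "(\<lambda>x. (f x)\<^sup>2 + 2 * (f x * g x) + (g x)\<^sup>2) summable_on UNIV"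
    by (intro summable_on_add summable_on_cmult_right summable_on_mult_of_squares assms)
  then show ?thesis
    by (simp add: power2_eq_square algebra_simps)
qed

text \<open>The measure does not enter this type: \<open>l2 m\<close> is mapped to it isometrically by
  \<open>f \<mapsto> f \<surd>m\<close> below, so that one type serves every vertex measure.\<close>

typedef 'a ell2 = "{f :: 'a \<Rightarrow> real. (\<lambda>x. (f x)\<^sup>2) summable_on UNIV}"
  morphisms ell2_fun ell2_of
  by (rule exI[of _ "\<lambda>_. 0"]) simp

lemma ell2_fun_summable: "(\<lambda>x. (ell2_fun f x)\<^sup>2) summable_on UNIV"
  using ell2_fun[of f] by simp

lemma ell2_eqI: "(\<And>x. ell2_fun f x = ell2_fun g x) \<Longrightarrow> f = g"
  by (simp add: ell2_fun_inject[symmetric] ext)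

instantiation ell2 :: (type) real_vector
begin

definition "0 = ell2_of (\<lambda>_. 0)"
definition "f + g = ell2_of (\<lambda>x. ell2_fun f x + ell2_fun g x)"
definition "- f = ell2_of (\<lambda>x. - ell2_fun f x)"
definition "f - g = ell2_of (\<lambda>x. ell2_fun f x - ell2_fun g x)"
definition "c *\<^sub>R f = ell2_of (\<lambda>x. c * ell2_fun f x)"
lemma ell2_fun_zero: "ell2_fun 0 x = 0"
  by (simp add: zero_ell2_def ell2_of_inverse)

lemma ell2_fun_add: "ell2_fun (f + g) x = ell2_fun f x + ell2_fun g x"
  by (simp add: plus_ell2_def ell2_of_inverse summable_on_square_add ell2_fun_summable)

lemma ell2_fun_scaleR: "ell2_fun (c *\<^sub>R f) x = c * ell2_fun f x"
  by (simp add: scaleR_ell2_def ell2_of_inverse power_mult_distrib summable_on_cmult_right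
      ell2_fun_summable)

lemma ell2_fun_uminus: "ell2_fun (- f) x = - ell2_fun f x"
  by (simp add: uminus_ell2_def ell2_of_inverse ell2_fun_summable)

lemma ell2_fun_diff: "ell2_fun (f - g) x = ell2_fun f x - ell2_fun g x"
  using summable_on_square_add[OF ell2_fun_summable[of f] ell2_fun_summable[of "- g"]]
  by (simp add: minus_ell2_def ell2_of_inverse ell2_fun_uminus)

lemmas ell2_fun_simps =
  ell2_fun_zero ell2_fun_add ell2_fun_scaleR ell2_fun_uminus ell2_fun_diff

instance
  by standard (auto intro!: ell2_eqI simp: ell2_fun_simps algebra_simps)

end

instantiation ell2 :: (type) real_inner
begin

definition "inner f g = (\<Sum>\<^sub>\<infinity>x. ell2_fun f x * ell2_fun g x)"
definition "norm (f :: 'a ell2) = sqrt (inner f f)"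
definition "sgn (f :: 'a ell2) = f /\<^sub>R norm f"
definition "dist f g = norm (f - g :: 'a ell2)"
definition "(uniformity :: ('a ell2 \<times> 'a ell2) filter) =
  (INF e\<in>{0<..}. principal {(x, y). dist x y < e})"
definition "open (U :: 'a ell2 set) \<longleftrightarrow>
  (\<forall>x\<in>U. eventually (\<lambda>(x', y). x' = x \<longrightarrow> y \<in> U) uniformity)"

instance
proof
  fix f g h :: "'a ell2" and c :: real
  have s: "(\<lambda>x. ell2_fun u x * ell2_fun v x) summable_on UNIV" for u v :: "'a ell2"
    by (intro summable_on_mult_of_squares ell2_fun_summable)
  show "sgn f = f /\<^sub>R norm f" "dist f g = norm (f - g)"
    by (simp_all add: sgn_ell2_def dist_ell2_def)
  show "(uniformity :: ('a ell2 \<times> 'a ell2) filter) =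
      (INF e\<in>{0<..}. principal {(x, y). dist x y < e})"
    by (simp add: uniformity_ell2_def)
  show "open U \<longleftrightarrow> (\<forall>x\<in>U. eventually (\<lambda>(x', y). x' = x \<longrightarrow> y \<in> U) uniformity)"
    for U :: "'a ell2 set"
    by (simp add: open_ell2_def)
  show "inner f g = inner g f"
    by (simp add: inner_ell2_def mult.commute)
  show "inner (f + g) h = inner f h + inner g h"
    by (simp add: inner_ell2_def ell2_fun_simps algebra_simps infsum_add s)
  show "inner (c *\<^sub>R f) g = c * inner f g"
    by (simp add: inner_ell2_def ell2_fun_simps mult.assoc infsum_cmult_right')
  show "0 \<le> inner f f"
    by (simp add: inner_ell2_def infsum_nonneg)
  show "inner f f = 0 \<longleftrightarrow> f = 0"
  proof
    assume "inner f f = 0"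
    then have "ell2_fun f x * ell2_fun f x = 0" for x
      using nonneg_infsum_le_0D[where f = "\<lambda>x. ell2_fun f x * ell2_fun f x" and A = UNIV] s
      by (simp add: inner_ell2_def)
    then show "f = 0"
      by (auto intro!: ell2_eqI simp: ell2_fun_simps)
  qed (simp add: inner_ell2_def ell2_fun_simps)
  show "norm f = sqrt (inner f f)"
    by (simp add: norm_ell2_def)
qed

end

lemma norm_ell2_power2: "(norm f)\<^sup>2 = (\<Sum>\<^sub>\<infinity>x. (ell2_fun f x)\<^sup>2)"
  by (simp only: power2_norm_eq_inner inner_ell2_def) (simp add: power2_eq_square)

lemma sum_square_le_norm_ell2: "finite F \<Longrightarrow> (\<Sum>x\<in>F. (ell2_fun f x)\<^sup>2) \<le> (norm f)\<^sup>2"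
  unfolding norm_ell2_power2 by (intro finite_sum_le_infsum ell2_fun_summable) auto

lemma abs_ell2_fun_le_norm: "\<bar>ell2_fun f x\<bar> \<le> norm f"
  using sum_square_le_norm_ell2[of "{x}" f] by (simp add: abs_le_square_iff[symmetric])

lemma bounded_linear_ell2_fun: "bounded_linear (\<lambda>f. ell2_fun f x)"
  by (rule bounded_linear_intro[where K = 1]) (simp_all add: ell2_fun_simps abs_ell2_fun_le_norm)

text \<open>A Cauchy sequence converges pointwise; bounding all finite partial sums of squares puts the
  pointwise limit into the space and upgrades the convergence to norm convergence.\<close>

instance ell2 :: (type) complete_space
proof
  fix X :: "nat \<Rightarrow> 'a ell2"
  assume X: "Cauchy X"
  have "Cauchy (\<lambda>n. ell2_fun (X n) x)" for x
  proof (rule metric_CauchyI)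
    fix e :: real
    assume "0 < e"
    then obtain M where M: "\<forall>m\<ge>M. \<forall>n\<ge>M. dist (X m) (X n) < e"
      using metric_CauchyD[OF X] by blast
    have le: "dist (ell2_fun (X m) x) (ell2_fun (X n) x) \<le> dist (X m) (X n)" for m n
      using abs_ell2_fun_le_norm[of "X m - X n" x] by (simp add: ell2_fun_diff dist_norm)
    show "\<exists>M. \<forall>m\<ge>M. \<forall>n\<ge>M. dist (ell2_fun (X m) x) (ell2_fun (X n) x) < e"
      using M by (intro exI[of _ M] allI impI le_less_trans[OF le]) blast
  qed
  then have f: "(\<lambda>n. ell2_fun (X n) x) \<longlonglongrightarrow> lim (\<lambda>n. ell2_fun (X n) x)" for x
    by (simp only: Cauchy_convergent_iff convergent_LIMSEQ_iff)
  define f where "f x = lim (\<lambda>n. ell2_fun (X n) x)" for x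
  note f = f[folded f_def]
  have tail: "\<exists>M. \<forall>n\<ge>M. \<forall>F. finite F \<longrightarrow> (\<Sum>x\<in>F. (ell2_fun (X n) x - f x)\<^sup>2) \<le> e\<^sup>2"
    if "0 < e" for e :: real
  proof -
    obtain M where M: "\<And>m n. m \<ge> M \<Longrightarrow> n \<ge> M \<Longrightarrow> dist (X m) (X n) < e"
      using metric_CauchyD[OF X \<open>0 < e\<close>] by blast
    have "(\<Sum>x\<in>F. (ell2_fun (X n) x - f x)\<^sup>2) \<le> e\<^sup>2" if "n \<ge> M" "finite F" for n F
    proof (rule LIMSEQ_le_const2)
      show "(\<lambda>k. \<Sum>x\<in>F. (ell2_fun (X n) x - ell2_fun (X k) x)\<^sup>2)
          \<longlonglongrightarrow> (\<Sum>x\<in>F. (ell2_fun (X n) x - f x)\<^sup>2)"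
        by (intro tendsto_intros f)
      have "(\<Sum>x\<in>F. (ell2_fun (X n) x - ell2_fun (X k) x)\<^sup>2) \<le> e\<^sup>2" if "k \<ge> M" for k
      proof -
        have "(\<Sum>x\<in>F. (ell2_fun (X n) x - ell2_fun (X k) x)\<^sup>2) \<le> (norm (X n - X k))\<^sup>2"
          using sum_square_le_norm_ell2[OF \<open>finite F\<close>, of "X n - X k"] by (simp add: ell2_fun_simps)
        also have "\<dots> \<le> e\<^sup>2"
          using M[OF \<open>n \<ge> M\<close> \<open>k \<ge> M\<close>] by (intro power_mono) (auto simp: dist_norm)
        finally show ?thesis .
      qed
      then show "\<exists>N. \<forall>k\<ge>N. (\<Sum>x\<in>F. (ell2_fun (X n) x - ell2_fun (X k) x)\<^sup>2) \<le> e\<^sup>2"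
        by blast
    qed
    then show ?thesis by blast
  qed
  have summ: "(\<lambda>x. (ell2_fun (X n) x - f x)\<^sup>2) summable_on UNIV"
    if "\<forall>F. finite F \<longrightarrow> (\<Sum>x\<in>F. (ell2_fun (X n) x - f x)\<^sup>2) \<le> e\<^sup>2" for n e
    by (rule nonneg_bdd_above_summable_on) (use that in \<open>auto intro!: bdd_aboveI2\<close>)
  obtain M where M: "\<forall>F. finite F \<longrightarrow> (\<Sum>x\<in>F. (ell2_fun (X M) x - f x)\<^sup>2) \<le> 1\<^sup>2"
    using tail[of 1] by auto
  have "(\<lambda>x. (f x)\<^sup>2) summable_on UNIV"
    using summable_on_square_add[of "\<lambda>x. f x - ell2_fun (X M) x" "ell2_fun (X M)"]
      summ[OF M] ell2_fun_summable[of "X M"] by (simp add: power2_commute)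
  then have ell2_f: "ell2_fun (ell2_of f) = f"
    by (simp add: ell2_of_inverse)
  have "X \<longlonglongrightarrow> ell2_of f"
  proof (rule metric_LIMSEQ_I)
    fix r :: real
    assume "0 < r"
    then obtain N where N: "\<And>n F. n \<ge> N \<Longrightarrow> finite F \<Longrightarrow>
        (\<Sum>x\<in>F. (ell2_fun (X n) x - f x)\<^sup>2) \<le> (r/2)\<^sup>2"
      using tail[of "r/2"] by auto
    have "dist (X n) (ell2_of f) < r" if "n \<ge> N" for n
    proof -
      have "(norm (X n - ell2_of f))\<^sup>2 \<le> (r/2)\<^sup>2"
        unfolding norm_ell2_power2 ell2_fun_simps ell2_f
        by (intro infsum_le_finite_sums N that) (use N that in \<open>auto intro: summ\<close>)
      then have "norm (X n - ell2_of f) \<le> r/2"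
        using \<open>0 < r\<close> by (simp add: abs_le_square_iff[symmetric])
      then show ?thesis
        using \<open>0 < r\<close> by (simp add: dist_norm)
    qed
    then show "\<exists>no. \<forall>n\<ge>no. dist (X n) (ell2_of f) < r"
      by blast
  qed
  then show "convergent X"
    by (rule convergentI)
qed

instance ell2 :: (type) banach ..

section \<open>Contraction semigroups from resolvents\<close>

text \<open>An m-accretive operator, given by its graph \<open>A\<close> so that relations such as
  \<open>(u, v) \<in> A\<close> record the domain and the value at once, together with its resolvents
  \<open>J h = (1 + h A)\<inverse>\<close>. The convergence \<open>J h g \<rightarrow> g\<close> takes the place of a
  dense domain. The aim is the semigroup \<open>exp (- t A)\<close>, obtained from the implicit Euler scheme;
  this route turns every property of the resolvents that survives iteration and limits into a
  property of the semigroup.\<close>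

locale accretive_operator =
  fixes A :: "('b :: banach \<times> 'b) set" and J :: "real \<Rightarrow> 'b \<Rightarrow> 'b"
  assumes subspace_A: "subspace A"
    and J_mem: "0 < h \<Longrightarrow> (J h g, (g - J h g) /\<^sub>R h) \<in> A"
    and J_unique: "0 < h \<Longrightarrow> (u, w) \<in> A \<Longrightarrow> J h (u + h *\<^sub>R w) = u"
    and norm_J_le: "0 < h \<Longrightarrow> norm (J h g) \<le> norm g"
    and J_tendsto: "((\<lambda>h. J h g) \<longlongrightarrow> g) (at_right 0)"
begin

lemma A_add: "(u, v) \<in> A \<Longrightarrow> (u', v') \<in> A \<Longrightarrow> (u + u', v + v') \<in> A"
  using subspace_add[OF subspace_A] by fastforce

lemma A_scale: "(u, v) \<in> A \<Longrightarrow> (c *\<^sub>R u, c *\<^sub>R v) \<in> A"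
  using subspace_scale[OF subspace_A] by fastforce

lemma A_diff: "(u, v) \<in> A \<Longrightarrow> (u', v') \<in> A \<Longrightarrow> (u - u', v - v') \<in> A"
  using subspace_diff[OF subspace_A] by fastforce

lemma J_eqI: "0 < h \<Longrightarrow> (u, w) \<in> A \<Longrightarrow> g = u + h *\<^sub>R w \<Longrightarrow> J h g = u"
  using J_unique by blast

lemma J_add: "0 < h \<Longrightarrow> J h (f + g) = J h f + J h g"
  by (rule J_eqI[OF _ A_add[OF J_mem J_mem]]) (auto simp: algebra_simps)

lemma J_scale: "0 < h \<Longrightarrow> J h (c *\<^sub>R f) = c *\<^sub>R J h f"
  by (rule J_eqI[OF _ A_scale[OF J_mem]]) (auto simp: algebra_simps)

lemma linear_J: "0 < h \<Longrightarrow> linear (J h)"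
  by (intro linearI J_add J_scale)

lemma J_diff: "0 < h \<Longrightarrow> J h (f - g) = J h f - J h g"
  by (rule linear_diff[OF linear_J])

lemma A_J: "0 < h \<Longrightarrow> (u, w) \<in> A \<Longrightarrow> (J h u, J h w) \<in> A"
proof -
  assume h: "0 < h" and uw: "(u, w) \<in> A"
  have "J h u + h *\<^sub>R J h w = u"
    using J_unique[OF h uw] by (simp add: J_add J_scale h)
  then have "u - J h u = h *\<^sub>R J h w"
    by (simp add: algebra_simps)
  then have "J h w = (u - J h u) /\<^sub>R h"
    using h by simp
  then show "(J h u, J h w) \<in> A"
    using J_mem[OF h] by metis
qed

lemma J_commute: "0 < a \<Longrightarrow> 0 < b \<Longrightarrow> J a (J b g) = J b (J a g)"
proof -
  assume a: "0 < a" and b: "0 < b"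
  have "(J a (J b g), J a ((g - J b g) /\<^sub>R b)) \<in> A"
    using A_J[OF a J_mem[OF b]] .
  from J_unique[OF b this] show ?thesis
    using a b by (simp add: J_scale J_diff)
qed

lemma norm_J_minus_le: "0 < h \<Longrightarrow> (u, w) \<in> A \<Longrightarrow> norm (J h u - u) \<le> h * norm w"
proof -
  assume h: "0 < h" and uw: "(u, w) \<in> A"
  have "J h u - u = - h *\<^sub>R J h w"
    using J_unique[OF h uw] h by (simp add: J_add J_scale algebra_simps)
  then show ?thesis
    using norm_J_le[OF h, of w] h by (simp add: norm_minus_commute)
qed

text \<open>The factorisation \<open>(1 + a A) (1 + b A) = 1 + (a + b) A + a b A\<^sup>2\<close> shows that one implicit
  Euler step of size \<open>a + b\<close> differs from two steps of sizes \<open>a\<close> and \<open>b\<close> only to second order.\<close>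

lemma norm_J_add_minus_le:
  assumes a: "0 < a" and b: "0 < b" and uv: "(u, v) \<in> A" and vw: "(v, w) \<in> A"
  shows "norm (J (a + b) u - J a (J b u)) \<le> a * b * norm w"
proof -
  have ab: "0 < a + b" using a b by simp
  have u: "J (a + b) (u + (a + b) *\<^sub>R v) = u"
    by (rule J_unique[OF ab uv])
  have ub: "J b (u + b *\<^sub>R v) = u" and vb: "J b (v + b *\<^sub>R w) = v"
    using J_unique[OF b] uv vw by auto
  have ua: "J a (u + a *\<^sub>R v) = u"
    by (rule J_unique[OF a uv])
  have "J a (J b (u + (a + b) *\<^sub>R v + (a * b) *\<^sub>R w)) = J a (J b (u + b *\<^sub>R v) + a *\<^sub>R J b (v + b *\<^sub>R w))"
    using a b by (simp add: J_add J_scale algebra_simps)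
  then have e1: "J a (J b (u + (a + b) *\<^sub>R v + (a * b) *\<^sub>R w)) = u"
    by (simp add: ub vb ua)
  have "J (a + b) u - J a (J b u) =
      J (a + b) (J a (J b (u + (a + b) *\<^sub>R v + (a * b) *\<^sub>R w)))
      - J a (J b (J (a + b) (u + (a + b) *\<^sub>R v)))"
    by (simp add: e1 u)
  also have "\<dots> = (a * b) *\<^sub>R J (a + b) (J a (J b w))"
    using a b ab J_commute[OF ab b] J_commute[OF ab a] by (simp add: J_add J_scale)
  finally have "norm (J (a + b) u - J a (J b u)) = a * b * norm (J (a + b) (J a (J b w)))"
    using a b by simp
  also have "\<dots> \<le> a * b * norm w"
    using order_trans[OF norm_J_le[OF ab] order_trans[OF norm_J_le[OF a] norm_J_le[OF b]]] a b
    by (intro mult_left_mono) auto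
  finally show ?thesis .
qed

text \<open>The domain of \<open>A\<^sup>2\<close>, on which the Euler scheme has a quantitative error. It
  contains the range of \<open>J h \<circ> J h\<close> and is therefore dense.\<close>

definition A2_dom :: "'b set" where "A2_dom = {u. \<exists>v w. (u, v) \<in> A \<and> (v, w) \<in> A}"

lemma J_J_mem_A2_dom:
  assumes h: "0 < h"
  shows "J h (J h g) \<in> A2_dom"
  unfolding A2_dom_def mem_Collect_eq
  using A_J[OF h J_mem[OF h, of g]] J_mem[OF h, of "(g - J h g) /\<^sub>R h"] by blast

lemma ex_A2_dom_near: "0 < e \<Longrightarrow> \<exists>v\<in>A2_dom. norm (v - g) < e"
proof -
  assume e: "0 < e"
  have "eventually (\<lambda>h. 0 < h \<and> norm (J h g - g) < e/2) (at_right 0)"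
    using tendstoD[OF J_tendsto, of "e/2" g] e
    by (intro eventually_conj eventually_at_right_less) (simp add: dist_norm)
  from eventually_happens'[OF trivial_limit_at_right_real this]
  obtain h where h: "0 < h" "norm (J h g - g) < e/2" by blast
  have "norm (J h (J h g) - g) \<le> norm (J h (J h g - g)) + norm (J h g - g)"
    using norm_triangle_ineq[of "J h (J h g - g)" "J h g - g"] h by (simp add: J_diff)
  then have "norm (J h (J h g) - g) < e"
    using h norm_J_le[OF h(1), of "J h g - g"] by simp
  then show ?thesis
    using J_J_mem_A2_dom[OF h(1)] by blast
qed

end

text \<open>Exchanging one factor at a time turns a one-step error into an error after \<open>n\<close> steps.
  The powers of \<open>T\<close> are only assumed bounded by \<open>K\<close>, because \<open>T\<close> will
  also be a time step of a semigroup that is not known to be contractive.\<close>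

lemma norm_funpow_diff_le:
  fixes S T :: "'b :: real_normed_vector \<Rightarrow> 'b"
  assumes "linear S" and "linear T" and comm: "\<And>x. S (T x) = T (S x)"
    and S: "\<And>x. norm (S x) \<le> norm x" and T: "\<And>k x. k < n \<Longrightarrow> norm ((T ^^ k) x) \<le> K * norm x"
  shows "norm ((S ^^ n) u - (T ^^ n) u) \<le> n * (K * norm (S u - T u))"
  using T
proof (induction n)
  case 0
  then show ?case by simp
next
  case (Suc n)
  have comm': "S ((T ^^ k) x) = (T ^^ k) (S x)" for k x
    by (induction k) (simp_all add: comm)
  have lin: "linear (T ^^ k)" for k
    by (induction k) (auto simp only: funpow.simps intro: linear_id linear_compose[OF _ \<open>linear T\<close>])
  have "(S ^^ Suc n) u - (T ^^ Suc n) u = S ((S ^^ n) u - (T ^^ n) u) + (T ^^ n) (S u - T u)"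
    using comm'[of n u] by (simp add: linear_diff[OF \<open>linear S\<close>] linear_diff[OF lin] funpow_swap1)
  also have "norm \<dots> \<le> norm ((S ^^ n) u - (T ^^ n) u) + K * norm (S u - T u)"
    by (rule norm_triangle_le[OF add_mono[OF S]]) (simp add: Suc.prems)
  also have "\<dots> \<le> n * (K * norm (S u - T u)) + K * norm (S u - T u)"
    using Suc by simp
  also have "\<dots> = Suc n * (K * norm (S u - T u))"
    by (simp add: algebra_simps)
  finally show ?case .
qed


lemma funpow_comp_commute:
  assumes "\<And>x. f (g x) = g (f x)"
  shows "((\<lambda>x. f (g x)) ^^ n) x = (f ^^ n) ((g ^^ n) x)"
proof -
  have *: "g ((f ^^ k) y) = (f ^^ k) (g y)" for k y
    by (induction k) (simp_all add: assms[symmetric])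
  show ?thesis
    by (induction n) (simp_all add: *)
qed

context accretive_operator
begin

lemma linear_J_funpow: "0 < h \<Longrightarrow> linear (J h ^^ n)"
  by (induction n) (auto simp only: funpow.simps intro: linear_id linear_compose[OF _ linear_J])

lemma norm_J_funpow_le: "0 < h \<Longrightarrow> norm ((J h ^^ n) u) \<le> norm u"
  by (induction n) (auto intro: order_trans[OF norm_J_le])

lemma norm_J_add_funpow_minus_le:
  assumes a: "0 < a" and b: "0 < b" and uv: "(u, v) \<in> A" and vw: "(v, w) \<in> A"
  shows "norm ((J (a + b) ^^ n) u - (J a ^^ n) ((J b ^^ n) u)) \<le> n * (a * b * norm w)"
proof -
  have ab: "0 < a + b" using a b by simp
  have T: "((\<lambda>x. J a (J b x)) ^^ n) x = (J a ^^ n) ((J b ^^ n) x)" for n x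
    by (rule funpow_comp_commute) (rule J_commute[OF a b])
  have "norm ((J (a + b) ^^ n) u - ((\<lambda>x. J a (J b x)) ^^ n) u)
      \<le> n * (1 * norm (J (a + b) u - J a (J b u)))"
  proof (rule norm_funpow_diff_le)
    show "linear (J (a + b))" "linear (\<lambda>x. J a (J b x))"
      using linear_compose[OF linear_J[OF b] linear_J[OF a]] linear_J[OF ab] by (auto simp: o_def)
    show "J (a + b) (J a (J b x)) = J a (J b (J (a + b) x))" for x
      using a b ab by (simp add: J_commute[of "a + b"])
    show "norm (J (a + b) x) \<le> norm x" for x
      by (rule norm_J_le[OF ab])
    show "norm (((\<lambda>x. J a (J b x)) ^^ k) x) \<le> 1 * norm x" for k x
      unfolding T using order_trans[OF norm_J_funpow_le[OF a] norm_J_funpow_le[OF b]] by simp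
  qed
  also have "\<dots> \<le> n * (a * b * norm w)"
    using norm_J_add_minus_le[OF assms] by (intro mult_left_mono) auto
  finally show ?thesis
    by (simp add: T)
qed

text \<open>The number of steps runs through powers of two, so that passing from one approximation to the
  next one just halves the step.\<close>

definition euler :: "real \<Rightarrow> nat \<Rightarrow> 'b \<Rightarrow> 'b" where
  "euler t k u = (J (t / 2 ^ k) ^^ (2 ^ k)) u"

text \<open>The resolvents are only available for positive steps, hence the separate value for \<open>t \<le> 0\<close>.\<close>

definition semi :: "real \<Rightarrow> 'b \<Rightarrow> 'b" where
  "semi t u = (if t \<le> 0 then u else lim (\<lambda>k. euler t k u))"

lemma semi_zero: "semi 0 u = u"
  by (simp add: semi_def)

lemma linear_euler: "0 < t \<Longrightarrow> linear (euler t k)"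
  using linear_J_funpow[of "t / 2 ^ k" "2 ^ k"] by (simp add: euler_def[abs_def])

lemma norm_euler_le: "0 < t \<Longrightarrow> norm (euler t k u) \<le> norm u"
  by (simp add: euler_def norm_J_funpow_le)

text \<open>Halving the step \<open>2 h\<close> costs at most \<open>h\<^sup>2\<close> per step, and there are
  \<open>t / (2 h)\<close> steps; the resulting geometric series telescopes.\<close>

lemma norm_euler_diff_le:
  assumes t: "0 < t" and uv: "(u, v) \<in> A" and vw: "(v, w) \<in> A"
  shows "norm (euler t k u - euler t (k + j) u) \<le> t\<^sup>2 * norm w / 2 * (1 / 2 ^ k - 1 / 2 ^ (k + j))"
proof (induction j)
  case 0
  then show ?case by simp
next
  case (Suc j)
  define h where "h = t / 2 ^ Suc (k + j)"
  have h: "0 < h" "h + h = t / 2 ^ (k + j)"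
    using t by (simp_all add: h_def field_simps)
  have "norm ((J (h + h) ^^ (2 ^ (k + j))) u - (J h ^^ (2 ^ (k + j))) ((J h ^^ (2 ^ (k + j))) u))
      \<le> real (2 ^ (k + j)) * (h * h * norm w)"
    by (rule norm_J_add_funpow_minus_le[OF h(1) h(1) uv vw])
  also have "(J h ^^ (2 ^ (k + j))) ((J h ^^ (2 ^ (k + j))) u) = (J h ^^ (2 ^ Suc (k + j))) u"
    by (simp add: funpow_add mult_2)
  also have "real (2 ^ (k + j)) * (h * h * norm w)
      = t\<^sup>2 * norm w / 2 * (1 / 2 ^ (k + j) - 1 / 2 ^ Suc (k + j))"
    by (simp add: h_def power2_eq_square field_simps)
  finally have "norm (euler t (k + j) u - euler t (k + Suc j) u)
      \<le> t\<^sup>2 * norm w / 2 * (1 / 2 ^ (k + j) - 1 / 2 ^ Suc (k + j))"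
    unfolding h(2) by (simp only: euler_def h_def add_Suc_right)
  then have "norm (euler t k u - euler t (k + Suc j) u)
      \<le> t\<^sup>2 * norm w / 2 * (1 / 2 ^ k - 1 / 2 ^ (k + j))
        + t\<^sup>2 * norm w / 2 * (1 / 2 ^ (k + j) - 1 / 2 ^ Suc (k + j))"
    using Suc by (rule norm_diff_triangle_le[rotated])
  also have "\<dots> = t\<^sup>2 * norm w / 2 * (1 / 2 ^ k - 1 / 2 ^ (k + Suc j))"
    by (simp add: algebra_simps)
  finally show ?case .
qed

lemma Cauchy_euler_A2:
  assumes t: "0 < t" and u: "u \<in> A2_dom"
  shows "Cauchy (\<lambda>k. euler t k u)"
proof -
  obtain v w where uv: "(u, v) \<in> A" and vw: "(v, w) \<in> A"
    using u by (auto simp: A2_dom_def)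
  define c where "c = t\<^sup>2 * norm w / 2"
  have c: "0 \<le> c" by (simp add: c_def)
  have le: "norm (euler t k u - euler t l u) \<le> c * (1/2) ^ k" if "k \<le> l" for k l
  proof -
    have "norm (euler t k u - euler t l u) \<le> c * (1 / 2 ^ k - 1 / 2 ^ l)"
      using norm_euler_diff_le[OF t uv vw, of k "l - k"] that by (simp add: c_def)
    also have "\<dots> \<le> c * (1 / 2 ^ k)"
      by (intro mult_left_mono c) simp
    finally show ?thesis by (simp add: power_one_over)
  qed
  have "(\<lambda>k. c * (1/2) ^ k) \<longlonglongrightarrow> 0"
    by (intro tendsto_mult_right_zero LIMSEQ_power_zero) simp
  then show ?thesis
    unfolding Cauchy_altdef
  proof (intro allI impI)
    fix e :: real
    assume "0 < e"
    with \<open>(\<lambda>k. c * (1/2) ^ k) \<longlonglongrightarrow> 0\<close> have "eventually (\<lambda>k. c * (1/2) ^ k < e) sequentially"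
      by (rule order_tendstoD)
    then obtain M where M: "\<And>k. k \<ge> M \<Longrightarrow> c * (1/2) ^ k < e"
      by (auto simp: eventually_sequentially)
    have "dist (euler t m u) (euler t n u) < e" if "m \<ge> M" "n > m" for m n
      using le[of m n] M[of m] that by (simp add: dist_norm)
    then show "\<exists>M. \<forall>m\<ge>M. \<forall>n>m. dist (euler t m u) (euler t n u) < e"
      by blast
  qed
qed

lemma euler_tendsto:
  assumes t: "0 < t"
  shows "(\<lambda>k. euler t k u) \<longlonglongrightarrow> semi t u"
proof -
  have "Cauchy (\<lambda>k. euler t k u)"
  proof (rule metric_CauchyI)
    fix e :: real
    assume e: "0 < e"
    obtain v where v: "v \<in> A2_dom" "norm (v - u) < e/3"
      using ex_A2_dom_near[of "e/3" u] e by auto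
    obtain M where M: "\<And>m n. m \<ge> M \<Longrightarrow> n \<ge> M \<Longrightarrow> dist (euler t m v) (euler t n v) < e/3"
      using metric_CauchyD[OF Cauchy_euler_A2[OF t v(1)], of "e/3"] e by auto
    have d: "dist (euler t m v) (euler t m u) < e/3" for m
      using norm_euler_le[OF t, of m "v - u"] v(2) by (simp add: dist_norm linear_diff[OF linear_euler[OF t]])
    have "dist (euler t m u) (euler t n u) < e" if "m \<ge> M" "n \<ge> M" for m n
      using d[of m] d[of n] M[OF that] dist_triangle2[of "euler t m u" "euler t n u" "euler t n v"]
        dist_triangle3[of "euler t m u" "euler t n v" "euler t m v"]
      by (simp add: dist_commute)
    then show "\<exists>M. \<forall>m\<ge>M. \<forall>n\<ge>M. dist (euler t m u) (euler t n u) < e" by blast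
  qed
  then show ?thesis
    using t by (simp add: semi_def Cauchy_convergent_iff convergent_LIMSEQ_iff)
qed

lemma semi_add: "semi t (u + v) = semi t u + semi t v"
proof (cases "0 < t")
  case True
  show ?thesis
    by (rule LIMSEQ_unique[OF euler_tendsto[OF True]])
      (use tendsto_add[OF euler_tendsto[OF True, of u] euler_tendsto[OF True, of v]]
       in \<open>simp add: linear_add[OF linear_euler[OF True]]\<close>)
qed (simp add: semi_def)

lemma semi_scale: "semi t (c *\<^sub>R u) = c *\<^sub>R semi t u"
proof (cases "0 < t")
  case True
  show ?thesis
    by (rule LIMSEQ_unique[OF euler_tendsto[OF True]])
      (use tendsto_scaleR[OF tendsto_const euler_tendsto[OF True, of u]]
       in \<open>simp add: linear_scale[OF linear_euler[OF True]]\<close>)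
qed (simp add: semi_def)

lemma linear_semi: "linear (semi t)"
  by (intro linearI semi_add semi_scale)

lemma norm_semi_le: "norm (semi t u) \<le> norm u"
proof (cases "0 < t")
  case True
  show ?thesis
    by (rule LIMSEQ_le_const2[OF tendsto_norm[OF euler_tendsto[OF True]]])
      (use norm_euler_le[OF True] in blast)
qed (simp add: semi_def)

text \<open>Later applied to the operators of a rival semigroup, which commute with the resolvents because
  they commute with the generator.\<close>

lemma semi_commute:
  assumes "linear T" and bd: "\<And>u. norm (T u) \<le> K * norm u" and T: "\<And>h u. 0 < h \<Longrightarrow> T (J h u) = J h (T u)"
  shows "T (semi t u) = semi t (T u)"
proof (cases "0 < t")
  case True
  have "bounded_linear T"
    using \<open>linear T\<close> bd by (auto simp: bounded_linear_def bounded_linear_axioms_def mult.commute)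
  then have "(\<lambda>k. T (euler t k u)) \<longlonglongrightarrow> T (semi t u)"
    by (rule bounded_linear.tendsto[OF _ euler_tendsto[OF True]])
  moreover have "T (euler t k u) = euler t k (T u)" for k
  proof -
    have "T ((J h ^^ n) u) = (J h ^^ n) (T u)" if "0 < h" for h n
      by (induction n) (simp_all add: T that)
    then show ?thesis using True by (simp add: euler_def)
  qed
  ultimately show ?thesis
    using LIMSEQ_unique[OF _ euler_tendsto[OF True]] by simp
qed (simp add: semi_def)

text \<open>One step of size \<open>(s + t) / n\<close> agrees up to \<open>s t / n\<^sup>2\<close> with a step of size
  \<open>s / n\<close> after one of size \<open>t / n\<close>, so the accumulated error is of order \<open>1 / n\<close>.\<close>

lemma semi_mult_A2:
  assumes s: "0 < s" and t: "0 < t" and u: "u \<in> A2_dom"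
  shows "semi (s + t) u = semi s (semi t u)"
proof -
  obtain v w where uv: "(u, v) \<in> A" and vw: "(v, w) \<in> A"
    using u by (auto simp: A2_dom_def)
  have le: "norm (euler (s + t) k u - euler s k (euler t k u)) \<le> s * t * norm w * (1/2) ^ k" for k
  proof -
    have "norm (euler (s + t) k u - euler s k (euler t k u))
        \<le> real (2 ^ k) * (s / 2 ^ k * (t / 2 ^ k) * norm w)"
      using norm_J_add_funpow_minus_le[OF _ _ uv vw, of "s / 2 ^ k" "t / 2 ^ k" "2 ^ k"] s t
      by (simp add: euler_def add_divide_distrib)
    then show ?thesis
      by (simp add: power_one_over field_simps)
  qed
  have "(\<lambda>k. s * t * norm w * (1/2) ^ k) \<longlonglongrightarrow> 0"
    by (intro tendsto_mult_right_zero LIMSEQ_power_zero) simp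
  then have 1: "(\<lambda>k. euler (s + t) k u - euler s k (euler t k u)) \<longlonglongrightarrow> 0"
    by (rule Lim_null_comparison[rotated]) (use le in auto)
  have 2: "(\<lambda>k. euler s k (euler t k u) - euler s k (semi t u)) \<longlonglongrightarrow> 0"
  proof (rule Lim_null_comparison)
    show "eventually (\<lambda>k. norm (euler s k (euler t k u) - euler s k (semi t u))
        \<le> norm (euler t k u - semi t u)) sequentially"
      using norm_euler_le[OF s] by (auto simp flip: linear_diff[OF linear_euler[OF s]])
    show "(\<lambda>k. norm (euler t k u - semi t u)) \<longlonglongrightarrow> 0"
      using euler_tendsto[OF t] by (simp add: LIM_zero tendsto_norm_zero)
  qed
  have "(\<lambda>k. euler (s + t) k u - euler s k (euler t k u)
      + (euler s k (euler t k u) - euler s k (semi t u)) + euler s k (semi t u)) \<longlonglongrightarrow> 0 + 0 + semi s (semi t u)"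
    by (intro tendsto_add 1 2 euler_tendsto s)
  then have "(\<lambda>k. euler (s + t) k u) \<longlonglongrightarrow> semi s (semi t u)"
    by simp
  then show ?thesis
    using LIMSEQ_unique[OF euler_tendsto] s t by simp
qed

text \<open>Bounded operators are determined by their values on the dense set \<open>A2_dom\<close>.\<close>

lemma eq_if_eq_on_A2:
  assumes "linear S" and "linear T" and S: "\<And>u. norm (S u) \<le> K * norm u" and T: "\<And>u. norm (T u) \<le> K * norm u"
    and eq: "\<And>u. u \<in> A2_dom \<Longrightarrow> S u = (T u :: 'b)"
  shows "S u = T u"
proof -
  have "norm (S u - T u) \<le> 0 + e" if e: "0 < e" for e
  proof -
    have "0 < e / (2 * \<bar>K\<bar> + 1)" using e by simp
    from ex_A2_dom_near[OF this] obtain v where v: "v \<in> A2_dom" "norm (v - u) < e / (2 * \<bar>K\<bar> + 1)"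
      by blast
    have "S u - T u = T (v - u) - S (v - u)"
      by (simp add: linear_diff[OF \<open>linear S\<close>] linear_diff[OF \<open>linear T\<close>] eq[OF v(1)])
    then have "norm (S u - T u) \<le> K * norm (v - u) + K * norm (v - u)"
      using S[of "v - u"] T[of "v - u"] norm_triangle_ineq4[of "T (v - u)" "S (v - u)"] by simp
    also have "\<dots> \<le> (2 * \<bar>K\<bar> + 1) * norm (v - u)"
      by (simp add: algebra_simps) (smt (verit) abs_ge_self mult_right_mono norm_ge_zero)
    also have "\<dots> \<le> e"
      using v(2) by (simp add: field_simps)
    finally show ?thesis by simp
  qed
  then have "norm (S u - T u) \<le> 0"
    by (rule field_le_epsilon)
  then show ?thesis by simp
qed

lemma semi_mult: "0 \<le> s \<Longrightarrow> 0 \<le> t \<Longrightarrow> semi (s + t) u = semi s (semi t u)"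
proof (cases "0 < s \<and> 0 < t")
  case True
  show ?thesis
  proof (rule eq_if_eq_on_A2[where K = 1 and S = "semi (s + t)" and T = "\<lambda>u. semi s (semi t u)"])
    show "linear (\<lambda>u. semi s (semi t u))"
      using linear_compose[OF linear_semi[of t] linear_semi[of s]] by (simp add: o_def)
  qed (use True in \<open>auto intro: order_trans[OF norm_semi_le] simp: linear_semi norm_semi_le semi_mult_A2\<close>)
next
  case False
  moreover assume "0 \<le> s" "0 \<le> t"
  ultimately have "s = 0 \<or> t = 0" by auto
  then show ?thesis by (auto simp: semi_zero)
qed

lemma norm_semi_minus_le:
  assumes t: "0 < t" and uv: "(u, v) \<in> A"
  shows "norm (semi t u - u) \<le> t * norm v"
proof (rule LIMSEQ_le_const2)
  show "(\<lambda>k. norm (euler t k u - u)) \<longlonglongrightarrow> norm (semi t u - u)"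
    by (intro tendsto_intros euler_tendsto t)
  have "norm (euler t k u - u) \<le> t * norm v" for k
  proof -
    define h where "h = t / 2 ^ k"
    have h: "0 < h" using t by (simp add: h_def)
    have "norm ((J h ^^ n) u - (id ^^ n) u) \<le> n * (1 * norm (J h u - id u))" for n
      by (rule norm_funpow_diff_le) (auto simp: h linear_J linear_id norm_J_le)
    from this[of "2 ^ k"] have "norm (euler t k u - u) \<le> 2 ^ k * norm (J h u - u)"
      by (simp add: euler_def h_def)
    also have "\<dots> \<le> 2 ^ k * (h * norm v)"
      by (intro mult_left_mono norm_J_minus_le[OF h uv]) simp
    finally show ?thesis by (simp add: h_def)
  qed
  then show "\<exists>N. \<forall>k\<ge>N. norm (euler t k u - u) \<le> t * norm v" by blast
qed

lemma norm_semi_minus_J_le: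
  assumes t: "0 < t" and uv: "(u, v) \<in> A" and vw: "(v, w) \<in> A"
  shows "norm (J t u - semi t u) \<le> t\<^sup>2 * norm w / 2"
proof (rule LIMSEQ_le_const2)
  show "(\<lambda>k. norm (J t u - euler t k u)) \<longlonglongrightarrow> norm (J t u - semi t u)"
    by (intro tendsto_intros euler_tendsto t)
  have "norm (J t u - euler t k u) \<le> t\<^sup>2 * norm w / 2" for k
  proof -
    have "norm (J t u - euler t k u) \<le> t\<^sup>2 * norm w / 2 * (1 - 1 / 2 ^ k)"
      using norm_euler_diff_le[OF t uv vw, of 0 k] by (simp add: euler_def)
    also have "\<dots> \<le> t\<^sup>2 * norm w / 2 * 1"
      by (intro mult_left_mono) simp_all
    finally show ?thesis by simp
  qed
  then show "\<exists>N. \<forall>k\<ge>N. norm (J t u - euler t k u) \<le> t\<^sup>2 * norm w / 2" by blast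
qed

lemma semi_tendsto: "((\<lambda>t. semi t u) \<longlongrightarrow> u) (at_right 0)"
proof (rule tendstoI)
  fix e :: real
  assume e: "0 < e"
  obtain v where v: "v \<in> A2_dom" "norm (v - u) < e/3"
    using ex_A2_dom_near[of "e/3" u] e by auto
  obtain w where vw: "(v, w) \<in> A"
    using v(1) by (auto simp: A2_dom_def)
  have "((\<lambda>t. t * norm w) \<longlongrightarrow> 0) (at_right 0)"
    by (rule tendsto_eq_intros refl | simp)+
  then have "eventually (\<lambda>t. t * norm w < e/3) (at_right 0)"
    by (rule order_tendstoD) (use e in simp)
  then show "eventually (\<lambda>t. dist (semi t u) u < e) (at_right 0)"
    using eventually_at_right_less
  proof eventually_elim
    case (elim t)
    have "norm (semi t u - u) \<le> norm (semi t (u - v)) + norm (semi t v - v) + norm (v - u)"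
      using norm_triangle_ineq[of "semi t (u - v) + (semi t v - v)" "v - u"]
        norm_triangle_ineq[of "semi t (u - v)" "semi t v - v"]
      by (simp add: linear_diff[OF linear_semi])
    then show ?case
      using norm_semi_le[of t "u - v"] norm_semi_minus_le[OF elim(2) vw] elim(1) v(2)
      by (simp add: dist_norm norm_minus_commute)
  qed
qed

text \<open>On the domain of \<open>A\<^sup>2\<close> the semigroup differs from a single Euler step by
  \<open>O(t\<^sup>2)\<close>, and \<open>(J t u - u) / t = - J t v\<close>.\<close>

lemma semi_deriv_A2:
  assumes uv: "(u, v) \<in> A" and vw: "(v, w) \<in> A"
  shows "((\<lambda>t. (semi t u - u) /\<^sub>R t) \<longlongrightarrow> - v) (at_right 0)"
proof (rule LIM_zero_cancel, rule Lim_null_comparison)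
  show "eventually (\<lambda>t. norm ((semi t u - u) /\<^sub>R t - - v) \<le> t * norm w / 2 + norm (J t v - v)) (at_right 0)"
    using eventually_at_right_less
  proof eventually_elim
    case (elim t)
    have Ju: "J t u = u - t *\<^sub>R J t v"
      using J_unique[OF elim uv] elim by (simp add: J_add J_scale algebra_simps)
    have "(semi t u - u) /\<^sub>R t - - v = - ((J t u - semi t u) /\<^sub>R t) - (J t v - v)"
      using elim by (simp add: Ju algebra_simps)
    also have "norm \<dots> \<le> norm (J t u - semi t u) / t + norm (J t v - v)"
      using norm_triangle_ineq4[of "- ((J t u - semi t u) /\<^sub>R t)" "J t v - v"] elim
      by (simp add: divide_inverse mult.commute)
    also have "norm (J t u - semi t u) / t \<le> t * norm w / 2"
      using norm_semi_minus_J_le[OF elim uv vw] elim by (simp add: field_simps power2_eq_square)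
    finally show ?case by simp
  qed
  show "((\<lambda>t. t * norm w / 2 + norm (J t v - v)) \<longlongrightarrow> 0) (at_right 0)"
    by (rule tendsto_eq_intros refl J_tendsto | simp)+
qed

text \<open>General \<open>u\<close> in the domain are replaced by \<open>J h u\<close>, which lies in the domain of
  \<open>A\<^sup>2\<close>. The difference quotient of \<open>u - J h u\<close> is at most
  \<open>norm (v - J h v)\<close>, uniformly in \<open>t\<close>, and this is small with \<open>h\<close>.\<close>

lemma semi_deriv:
  assumes uv: "(u, v) \<in> A"
  shows "((\<lambda>t. (semi t u - u) /\<^sub>R t) \<longlongrightarrow> - v) (at_right 0)"
proof (rule tendstoI)
  fix e :: real
  assume e: "0 < e"
  have "eventually (\<lambda>h. 0 < h \<and> norm (J h v - v) < e/3) (at_right 0)"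
    using tendstoD[OF J_tendsto, of "e/3" v] e
    by (intro eventually_conj eventually_at_right_less) (simp add: dist_norm)
  from eventually_happens'[OF trivial_limit_at_right_real this]
  obtain h where h: "0 < h" "norm (J h v - v) < e/3" by blast
  define u' v' where "u' = J h u" and "v' = J h v"
  have u'v': "(u', v') \<in> A" and d: "(u - u', v - v') \<in> A"
    using A_J[OF h(1) uv] A_diff[OF uv] by (auto simp: u'_def v'_def)
  have "((\<lambda>t. (semi t u' - u') /\<^sub>R t) \<longlongrightarrow> - v') (at_right 0)"
    using semi_deriv_A2[OF u'v'] J_mem[OF h(1), of v] by (auto simp: v'_def)
  then have "eventually (\<lambda>t. dist ((semi t u' - u') /\<^sub>R t) (- v') < e/3) (at_right 0)"
    by (rule tendstoD) (use e in simp)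
  then show "eventually (\<lambda>t. dist ((semi t u - u) /\<^sub>R t) (- v) < e) (at_right 0)"
    using eventually_at_right_less
  proof eventually_elim
    case (elim t)
    have "norm ((semi t (u - u') - (u - u')) /\<^sub>R t) \<le> norm (v - v')"
      using norm_semi_minus_le[OF elim(2) d] elim(2)
      unfolding norm_scaleR by (simp add: divide_inverse_commute[symmetric] pos_divide_le_eq mult.commute)
    then have "norm ((semi t (u - u') - (u - u')) /\<^sub>R t + ((semi t u' - u') /\<^sub>R t - - v') + (v - v'))
        \<le> norm (v - v') + norm ((semi t u' - u') /\<^sub>R t - - v') + norm (v - v')"
      by (intro norm_triangle_mono order_refl)
    also have "(semi t (u - u') - (u - u')) /\<^sub>R t + ((semi t u' - u') /\<^sub>R t - - v') + (v - v')
        = (semi t u - u) /\<^sub>R t - - v"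
      by (simp add: linear_diff[OF linear_semi] algebra_simps)
    finally have "norm ((semi t u - u) /\<^sub>R t - - v)
        \<le> norm (v - v') + norm ((semi t u' - u') /\<^sub>R t - - v') + norm (v - v')" .
    then show ?case
      using elim(1) h(2) by (simp add: dist_norm v'_def norm_minus_commute)
  qed
qed

text \<open>The generator cannot be larger than \<open>- A\<close>: since \<open>1 + A\<close> is onto, an extra element would yield
  a vector that the contraction semigroup expands at rate one.\<close>

lemma semi_deriv_imp_A:
  assumes u: "((\<lambda>t. (semi t u - u) /\<^sub>R t) \<longlongrightarrow> - w) (at_right 0)"
  shows "(u, w) \<in> A"
proof -
  define x where "x = J 1 (u + w)"
  have x: "(x, u + w - x) \<in> A"
    using J_mem[of 1 "u + w"] by (simp add: x_def)
  define y where "y = u - x"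
  have "((\<lambda>t. (semi t u - u) /\<^sub>R t - (semi t x - x) /\<^sub>R t) \<longlongrightarrow> - w - - (u + w - x)) (at_right 0)"
    by (intro tendsto_diff u semi_deriv x)
  then have y: "((\<lambda>t. (semi t y - y) /\<^sub>R t) \<longlongrightarrow> y) (at_right 0)"
    by (simp add: y_def linear_diff[OF linear_semi] algebra_simps)
  have "norm y \<le> 0"
  proof (rule tendsto_upperbound)
    show "((\<lambda>t. norm y - norm ((semi t y - y) /\<^sub>R t - y)) \<longlongrightarrow> norm y) (at_right 0)"
      using tendsto_diff[OF tendsto_const tendsto_norm_zero[OF LIM_zero[OF y]]] by fastforce
    show "eventually (\<lambda>t. norm y - norm ((semi t y - y) /\<^sub>R t - y) \<le> 0) (at_right 0)"
      using eventually_at_right_less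
    proof eventually_elim
      case (elim t)
      define r where "r = (semi t y - y) /\<^sub>R t - y"
      have "semi t y - t *\<^sub>R r = (1 + t) *\<^sub>R y"
        using elim by (simp add: r_def algebra_simps)
      then have "(1 + t) * norm y = norm (semi t y - t *\<^sub>R r)"
        using elim by simp
      also have "\<dots> \<le> norm y + t * norm r"
        using norm_triangle_ineq4[of "semi t y" "t *\<^sub>R r"] norm_semi_le[of t y] elim by simp
      finally have "t * norm y \<le> t * norm r"
        by (simp add: algebra_simps)
      then show ?case
        using elim by (simp add: r_def)
    qed
  qed simp
  then show ?thesis
    using x by (simp add: y_def)
qed

end

text \<open>By Baire's theorem one of the closed sets on which all \<open>T n\<close> are bounded by
  \<open>k\<close> contains a ball.\<close>

lemma uniform_boundedness:
  fixes T :: "nat \<Rightarrow> 'b :: banach \<Rightarrow> 'c :: real_normed_vector"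
  assumes T: "\<And>n. bounded_linear (T n)" and bd: "\<And>u. bounded (range (\<lambda>n. T n u))"
  shows "\<exists>M. \<forall>n u. norm (T n u) \<le> M * norm u"
proof -
  define F where "F k = {u. \<forall>n. norm (T n u) \<le> real k}" for k
  have closed: "closed (F k)" for k
    unfolding F_def Collect_all_eq
    by (intro closed_INT ballI closed_Collect_le continuous_intros
        bounded_linear.continuous_on[OF T])
  have "\<exists>k. u \<in> F k" for u
  proof -
    obtain B where "\<And>n. norm (T n u) \<le> B"
      using bd[of u] by (auto simp: bounded_iff)
    moreover obtain k where "B \<le> real k"
      using real_arch_simple by blast
    ultimately show ?thesis
      by (auto simp: F_def intro: order_trans)
  qed
  then have "\<Union>(range F) = UNIV" by auto
  have "\<exists>k. interior (F k) \<noteq> {}"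
  proof (rule ccontr)
    assume "\<nexists>k. interior (F k) \<noteq> {}"
    then have "euclidean interior_of \<Union>(range F) = {}"
      using closed by (intro Baire_category_alt) (auto simp: completely_metrizable_space_euclidean)
    then show False
      by (simp add: \<open>\<Union>(range F) = UNIV\<close>)
  qed
  then obtain k u0 where "u0 \<in> interior (F k)" by auto
  then obtain r where r: "0 < r" "cball u0 r \<subseteq> F k"
    using mem_interior_cball by blast
  have "norm (T n u) \<le> (2 * real k / r) * norm u" for n u
  proof (cases "u = 0")
    case True
    then show ?thesis
      by (simp add: linear_0 bounded_linear.linear[OF T])
  next
    case False
    define v where "v = (r / norm u) *\<^sub>R u"
    have "u0 + v \<in> cball u0 r" "u0 \<in> cball u0 r"
      using r(1) False by (auto simp: v_def dist_norm)
    then have "norm (T n (u0 + v)) \<le> k" "norm (T n u0) \<le> k"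
      using subsetD[OF r(2)] unfolding F_def by blast+
    moreover have "T n v = T n (u0 + v) - T n u0"
      by (simp add: linear_add bounded_linear.linear[OF T])
    ultimately have "norm (T n v) \<le> 2 * real k"
      using norm_triangle_ineq4[of "T n (u0 + v)" "T n u0"] by simp
    moreover have "norm (T n v) = r / norm u * norm (T n u)"
      using r(1) by (simp add: v_def linear_scale bounded_linear.linear[OF T])
    ultimately show ?thesis
      using r(1) False by (simp add: field_simps)
  qed
  then show ?thesis by blast
qed

context accretive_operator
begin

text \<open>A semigroup with generator \<open>- A\<close> is only assumed to consist of bounded operators, one
  bound for each time. Strong continuity and the uniform boundedness principle give a common bound
  \<open>M\<close> on an interval \<open>[0, \<delta>]\<close>. There the two semigroups are compared by telescoping over
  \<open>n\<close> steps of size \<open>h = s / n\<close>: on the domain of \<open>A\<close> both steps have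
  the same derivative, so a step contributes \<open>o(h)\<close> and the sum tends to zero. The semigroup law
  then extends the identity to all times.\<close>

theorem semi_unique:
  fixes P :: "real \<Rightarrow> 'b \<Rightarrow> 'b"
  assumes lin: "\<And>t. 0 \<le> t \<Longrightarrow> linear (P t)"
    and bd: "\<And>t. 0 \<le> t \<Longrightarrow> \<exists>K. \<forall>u. norm (P t u) \<le> K * norm u"
    and P0: "\<And>u. P 0 u = u"
    and mult: "\<And>s t u. 0 \<le> s \<Longrightarrow> 0 \<le> t \<Longrightarrow> P (s + t) u = P s (P t u)"
    and cont: "\<And>u. ((\<lambda>t. P t u) \<longlongrightarrow> u) (at_right 0)"
    and gen: "\<And>u w. ((\<lambda>t. (P t u - u) /\<^sub>R t) \<longlongrightarrow> - w) (at_right 0) \<longleftrightarrow> (u, w) \<in> A"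
    and t: "0 \<le> t"
  shows "P t u = semi t u"
proof -
  have bl: "bounded_linear (P t)" if "0 \<le> t" for t
    using lin[OF that] bd[OF that] by (auto simp: bounded_linear_def bounded_linear_axioms_def mult.commute)
  have P_A: "(P s x, P s y) \<in> A" if xy: "(x, y) \<in> A" and s: "0 \<le> s" for s x y
  proof -
    have "((\<lambda>t. P s ((P t x - x) /\<^sub>R t)) \<longlongrightarrow> P s (- y)) (at_right 0)" (is "(?F \<longlongrightarrow> _) _")
      by (rule bounded_linear.tendsto[OF bl[OF s]]) (use gen xy in blast)
    then have "(?F \<longlongrightarrow> - P s y) (at_right 0)"
      by (simp only: linear_neg[OF lin[OF s]])
    then have "((\<lambda>t. (P t (P s x) - P s x) /\<^sub>R t) \<longlongrightarrow> - P s y) (at_right 0)"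
    proof (rule Lim_transform_eventually)
      show "eventually (\<lambda>t. P s ((P t x - x) /\<^sub>R t) = (P t (P s x) - P s x) /\<^sub>R t) (at_right 0)"
        using eventually_at_right_less
      proof eventually_elim
        case (elim t)
        have "P s (P t x) = P t (P s x)"
          using mult[of s t x] mult[of t s x] s elim by (simp add: add.commute)
        then show ?case
          by (simp add: linear_scale[OF lin[OF s]] linear_diff[OF lin[OF s]])
      qed
    qed
    then show ?thesis using gen by blast
  qed
  have P_J: "P s (J h x) = J h (P s x)" if s: "0 \<le> s" and h: "0 < h" for s h x
    by (rule J_eqI[OF h P_A[OF J_mem[OF h] s], symmetric])
      (use h in \<open>simp add: linear_scale[OF lin[OF s]] linear_diff[OF lin[OF s]]\<close>)
  have P_semi: "P s (semi t x) = semi t (P s x)" if s: "0 \<le> s" for s t x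
    using bd[OF s] semi_commute[OF lin[OF s] _ P_J[OF s]] by blast
  have P_funpow: "(P s ^^ k) x = P (real k * s) x" if s: "0 \<le> s" for s k x
    by (induction k) (use s in \<open>simp_all add: P0 distrib_right mult\<close>)
  have semi_funpow: "(semi s ^^ k) x = semi (real k * s) x" if s: "0 \<le> s" for s k x
    by (induction k) (use s in \<open>simp_all add: semi_zero distrib_right semi_mult\<close>)
  have "\<exists>\<delta>>0. \<exists>M. \<forall>s. 0 \<le> s \<and> s \<le> \<delta> \<longrightarrow> (\<forall>u. norm (P s u) \<le> M * norm u)"
  proof (rule ccontr)
    assume neg: "\<not> ?thesis"
    have "\<exists>s u. 0 \<le> s \<and> s \<le> inverse (real (Suc n)) \<and> \<not> norm (P s u) \<le> real (Suc n) * norm u" for n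
      using neg[simplified, rule_format, of "inverse (real (Suc n))" "real (Suc n)"]
      by (auto simp: not_le simp del: of_nat_Suc)
    then obtain s U where s: "\<And>n. 0 \<le> s n" "\<And>n. s n \<le> inverse (real (Suc n))"
      and U: "\<And>n. \<not> norm (P (s n) (U n)) \<le> real (Suc n) * norm (U n)"
      by metis
    have "s n \<noteq> 0" for n
      using U[of n] mult_right_mono[of 1 "real (Suc n)" "norm (U n)"] by (auto simp: P0)
    then have spos: "0 < s n" for n
      using s(1)[of n] by (simp add: less_le)
    have "s \<longlonglongrightarrow> 0"
      by (rule tendsto_sandwich[OF _ _ tendsto_const LIMSEQ_inverse_real_of_nat]) (use s in auto)
    then have s0: "filterlim s (at_right 0) sequentially"
      by (rule tendsto_imp_filterlim_at_right) (simp add: spos)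
    have "bounded (range (\<lambda>n. P (s n) u))" for u
      using filterlim_compose[OF cont s0] by (intro convergent_imp_bounded)
    then obtain M where M: "\<And>n u. norm (P (s n) u) \<le> M * norm u"
      using uniform_boundedness[of "\<lambda>n. P (s n)"] bl s(1) by blast
    obtain n where n: "M \<le> real n"
      using real_arch_simple by blast
    have "norm (P (s n) (U n)) \<le> real (Suc n) * norm (U n)"
      using M[of n "U n"] n mult_right_mono[of M "real (Suc n)" "norm (U n)"] by simp
    then show False
      using U by blast
  qed
  then obtain \<delta> M where \<delta>: "0 < \<delta>"
    and M: "\<And>s u. 0 \<le> s \<Longrightarrow> s \<le> \<delta> \<Longrightarrow> norm (P s u) \<le> M * norm u"
    by blast
  \<comment> \<open>The common bound \<open>M\<close> only holds up to time \<open>\<delta>\<close>, so the comparison starts there.\<close>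
  have small: "P s u = semi s u" if s: "0 < s" "s \<le> \<delta>" for s u
  proof (rule eq_if_eq_on_A2[where S = "P s" and T = "semi s" and K = "max M 1"])
    show "linear (P s)" "linear (semi s)"
      using lin s by (auto simp: linear_semi)
    show "norm (P s u) \<le> max M 1 * norm u" "norm (semi s u) \<le> max M 1 * norm u" for u
      using order_trans[OF M mult_right_mono[of M "max M 1"]] s
        order_trans[OF norm_semi_le mult_right_mono[of 1 "max M 1" "norm u", simplified]] by auto
    show "P s x = semi s x" if x: "x \<in> A2_dom" for x
    proof -
      obtain y where xy: "(x, y) \<in> A"
        using x by (auto simp: A2_dom_def)
      define h where "h n = s / real (Suc n)" for n
      have h: "0 < h n" "h n \<le> s" "real (Suc n) * h n = s" for n
        using s by (simp_all add: h_def field_simps del: of_nat_Suc)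
      have "h \<longlonglongrightarrow> 0"
        unfolding h_def[abs_def] by (rule LIMSEQ_Suc[OF lim_const_over_n])
      then have h0: "filterlim h (at_right 0) sequentially"
        by (rule tendsto_imp_filterlim_at_right) (simp add: h(1))
      have le: "norm (semi s x - P s x)
          \<le> s * M * norm ((semi (h n) x - x) /\<^sub>R h n - (P (h n) x - x) /\<^sub>R h n)" for n
      proof -
        have "norm ((semi (h n) ^^ Suc n) x - (P (h n) ^^ Suc n) x)
            \<le> Suc n * (M * norm (semi (h n) x - P (h n) x))"
        proof (rule norm_funpow_diff_le)
          show "norm ((P (h n) ^^ k) u) \<le> M * norm u" if "k < Suc n" for k u
          proof -
            have "real k * h n \<le> real (Suc n) * h n"
              using that less_imp_le[OF h(1)] by (intro mult_right_mono) auto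
            then have "real k * h n \<le> s"
              unfolding h(3) .
            then show ?thesis
              using h(1)[of n] s M[of "real k * h n" u] by (simp add: P_funpow)
          qed
        qed (use h(1)[of n] in \<open>auto simp: linear_semi lin norm_semi_le P_semi\<close>)
        moreover have "semi (h n) x - P (h n) x
            = h n *\<^sub>R ((semi (h n) x - x) /\<^sub>R h n - (P (h n) x - x) /\<^sub>R h n)"
          using h(1)[of n] by (simp add: scaleR_diff_right)
        then have "norm (semi (h n) x - P (h n) x)
            = h n * norm ((semi (h n) x - x) /\<^sub>R h n - (P (h n) x - x) /\<^sub>R h n)"
          using h(1)[of n] by simp
        ultimately have "norm (semi (real (Suc n) * h n) x - P (real (Suc n) * h n) x)
            \<le> (Suc n * h n) * M * norm ((semi (h n) x - x) /\<^sub>R h n - (P (h n) x - x) /\<^sub>R h n)"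
          using less_imp_le[OF h(1)[of n]]
          unfolding P_funpow[OF less_imp_le[OF h(1)]] semi_funpow[OF less_imp_le[OF h(1)]]
          by (simp only: mult.assoc mult.left_commute)
        then show ?thesis
          unfolding h(3) .
      qed
      have "(\<lambda>n. s * M * norm ((semi (h n) x - x) /\<^sub>R h n - (P (h n) x - x) /\<^sub>R h n))
          \<longlonglongrightarrow> s * M * norm (- y - - y)"
        using xy gen
        by (intro tendsto_intros filterlim_compose[OF semi_deriv h0] filterlim_compose[OF _ h0]) auto
      then have "norm (semi s x - P s x) \<le> s * M * norm (- y - - y)"
        by (rule LIMSEQ_le_const) (use le in blast)
      then show ?thesis by simp
    qed
  qed
  obtain n where n: "t / \<delta> \<le> real n"
    using real_arch_simple by blast
  show ?thesis
  proof (cases "t = 0")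
    case False
    then have tpos: "0 < t" using t by simp
    then have npos: "0 < real n"
      using n \<delta> divide_pos_pos[OF tpos \<delta>] by linarith
    have s: "0 < t / n" "t / n \<le> \<delta>"
      using n npos \<delta> tpos by (simp_all add: field_simps)
    have "(P (t / n) ^^ k) u = (semi (t / n) ^^ k) u" for k
      by (induction k) (simp_all add: small[OF s])
    from this[of n] show ?thesis
      using npos s(1) by (simp add: P_funpow semi_funpow)
  qed (simp add: P0 semi_zero)
qed

end

section \<open>The Friedrichs extension and its resolvents\<close>

text \<open>Yields both the Cauchy-Schwarz inequality of the form and the Euler-Lagrange equation of the
  functional minimised below.\<close>

lemma discriminant_le:
  fixes a l n :: real
  assumes "\<And>s. 0 \<le> a + 2 * s * l + s\<^sup>2 * n" and "0 \<le> n"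
  shows "l\<^sup>2 \<le> a * n"
proof (cases "n = 0")
  case True
  have "l = 0"
  proof (rule ccontr)
    assume "l \<noteq> 0"
    then have "a + 2 * (- (a + 1) / (2 * l)) * l = - 1"
      by (simp add: field_simps)
    then show False
      using assms(1)[of "- (a + 1) / (2 * l)"] True by simp
  qed
  then show ?thesis using True by simp
next
  case False
  have "a + 2 * (- l / n) * l + (- l / n)\<^sup>2 * n = a - l\<^sup>2 / n"
    using False by (simp add: power2_eq_square)
  then have "l\<^sup>2 / n \<le> a"
    using assms(1)[of "- l / n"] by simp
  then show ?thesis
    using False assms(2) by (simp add: pos_divide_le_eq)
qed

lemma tendsto_zero_power2_cancel:
  fixes f :: "'a \<Rightarrow> real"
  assumes "((\<lambda>n. (f n)\<^sup>2) \<longlongrightarrow> 0) F"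
  shows "(f \<longlongrightarrow> 0) F"
  using tendsto_real_sqrt[OF assms] by (simp add: tendsto_rabs_zero_iff)

text \<open>A nonnegative symmetric operator \<open>L\<close> on a dense subspace \<open>C\<close>; its
  linearity on \<open>C\<close> is a consequence of the symmetry.\<close>

locale nonneg_symmetric_operator =
  fixes C :: "'h :: {real_inner, banach} set" and L :: "'h \<Rightarrow> 'h"
  assumes subspace_C: "subspace C"
    and dense_C: "closure C = UNIV"
    and L_symmetric: "\<phi> \<in> C \<Longrightarrow> \<psi> \<in> C \<Longrightarrow> inner (L \<phi>) \<psi> = inner (L \<psi>) \<phi>"
    and L_nonneg: "\<phi> \<in> C \<Longrightarrow> 0 \<le> inner (L \<phi>) \<phi>"
begin

lemmas C_add = subspace_add[OF subspace_C]
  and C_diff = subspace_diff[OF subspace_C]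
  and C_scale = subspace_scale[OF subspace_C]

definition E :: "'h \<Rightarrow> 'h \<Rightarrow> real" where "E \<phi> \<psi> = inner (L \<phi>) \<psi>"

lemma E_commute: "\<phi> \<in> C \<Longrightarrow> \<psi> \<in> C \<Longrightarrow> E \<phi> \<psi> = E \<psi> \<phi>"
  by (simp add: E_def L_symmetric)

lemma E_nonneg: "\<phi> \<in> C \<Longrightarrow> 0 \<le> E \<phi> \<phi>"
  by (simp add: E_def L_nonneg)

lemma E_right:
  "E \<phi> (\<psi> + \<theta>) = E \<phi> \<psi> + E \<phi> \<theta>" "E \<phi> (\<psi> - \<theta>) = E \<phi> \<psi> - E \<phi> \<theta>" "E \<phi> (c *\<^sub>R \<psi>) = c * E \<phi> \<psi>"
  by (simp_all add: E_def inner_add_right inner_diff_right)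

lemma E_left:
  assumes "\<phi> \<in> C" "\<psi> \<in> C" "\<theta> \<in> C"
  shows "E (\<psi> + \<theta>) \<phi> = E \<psi> \<phi> + E \<theta> \<phi>" "E (\<psi> - \<theta>) \<phi> = E \<psi> \<phi> - E \<theta> \<phi>"
  using assms by (simp_all add: E_commute[of _ \<phi>] C_add C_diff E_right)

lemma E_scale_left: "\<phi> \<in> C \<Longrightarrow> \<psi> \<in> C \<Longrightarrow> E (c *\<^sub>R \<psi>) \<phi> = c * E \<psi> \<phi>"
  by (simp add: E_commute[of _ \<phi>] C_scale E_right)

lemma E_Cauchy_Schwarz:
  assumes "\<phi> \<in> C" "\<psi> \<in> C"
  shows "(E \<phi> \<psi>)\<^sup>2 \<le> E \<phi> \<phi> * E \<psi> \<psi>"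
proof (rule discriminant_le)
  fix s
  have "0 \<le> E (\<phi> + s *\<^sub>R \<psi>) (\<phi> + s *\<^sub>R \<psi>)"
    using assms by (intro E_nonneg C_add C_scale)
  then show "0 \<le> E \<phi> \<phi> + 2 * s * E \<phi> \<psi> + s\<^sup>2 * E \<psi> \<psi>"
    using assms E_commute[of \<phi> \<psi>]
    by (simp add: E_left E_scale_left E_right C_add C_scale algebra_simps power2_eq_square)
qed (rule E_nonneg[OF assms(2)])

definition form_norm :: "'h \<Rightarrow> real" where "form_norm \<phi> = sqrt (E \<phi> \<phi>)"

lemma form_norm_nonneg: "\<phi> \<in> C \<Longrightarrow> 0 \<le> form_norm \<phi>"
  by (simp add: form_norm_def E_nonneg)

lemma form_norm_power2: "\<phi> \<in> C \<Longrightarrow> (form_norm \<phi>)\<^sup>2 = E \<phi> \<phi>"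
  by (simp add: form_norm_def E_nonneg)

lemma abs_E_le: "\<phi> \<in> C \<Longrightarrow> \<psi> \<in> C \<Longrightarrow> \<bar>E \<phi> \<psi>\<bar> \<le> form_norm \<phi> * form_norm \<psi>"
  using real_sqrt_le_mono[OF E_Cauchy_Schwarz] by (simp add: form_norm_def real_sqrt_mult)

lemma form_norm_triangle:
  assumes "\<phi> \<in> C" "\<psi> \<in> C"
  shows "form_norm (\<phi> + \<psi>) \<le> form_norm \<phi> + form_norm \<psi>"
proof (rule power2_le_imp_le)
  have "(form_norm (\<phi> + \<psi>))\<^sup>2 = E \<phi> \<phi> + 2 * E \<phi> \<psi> + E \<psi> \<psi>"
    using assms E_commute[of \<phi> \<psi>] by (simp add: form_norm_power2 C_add E_left E_scale_left E_right)
  also have "\<dots> \<le> E \<phi> \<phi> + 2 * (form_norm \<phi> * form_norm \<psi>) + E \<psi> \<psi>"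
    using abs_E_le[OF assms] by simp
  also have "\<dots> = (form_norm \<phi> + form_norm \<psi>)\<^sup>2"
    using assms by (simp add: power2_sum form_norm_power2)
  finally show "(form_norm (\<phi> + \<psi>))\<^sup>2 \<le> (form_norm \<phi> + form_norm \<psi>)\<^sup>2" .
qed (simp add: assms form_norm_nonneg)

lemma form_norm_scale: "\<phi> \<in> C \<Longrightarrow> form_norm (c *\<^sub>R \<phi>) = \<bar>c\<bar> * form_norm \<phi>"
  by (simp add: form_norm_def E_left E_scale_left E_right C_scale real_sqrt_mult flip: mult.assoc)

definition approx :: "(nat \<Rightarrow> 'h) \<Rightarrow> 'h \<Rightarrow> bool" where
  "approx \<phi> f \<longleftrightarrow> (\<forall>n. \<phi> n \<in> C) \<and> \<phi> \<longlonglongrightarrow> f \<and>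
     (\<forall>\<epsilon>>0. \<exists>N. \<forall>i\<ge>N. \<forall>j\<ge>N. E (\<phi> i - \<phi> j) (\<phi> i - \<phi> j) < \<epsilon>)"

lemma approxD:
  assumes "approx \<phi> f"
  shows "\<phi> n \<in> C" "\<phi> \<longlonglongrightarrow> f"
    "\<And>e. 0 < e \<Longrightarrow> \<exists>N. \<forall>i\<ge>N. \<forall>j\<ge>N. form_norm (\<phi> i - \<phi> j) < e"
proof -
  fix e :: real
  assume e: "0 < e"
  then obtain N where "\<forall>i\<ge>N. \<forall>j\<ge>N. E (\<phi> i - \<phi> j) (\<phi> i - \<phi> j) < e\<^sup>2"
    using assms unfolding approx_def by (meson zero_less_power)
  then show "\<exists>N. \<forall>i\<ge>N. \<forall>j\<ge>N. form_norm (\<phi> i - \<phi> j) < e"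
    using e by (auto intro!: exI[of _ N] real_less_lsqrt simp: form_norm_def)
qed (use assms in \<open>simp_all add: approx_def\<close>)

lemma approxI:
  assumes C: "\<And>n. \<phi> n \<in> C" and "\<phi> \<longlonglongrightarrow> f"
    and "\<And>e. 0 < e \<Longrightarrow> \<exists>N. \<forall>i\<ge>N. \<forall>j\<ge>N. form_norm (\<phi> i - \<phi> j) < e"
  shows "approx \<phi> f"
  unfolding approx_def
proof (intro conjI allI impI assms)
  fix \<epsilon> :: real
  assume e: "0 < \<epsilon>"
  then obtain N where N: "\<forall>i\<ge>N. \<forall>j\<ge>N. form_norm (\<phi> i - \<phi> j) < sqrt \<epsilon>"
    using assms(3)[of "sqrt \<epsilon>"] by auto
  then show "\<exists>N. \<forall>i\<ge>N. \<forall>j\<ge>N. E (\<phi> i - \<phi> j) (\<phi> i - \<phi> j) < \<epsilon>"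
    by (auto simp: form_norm_def)
qed

lemma approx_lincomb:
  assumes f: "approx \<phi> f" and g: "approx \<psi> g"
  shows "approx (\<lambda>n. a *\<^sub>R \<phi> n + b *\<^sub>R \<psi> n) (a *\<^sub>R f + b *\<^sub>R g)"
proof (rule approxI)
  note C = approxD(1)[OF f] approxD(1)[OF g]
  show "a *\<^sub>R \<phi> n + b *\<^sub>R \<psi> n \<in> C" for n
    by (intro C_add C_scale C)
  show "(\<lambda>n. a *\<^sub>R \<phi> n + b *\<^sub>R \<psi> n) \<longlonglongrightarrow> a *\<^sub>R f + b *\<^sub>R g"
    by (intro tendsto_intros approxD(2)[OF f] approxD(2)[OF g])
  fix e :: real
  assume e: "0 < e"
  define d where "d = e / (\<bar>a\<bar> + \<bar>b\<bar> + 1)"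
  have d: "0 < d" "\<bar>a\<bar> * d + \<bar>b\<bar> * d < e"
  proof -
    have "0 < \<bar>a\<bar> + \<bar>b\<bar> + 1" by simp
    then show "0 < d" and "\<bar>a\<bar> * d + \<bar>b\<bar> * d < e"
      using e by (simp_all add: d_def pos_divide_less_eq flip: distrib_right add_divide_distrib)
  qed
  obtain N M where N: "\<And>i j. i \<ge> N \<Longrightarrow> j \<ge> N \<Longrightarrow> form_norm (\<phi> i - \<phi> j) < d"
    and M: "\<And>i j. i \<ge> M \<Longrightarrow> j \<ge> M \<Longrightarrow> form_norm (\<psi> i - \<psi> j) < d"
    using approxD(3)[OF f d(1)] approxD(3)[OF g d(1)] by blast
  have "form_norm ((a *\<^sub>R \<phi> i + b *\<^sub>R \<psi> i) - (a *\<^sub>R \<phi> j + b *\<^sub>R \<psi> j)) < e" if "i \<ge> max N M" "j \<ge> max N M" for i j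
  proof -
    have "(a *\<^sub>R \<phi> i + b *\<^sub>R \<psi> i) - (a *\<^sub>R \<phi> j + b *\<^sub>R \<psi> j) = a *\<^sub>R (\<phi> i - \<phi> j) + b *\<^sub>R (\<psi> i - \<psi> j)"
      by (simp add: algebra_simps)
    then have "form_norm ((a *\<^sub>R \<phi> i + b *\<^sub>R \<psi> i) - (a *\<^sub>R \<phi> j + b *\<^sub>R \<psi> j))
        \<le> \<bar>a\<bar> * form_norm (\<phi> i - \<phi> j) + \<bar>b\<bar> * form_norm (\<psi> i - \<psi> j)"
      using form_norm_triangle[of "a *\<^sub>R (\<phi> i - \<phi> j)" "b *\<^sub>R (\<psi> i - \<psi> j)"] C
      by (simp add: C_scale C_diff form_norm_scale)
    also have "\<dots> \<le> \<bar>a\<bar> * d + \<bar>b\<bar> * d"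
      using N[of i j] M[of i j] that by (intro add_mono mult_left_mono) auto
    finally show ?thesis using d(2) by simp
  qed
  then show "\<exists>N. \<forall>i\<ge>N. \<forall>j\<ge>N. form_norm ((a *\<^sub>R \<phi> i + b *\<^sub>R \<psi> i) - (a *\<^sub>R \<phi> j + b *\<^sub>R \<psi> j)) < e"
    by blast
qed

lemma approx_const: "\<phi> \<in> C \<Longrightarrow> approx (\<lambda>_. \<phi>) \<phi>"
  by (auto simp: approx_def E_def)

lemma approx_convergent:
  assumes f: "approx \<phi> f"
  shows "convergent (\<lambda>n. form_norm (\<phi> n))"
proof -
  note C = approxD(1)[OF f]
  have le: "\<bar>form_norm (\<phi> i) - form_norm (\<phi> j)\<bar> \<le> form_norm (\<phi> i - \<phi> j)" for i j
    using form_norm_triangle[of "\<phi> i - \<phi> j" "\<phi> j"] form_norm_triangle[of "\<phi> j - \<phi> i" "\<phi> i"]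
      form_norm_scale[of "\<phi> i - \<phi> j" "-1"] C by (simp add: C_diff)
  have "Cauchy (\<lambda>n. form_norm (\<phi> n))"
  proof (rule metric_CauchyI)
    fix e :: real
    assume "0 < e"
    then obtain N where "\<forall>i\<ge>N. \<forall>j\<ge>N. form_norm (\<phi> i - \<phi> j) < e"
      using approxD(3)[OF f] by blast
    then show "\<exists>N. \<forall>i\<ge>N. \<forall>j\<ge>N. dist (form_norm (\<phi> i)) (form_norm (\<phi> j)) < e"
      unfolding dist_real_def by (intro exI[of _ N] allI impI le_less_trans[OF le]) blast
  qed
  then show ?thesis
    by (simp add: Cauchy_convergent_iff)
qed

text \<open>Closability: against a fixed core vector the form is an inner product, so it sees only the
  norm limit of the other argument.\<close>

lemma approx_null:
  assumes f: "approx \<phi> 0"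
  shows "(\<lambda>n. form_norm (\<phi> n)) \<longlonglongrightarrow> 0"
proof (rule LIMSEQ_I)
  note C = approxD(1)[OF f]
  fix r :: real
  assume r: "0 < r"
  then obtain N where N: "\<And>i j. i \<ge> N \<Longrightarrow> j \<ge> N \<Longrightarrow> E (\<phi> i - \<phi> j) (\<phi> i - \<phi> j) < (r/2)\<^sup>2"
    using f unfolding approx_def by (meson zero_less_power half_gt_zero)
  have "form_norm (\<phi> n) \<le> r/2" if n: "n \<ge> N" for n
  proof -
    have "E (\<phi> n) (\<phi> n) \<le> (r/2)\<^sup>2 + 2 * E (\<phi> n) 0"
    proof (rule LIMSEQ_le_const)
      show "(\<lambda>m. (r/2)\<^sup>2 + 2 * E (\<phi> n) (\<phi> m)) \<longlonglongrightarrow> (r/2)\<^sup>2 + 2 * E (\<phi> n) 0"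
        unfolding E_def by (intro tendsto_intros approxD(2)[OF f])
      have "E (\<phi> n) (\<phi> n) \<le> (r/2)\<^sup>2 + 2 * E (\<phi> n) (\<phi> m)" if "m \<ge> N" for m
      proof -
        have "E (\<phi> n - \<phi> m) (\<phi> n - \<phi> m) = E (\<phi> n) (\<phi> n) - 2 * E (\<phi> n) (\<phi> m) + E (\<phi> m) (\<phi> m)"
          using C E_commute[of "\<phi> n" "\<phi> m"] by (simp add: E_left E_scale_left E_right C_diff)
        then show ?thesis
          using N[OF n that] E_nonneg[of "\<phi> m"] C by simp
      qed
      then show "\<exists>M. \<forall>m\<ge>M. E (\<phi> n) (\<phi> n) \<le> (r/2)\<^sup>2 + 2 * E (\<phi> n) (\<phi> m)" by blast
    qed
    then have "E (\<phi> n) (\<phi> n) \<le> (r/2)\<^sup>2"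
      by (simp add: E_def)
    then show ?thesis
      unfolding form_norm_def using r by (intro real_le_lsqrt) auto
  qed
  then show "\<exists>no. \<forall>n\<ge>no. norm (form_norm (\<phi> n) - 0) < r"
    using r form_norm_nonneg[OF C] by (intro exI[of _ N]) fastforce
qed

definition closure_dom :: "'h set" where "closure_dom = {f. \<exists>\<phi>. approx \<phi> f}"

definition closure_form :: "'h \<Rightarrow> 'h \<Rightarrow> real" where
  "closure_form f g = (THE c. \<forall>\<phi> \<psi>. approx \<phi> f \<longrightarrow> approx \<psi> g \<longrightarrow> (\<lambda>n. E (\<phi> n) (\<psi> n)) \<longlonglongrightarrow> c)"

definition friedrichs :: "('h \<times> 'h) set" where
  "friedrichs = {(f, w). f \<in> closure_dom \<and> (\<forall>h\<in>closure_dom. closure_form f h = inner w h)}"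

text \<open>By polarisation it suffices that \<open>form_norm\<close> converges along sums and differences.\<close>

lemma E_convergent:
  assumes f: "approx \<phi> f" and g: "approx \<psi> g"
  shows "convergent (\<lambda>n. E (\<phi> n) (\<psi> n))"
proof -
  note C = approxD(1)[OF f] approxD(1)[OF g]
  have "convergent (\<lambda>n. form_norm (\<phi> n + \<psi> n))" "convergent (\<lambda>n. form_norm (\<phi> n - \<psi> n))"
    using approx_convergent[OF approx_lincomb[OF f g, of 1 1]]
      approx_convergent[OF approx_lincomb[OF f g, of 1 "-1"]] by simp_all
  then have "convergent (\<lambda>n. (1/4) * ((form_norm (\<phi> n + \<psi> n))\<^sup>2 - (form_norm (\<phi> n - \<psi> n))\<^sup>2))"
    unfolding power2_eq_square
    by (intro convergent_mult convergent_diff convergent_const)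
  also have "(\<lambda>n. (1/4) * ((form_norm (\<phi> n + \<psi> n))\<^sup>2 - (form_norm (\<phi> n - \<psi> n))\<^sup>2)) = (\<lambda>n. E (\<phi> n) (\<psi> n))"
    using C E_commute[OF C(1) C(2)]
    by (simp add: form_norm_power2 C_add C_diff E_left E_scale_left E_right fun_eq_iff)
  finally show ?thesis .
qed

lemma E_tendsto_unique:
  assumes f: "approx \<phi> f" and f': "approx \<phi>' f" and g: "approx \<psi> g" and g': "approx \<psi>' g"
  shows "(\<lambda>n. E (\<phi> n) (\<psi> n) - E (\<phi>' n) (\<psi>' n)) \<longlonglongrightarrow> 0"
proof (rule Lim_null_comparison)
  note C = approxD(1)[OF f] approxD(1)[OF g] approxD(1)[OF f'] approxD(1)[OF g']
  obtain a b where ab: "(\<lambda>n. form_norm (\<psi> n)) \<longlonglongrightarrow> a" "(\<lambda>n. form_norm (\<phi>' n)) \<longlonglongrightarrow> b"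
    using approx_convergent[OF g] approx_convergent[OF f'] by (auto simp: convergent_def)
  have n: "(\<lambda>n. form_norm (\<phi> n - \<phi>' n)) \<longlonglongrightarrow> 0" "(\<lambda>n. form_norm (\<psi> n - \<psi>' n)) \<longlonglongrightarrow> 0"
    using approx_null[of "\<lambda>n. \<phi> n - \<phi>' n"] approx_null[of "\<lambda>n. \<psi> n - \<psi>' n"]
      approx_lincomb[OF f f', of 1 "-1"] approx_lincomb[OF g g', of 1 "-1"] by simp_all
  have "(\<lambda>n. form_norm (\<phi> n - \<phi>' n) * form_norm (\<psi> n) + form_norm (\<phi>' n) * form_norm (\<psi> n - \<psi>' n)) \<longlonglongrightarrow> 0 * a + b * 0"
    by (intro tendsto_intros n ab)
  then show "(\<lambda>n. form_norm (\<phi> n - \<phi>' n) * form_norm (\<psi> n) + form_norm (\<phi>' n) * form_norm (\<psi> n - \<psi>' n)) \<longlonglongrightarrow> 0"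
    by simp
  have "norm (E (\<phi> n) (\<psi> n) - E (\<phi>' n) (\<psi>' n))
      \<le> form_norm (\<phi> n - \<phi>' n) * form_norm (\<psi> n) + form_norm (\<phi>' n) * form_norm (\<psi> n - \<psi>' n)" for n
  proof -
    have "E (\<phi> n) (\<psi> n) - E (\<phi>' n) (\<psi>' n) = E (\<phi> n - \<phi>' n) (\<psi> n) + E (\<phi>' n) (\<psi> n - \<psi>' n)"
      using C by (simp add: E_left E_scale_left E_right)
    then show ?thesis
      using abs_E_le[of "\<phi> n - \<phi>' n" "\<psi> n"] abs_E_le[of "\<phi>' n" "\<psi> n - \<psi>' n"] C
      by (simp add: C_diff)
  qed
  then show "eventually (\<lambda>n. norm (E (\<phi> n) (\<psi> n) - E (\<phi>' n) (\<psi>' n))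
      \<le> form_norm (\<phi> n - \<phi>' n) * form_norm (\<psi> n) + form_norm (\<phi>' n) * form_norm (\<psi> n - \<psi>' n)) sequentially"
    by simp
qed

lemma closure_form_tendsto:
  assumes f: "approx \<phi> f" and g: "approx \<psi> g"
  shows "(\<lambda>n. E (\<phi> n) (\<psi> n)) \<longlonglongrightarrow> closure_form f g"
proof -
  obtain c where c: "(\<lambda>n. E (\<phi> n) (\<psi> n)) \<longlonglongrightarrow> c"
    using E_convergent[OF f g] by (auto simp: convergent_def)
  have "\<forall>\<phi> \<psi>. approx \<phi> f \<longrightarrow> approx \<psi> g \<longrightarrow> (\<lambda>n. E (\<phi> n) (\<psi> n)) \<longlonglongrightarrow> c"
    using tendsto_diff[OF c E_tendsto_unique[OF f _ g]] by simp
  moreover have "d = c" if "\<forall>\<phi> \<psi>. approx \<phi> f \<longrightarrow> approx \<psi> g \<longrightarrow> (\<lambda>n. E (\<phi> n) (\<psi> n)) \<longlonglongrightarrow> d" for d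
    using that f g c LIMSEQ_unique by blast
  ultimately have "closure_form f g = c"
    unfolding closure_form_def by (rule the_equality)
  then show ?thesis using c by simp
qed

lemma closure_form_lincomb:
  assumes f: "f \<in> closure_dom" and g: "g \<in> closure_dom" and h: "h \<in> closure_dom"
  shows "closure_form (a *\<^sub>R f + b *\<^sub>R g) h = a * closure_form f h + b * closure_form g h"
proof -
  obtain \<phi> \<psi> \<theta> where ap: "approx \<phi> f" "approx \<psi> g" "approx \<theta> h"
    using f g h by (auto simp: closure_dom_def)
  have "(\<lambda>n. E (a *\<^sub>R \<phi> n + b *\<^sub>R \<psi> n) (\<theta> n)) \<longlonglongrightarrow> a * closure_form f h + b * closure_form g h"
    using tendsto_add[OF tendsto_mult[OF tendsto_const closure_form_tendsto[OF ap(1,3)], of a]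
        tendsto_mult[OF tendsto_const closure_form_tendsto[OF ap(2,3)], of b]] ap[THEN approxD(1)]
    by (simp add: E_left E_scale_left C_scale)
  then show ?thesis
    using LIMSEQ_unique[OF closure_form_tendsto[OF approx_lincomb[OF ap(1,2)] ap(3)]] by blast
qed

lemma closure_form_nonneg: "f \<in> closure_dom \<Longrightarrow> 0 \<le> closure_form f f"
  unfolding closure_dom_def using LIMSEQ_le_const[OF closure_form_tendsto] approxD(1) E_nonneg by blast

lemma closure_dom_lincomb: "f \<in> closure_dom \<Longrightarrow> g \<in> closure_dom \<Longrightarrow> a *\<^sub>R f + b *\<^sub>R g \<in> closure_dom"
  unfolding closure_dom_def using approx_lincomb by blast

lemma friedrichs_lincomb:
  assumes "(f, w) \<in> friedrichs" "(f', w') \<in> friedrichs"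
  shows "(a *\<^sub>R f + b *\<^sub>R f', a *\<^sub>R w + b *\<^sub>R w') \<in> friedrichs"
  using assms by (auto simp: friedrichs_def closure_dom_lincomb closure_form_lincomb inner_add_left)

lemma zero_mem_C: "0 \<in> C"
  by (rule subspace_0[OF subspace_C])

lemma subspace_friedrichs: "subspace friedrichs"
proof -
  have "0 \<in> closure_dom"
    using approx_const[OF zero_mem_C] by (auto simp: closure_dom_def)
  moreover from this have "closure_form 0 h = 0" if "h \<in> closure_dom" for h
    using closure_form_lincomb[of 0 0 h 0 0] that by simp
  ultimately have "(0, 0) \<in> friedrichs"
    by (simp add: friedrichs_def)
  then show ?thesis
    using friedrichs_lincomb[of _ _ _ _ 1 1] friedrichs_lincomb[of _ _ 0 0 _ 0]
    by (auto simp: subspace_def zero_prod_def)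
qed

text \<open>The operator is monotone, so its resolvents do not increase the norm; this also gives their
  uniqueness.\<close>

lemma norm_le_friedrichs:
  assumes uw: "(u, w) \<in> friedrichs" and h: "0 < h"
  shows "norm u \<le> norm (u + h *\<^sub>R w)"
proof (cases "u = 0")
  case False
  have "0 \<le> inner w u"
    using uw closure_form_nonneg[of u] by (auto simp: friedrichs_def)
  then have "norm u * norm u \<le> inner (u + h *\<^sub>R w) u"
    using h by (simp add: inner_add_left flip: power2_norm_eq_inner power2_eq_square)
  also have "\<dots> \<le> norm (u + h *\<^sub>R w) * norm u"
    by (rule norm_cauchy_schwarz)
  finally show ?thesis using False by simp
qed simp

text \<open>The resolvent \<open>(1 + h L)\<inverse> g\<close> is the limit of every minimising sequence of the following
  strictly convex functional on the core.\<close>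

definition energy_fun :: "real \<Rightarrow> 'h \<Rightarrow> 'h \<Rightarrow> real" where
  "energy_fun h g \<phi> = (norm (\<phi> - g))\<^sup>2 + h * E \<phi> \<phi>"

definition minimizing :: "real \<Rightarrow> 'h \<Rightarrow> (nat \<Rightarrow> 'h) \<Rightarrow> bool" where
  "minimizing h g \<phi> \<longleftrightarrow> (\<forall>n. \<phi> n \<in> C) \<and>
     (\<lambda>n. energy_fun h g (\<phi> n)) \<longlonglongrightarrow> Inf (energy_fun h g ` C)"

definition res :: "real \<Rightarrow> 'h \<Rightarrow> 'h" where
  "res h g = (THE u. \<forall>\<phi>. minimizing h g \<phi> \<longrightarrow> \<phi> \<longlonglongrightarrow> u)"

context
  fixes h :: real and g :: 'h
  assumes h: "0 < h"
begin

lemma energy_fun_nonneg: "\<phi> \<in> C \<Longrightarrow> 0 \<le> energy_fun h g \<phi>"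
  using h by (simp add: energy_fun_def E_nonneg)

lemma bdd_below_energy_fun: "bdd_below (energy_fun h g ` C)"
  using energy_fun_nonneg by (auto intro!: bdd_belowI2)

lemma Inf_energy_fun_le: "\<phi> \<in> C \<Longrightarrow> Inf (energy_fun h g ` C) \<le> energy_fun h g \<phi>"
  by (intro cInf_lower bdd_below_energy_fun imageI)

lemma ex_minimizing: "\<exists>\<phi>. minimizing h g \<phi>"
proof -
  have "\<exists>\<phi>\<in>C. energy_fun h g \<phi> < Inf (energy_fun h g ` C) + inverse (real (Suc n))" for n
    using cInf_lessD[of "energy_fun h g ` C" "Inf (energy_fun h g ` C) + inverse (real (Suc n))"]
      zero_mem_C by fastforce
  then obtain \<phi> where C: "\<And>n. \<phi> n \<in> C"
    and lt: "\<And>n. energy_fun h g (\<phi> n) < Inf (energy_fun h g ` C) + inverse (real (Suc n))"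
    by metis
  have "(\<lambda>n. energy_fun h g (\<phi> n)) \<longlonglongrightarrow> Inf (energy_fun h g ` C)"
  proof (rule tendsto_sandwich[OF always_eventually always_eventually tendsto_const])
    show "(\<lambda>n. Inf (energy_fun h g ` C) + inverse (real (Suc n))) \<longlonglongrightarrow> Inf (energy_fun h g ` C)"
      using tendsto_add[OF tendsto_const LIMSEQ_inverse_real_of_nat] by fastforce
  qed (blast intro: Inf_energy_fun_le C less_imp_le[OF lt])+
  then show ?thesis
    using C by (auto simp: minimizing_def)
qed

text \<open>Strict convexity in quantitative form: by the parallelogram law, two vectors that almost
  minimise the functional are close in the norm and in the form.\<close>

lemma energy_fun_parallelogram:
  assumes "\<phi> \<in> C" "\<psi> \<in> C"
  shows "(norm (\<phi> - \<psi>))\<^sup>2 + h * E (\<phi> - \<psi>) (\<phi> - \<psi>)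
    \<le> 2 * (energy_fun h g \<phi> - Inf (energy_fun h g ` C)) + 2 * (energy_fun h g \<psi> - Inf (energy_fun h g ` C))"
proof -
  define \<theta> where "\<theta> = (1/2) *\<^sub>R (\<phi> + \<psi>)"
  have \<theta>: "\<theta> \<in> C"
    unfolding \<theta>_def by (intro C_scale C_add assms)
  have parallelogram: "(norm (p - q))\<^sup>2 + (norm (p + q))\<^sup>2 = 2 * (norm p)\<^sup>2 + 2 * (norm q)\<^sup>2" for p q :: 'h
    unfolding power2_norm_eq_inner by (simp add: inner_add inner_diff inner_commute)
  have "(\<phi> - g) + (\<psi> - g) = 2 *\<^sub>R (\<theta> - g)"
    by (simp add: \<theta>_def scaleR_2 scaleR_diff_right)
  then have "(norm ((\<phi> - g) + (\<psi> - g)))\<^sup>2 = 4 * (norm (\<theta> - g))\<^sup>2"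
    by (simp add: power_mult_distrib)
  then have 1: "(norm (\<phi> - \<psi>))\<^sup>2 + 4 * (norm (\<theta> - g))\<^sup>2 = 2 * (norm (\<phi> - g))\<^sup>2 + 2 * (norm (\<psi> - g))\<^sup>2"
    using parallelogram[of "\<phi> - g" "\<psi> - g"] by simp
  have 2: "E (\<phi> - \<psi>) (\<phi> - \<psi>) + 4 * E \<theta> \<theta> = 2 * E \<phi> \<phi> + 2 * E \<psi> \<psi>"
    using assms E_commute[OF assms] by (simp add: \<theta>_def E_left E_scale_left E_right C_add C_diff C_scale field_simps)
  have "(norm (\<phi> - \<psi>))\<^sup>2 + h * E (\<phi> - \<psi>) (\<phi> - \<psi>)
      = 2 * energy_fun h g \<phi> + 2 * energy_fun h g \<psi> - 4 * energy_fun h g \<theta>"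
    using 1 arg_cong[OF 2, of "\<lambda>x. h * x"] by (simp add: energy_fun_def algebra_simps)
  then show ?thesis
    using Inf_energy_fun_le[OF \<theta>] by simp
qed

lemma minimizing_approx:
  assumes \<phi>: "minimizing h g \<phi>"
  shows "\<exists>u. approx \<phi> u"
proof -
  let ?I = "Inf (energy_fun h g ` C)"
  have C: "\<phi> n \<in> C" for n
    using \<phi> by (simp add: minimizing_def)
  have ev: "\<exists>N. \<forall>i\<ge>N. \<forall>j\<ge>N. (norm (\<phi> i - \<phi> j))\<^sup>2 + h * E (\<phi> i - \<phi> j) (\<phi> i - \<phi> j) < e" if e: "0 < e" for e
  proof -
    have "eventually (\<lambda>n. energy_fun h g (\<phi> n) < ?I + e/4) sequentially"
      by (rule order_tendstoD[where y = ?I]) (use \<phi> e in \<open>auto simp: minimizing_def\<close>)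
    then obtain N where N: "\<And>n. n \<ge> N \<Longrightarrow> energy_fun h g (\<phi> n) < ?I + e/4"
      by (auto simp: eventually_sequentially)
    have "(norm (\<phi> i - \<phi> j))\<^sup>2 + h * E (\<phi> i - \<phi> j) (\<phi> i - \<phi> j) < e" if "i \<ge> N" "j \<ge> N" for i j
    proof -
      have "2 * (a - I) + 2 * (b - I) < e" if "a < I + e/4" "b < I + e/4" for a b I
        using that by (simp add: field_simps)
      from le_less_trans[OF energy_fun_parallelogram[OF C C] this[OF N[OF that(1)] N[OF that(2)]]]
      show ?thesis .
    qed
    then show ?thesis by blast
  qed
  have nE: "0 \<le> h * E (\<phi> i - \<phi> j) (\<phi> i - \<phi> j)" for i j
    using h by (simp add: E_nonneg C_diff C)
  have "Cauchy \<phi>"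
  proof (rule metric_CauchyI)
    fix e :: real
    assume e: "0 < e"
    then obtain N where N: "\<And>i j. i \<ge> N \<Longrightarrow> j \<ge> N \<Longrightarrow>
        (norm (\<phi> i - \<phi> j))\<^sup>2 + h * E (\<phi> i - \<phi> j) (\<phi> i - \<phi> j) < e\<^sup>2"
      using ev[of "e\<^sup>2"] by auto
    have "dist (\<phi> i) (\<phi> j) < e" if "i \<ge> N" "j \<ge> N" for i j
      using N[OF that] nE[of i j] e by (intro power2_less_imp_less[of _ e]) (auto simp: dist_norm)
    then show "\<exists>N. \<forall>i\<ge>N. \<forall>j\<ge>N. dist (\<phi> i) (\<phi> j) < e" by blast
  qed
  then obtain u where "\<phi> \<longlonglongrightarrow> u"
    by (auto simp: Cauchy_convergent_iff convergent_def)
  moreover have "\<exists>N. \<forall>i\<ge>N. \<forall>j\<ge>N. E (\<phi> i - \<phi> j) (\<phi> i - \<phi> j) < e" if e: "0 < e" for e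
  proof -
    obtain N where N: "\<And>i j. i \<ge> N \<Longrightarrow> j \<ge> N \<Longrightarrow>
        (norm (\<phi> i - \<phi> j))\<^sup>2 + h * E (\<phi> i - \<phi> j) (\<phi> i - \<phi> j) < h * e"
      using ev[of "h * e"] h e by auto
    have "h * E (\<phi> i - \<phi> j) (\<phi> i - \<phi> j) < h * e" if "i \<ge> N" "j \<ge> N" for i j
      using N[OF that] zero_le_power2[of "norm (\<phi> i - \<phi> j)"] by linarith
    then show ?thesis using h by auto
  qed
  ultimately show ?thesis
    using C by (auto simp: approx_def)
qed

text \<open>Two minimising sequences approach each other, so the limit does not depend on the sequence.\<close>

lemma minimizing_tendsto:
  assumes \<phi>: "minimizing h g \<phi>"
  shows "\<phi> \<longlonglongrightarrow> res h g"
proof -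
  let ?I = "Inf (energy_fun h g ` C)"
  obtain u where u: "approx \<phi> u"
    using minimizing_approx[OF \<phi>] by blast
  have "\<psi> \<longlonglongrightarrow> u" if \<psi>: "minimizing h g \<psi>" for \<psi>
  proof -
    have C: "\<phi> n \<in> C" "\<psi> n \<in> C" for n
      using \<phi> \<psi> by (auto simp: minimizing_def)
    have le: "(norm (\<psi> n - \<phi> n))\<^sup>2 \<le> 2 * (energy_fun h g (\<psi> n) - ?I) + 2 * (energy_fun h g (\<phi> n) - ?I)" for n
      using energy_fun_parallelogram[OF C(2) C(1), of n n] h E_nonneg[OF C_diff[OF C(2) C(1)], of n n]
      by (smt (verit) mult_nonneg_nonneg)
    have "(\<lambda>n. 2 * (energy_fun h g (\<psi> n) - ?I) + 2 * (energy_fun h g (\<phi> n) - ?I)) \<longlonglongrightarrow> 2 * (?I - ?I) + 2 * (?I - ?I)"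
      using \<phi> \<psi> by (intro tendsto_intros) (auto simp: minimizing_def)
    then have "(\<lambda>n. 2 * (energy_fun h g (\<psi> n) - ?I) + 2 * (energy_fun h g (\<phi> n) - ?I)) \<longlonglongrightarrow> 0"
      by (simp only: diff_self mult_zero_right add_0_right)
    then have "(\<lambda>n. (norm (\<psi> n - \<phi> n))\<^sup>2) \<longlonglongrightarrow> 0"
      by (rule tendsto_sandwich[OF always_eventually always_eventually tendsto_const, rotated 2])
        (blast intro: le zero_le_power2)+
    then have "(\<lambda>n. \<psi> n - \<phi> n) \<longlonglongrightarrow> 0"
      by (rule tendsto_norm_zero_cancel[OF tendsto_zero_power2_cancel])
    then have "(\<lambda>n. \<psi> n - \<phi> n + \<phi> n) \<longlonglongrightarrow> 0 + u"
      by (intro tendsto_add approxD(2)[OF u])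
    then show ?thesis by simp
  qed
  moreover have "v = u" if "\<forall>\<psi>. minimizing h g \<psi> \<longrightarrow> \<psi> \<longlonglongrightarrow> v" for v
    using that \<phi> approxD(2)[OF u] LIMSEQ_unique by blast
  ultimately have "res h g = u"
    unfolding res_def by (intro the_equality) auto
  then show ?thesis
    using approxD(2)[OF u] by simp
qed

lemma approx_res:
  assumes \<phi>: "minimizing h g \<phi>"
  shows "approx \<phi> (res h g)"
  using minimizing_approx[OF \<phi>] minimizing_tendsto[OF \<phi>] by (auto simp: approx_def)

text \<open>The first variation of the functional at the minimiser vanishes. As the minimiser is a limit of
  core vectors \<open>\<phi> n\<close>, the first variation \<open>l n\<close> is taken at \<open>\<phi> n\<close> and
  bounded through the discriminant by the distance of the value at \<open>\<phi> n\<close> from the infimum.\<close>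

lemma res_mem_friedrichs: "(res h g, (g - res h g) /\<^sub>R h) \<in> friedrichs"
proof -
  let ?I = "Inf (energy_fun h g ` C)"
  obtain \<phi> where \<phi>: "minimizing h g \<phi>"
    using ex_minimizing by blast
  have C: "\<phi> n \<in> C" for n
    using \<phi> by (simp add: minimizing_def)
  have ap: "approx \<phi> (res h g)"
    by (rule approx_res[OF \<phi>])
  have "closure_form (res h g) v = inner ((g - res h g) /\<^sub>R h) v" if v: "v \<in> closure_dom" for v
  proof -
    obtain \<psi> where \<psi>: "approx \<psi> v"
      using v by (auto simp: closure_dom_def)
    note C' = approxD(1)[OF \<psi>]
    define l where "l n = inner (\<phi> n - g) (\<psi> n) + h * E (\<phi> n) (\<psi> n)" for n
    have le: "(l n)\<^sup>2 \<le> (energy_fun h g (\<phi> n) - ?I) * ((norm (\<psi> n))\<^sup>2 + h * E (\<psi> n) (\<psi> n))" for n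
    proof (rule discriminant_le)
      fix s
      have square: "(norm (p + s *\<^sub>R q))\<^sup>2 = (norm p)\<^sup>2 + 2 * s * inner p q + s\<^sup>2 * (norm q)\<^sup>2" for p q :: 'h
        unfolding power2_norm_eq_inner
        by (simp add: inner_add inner_commute[of q p] power2_eq_square algebra_simps)
      have eq: "\<phi> n + s *\<^sub>R \<psi> n - g = (\<phi> n - g) + s *\<^sub>R \<psi> n" by simp
      have "(norm (\<phi> n + s *\<^sub>R \<psi> n - g))\<^sup>2
          = (norm (\<phi> n - g))\<^sup>2 + 2 * s * inner (\<phi> n - g) (\<psi> n) + s\<^sup>2 * (norm (\<psi> n))\<^sup>2"
        unfolding eq by (rule square)
      moreover have "E (\<phi> n + s *\<^sub>R \<psi> n) (\<phi> n + s *\<^sub>R \<psi> n)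
          = E (\<phi> n) (\<phi> n) + 2 * s * E (\<phi> n) (\<psi> n) + s\<^sup>2 * E (\<psi> n) (\<psi> n)"
        using E_commute[OF C C', of n n] C C'
        by (simp add: E_left E_scale_left E_right C_add C_scale power2_eq_square algebra_simps)
      ultimately have "energy_fun h g (\<phi> n + s *\<^sub>R \<psi> n)
          = energy_fun h g (\<phi> n) + 2 * s * l n + s\<^sup>2 * ((norm (\<psi> n))\<^sup>2 + h * E (\<psi> n) (\<psi> n))"
        by (simp add: energy_fun_def l_def algebra_simps)
      then show "0 \<le> energy_fun h g (\<phi> n) - ?I + 2 * s * l n + s\<^sup>2 * ((norm (\<psi> n))\<^sup>2 + h * E (\<psi> n) (\<psi> n))"
        using Inf_energy_fun_le[OF C_add[OF C C_scale[OF C']], of n s n] by simp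
    qed (use h E_nonneg[OF C'] in auto)
    have "(\<lambda>n. (energy_fun h g (\<phi> n) - ?I) * ((norm (\<psi> n))\<^sup>2 + h * E (\<psi> n) (\<psi> n)))
        \<longlonglongrightarrow> (?I - ?I) * ((norm v)\<^sup>2 + h * closure_form v v)"
      using \<phi> by (intro tendsto_intros closure_form_tendsto[OF \<psi> \<psi>] approxD(2)[OF \<psi>]) (simp add: minimizing_def)
    then have "(\<lambda>n. (energy_fun h g (\<phi> n) - ?I) * ((norm (\<psi> n))\<^sup>2 + h * E (\<psi> n) (\<psi> n))) \<longlonglongrightarrow> 0"
      by (simp only: diff_self mult_zero_left)
    then have "(\<lambda>n. (l n)\<^sup>2) \<longlonglongrightarrow> 0"
      by (rule Lim_null_comparison[rotated]) (simp add: le)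
    then have l0: "l \<longlonglongrightarrow> 0"
      by (rule tendsto_zero_power2_cancel)
    have "l \<longlonglongrightarrow> inner (res h g - g) v + h * closure_form (res h g) v"
      unfolding l_def[abs_def]
      by (intro tendsto_intros closure_form_tendsto[OF ap \<psi>] approxD(2)[OF ap] approxD(2)[OF \<psi>])
    from LIMSEQ_unique[OF this l0] show ?thesis
      using h by (simp add: field_simps inner_diff_left)
  qed
  then show ?thesis
    using ap by (auto simp: friedrichs_def closure_dom_def)
qed

lemma res_friedrichs:
  assumes uw: "(u, w) \<in> friedrichs" and g: "g = u + h *\<^sub>R w"
  shows "res h g = u"
proof -
  have "(res h g - u, (g - res h g) /\<^sub>R h - w) \<in> friedrichs"
    using friedrichs_lincomb[OF res_mem_friedrichs uw, of 1 "-1"] by simp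
  from norm_le_friedrichs[OF this h] show ?thesis
    using h by (simp add: g algebra_simps)
qed

lemma norm_res_le: "norm (res h g) \<le> norm g"
  using norm_le_friedrichs[OF res_mem_friedrichs h] h by simp

text \<open>Comparison of the minimal value with the value at \<open>g\<close> itself.\<close>

lemma norm_res_minus_le:
  assumes g: "g \<in> C"
  shows "(norm (res h g - g))\<^sup>2 \<le> h * E g g"
proof -
  obtain \<psi> where \<psi>: "minimizing h g \<psi>"
    using ex_minimizing by blast
  have "(norm (res h g - g))\<^sup>2 \<le> Inf (energy_fun h g ` C)"
  proof (rule LIMSEQ_le)
    show "(\<lambda>n. (norm (\<psi> n - g))\<^sup>2) \<longlonglongrightarrow> (norm (res h g - g))\<^sup>2"
      by (intro tendsto_intros minimizing_tendsto[OF \<psi>])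
    show "(\<lambda>n. energy_fun h g (\<psi> n)) \<longlonglongrightarrow> Inf (energy_fun h g ` C)"
      using \<psi> by (simp add: minimizing_def)
    show "\<exists>N. \<forall>n\<ge>N. (norm (\<psi> n - g))\<^sup>2 \<le> energy_fun h g (\<psi> n)"
      using \<psi> h by (auto simp: energy_fun_def minimizing_def E_nonneg)
  qed
  also have "\<dots> \<le> h * E g g"
    using Inf_energy_fun_le[OF g] by (simp add: energy_fun_def)
  finally show ?thesis .
qed

end

lemma res_tendsto: "((\<lambda>h. res h g) \<longlongrightarrow> g) (at_right 0)"
proof (rule tendstoI)
  fix e :: real
  assume e: "0 < e"
  have "g \<in> closure C" using dense_C by simp
  then obtain \<phi> where \<phi>: "\<phi> \<in> C" "dist \<phi> g < e/3"
    using e closure_approachable[of g C] by (meson divide_pos_pos zero_less_numeral)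
  have "((\<lambda>h. sqrt (h * E \<phi> \<phi>)) \<longlongrightarrow> 0) (at_right 0)"
    by (rule tendsto_eq_intros refl | simp)+
  then have "eventually (\<lambda>h. sqrt (h * E \<phi> \<phi>) < e/3) (at_right 0)"
    by (rule order_tendstoD) (use e in simp)
  then show "eventually (\<lambda>h. dist (res h g) g < e) (at_right 0)"
    using eventually_at_right_less
  proof eventually_elim
    case (elim h)
    have "(res h g - res h \<phi>, (g - res h g) /\<^sub>R h - (\<phi> - res h \<phi>) /\<^sub>R h) \<in> friedrichs"
      using friedrichs_lincomb[OF res_mem_friedrichs[OF elim(2)] res_mem_friedrichs[OF elim(2)], of 1 g "-1" \<phi>]
      by simp
    from norm_le_friedrichs[OF this elim(2)] have "norm (res h g - res h \<phi>) \<le> norm (g - \<phi>)"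
      using elim(2) by (simp add: algebra_simps)
    moreover have "norm (res h \<phi> - \<phi>) \<le> sqrt (h * E \<phi> \<phi>)"
      by (rule real_le_rsqrt) (rule norm_res_minus_le[OF elim(2) \<phi>(1)])
    ultimately show ?case
      using elim(1) \<phi>(2) norm_triangle_ineq[of "res h g - res h \<phi>" "res h \<phi> - \<phi>"]
        norm_triangle_ineq[of "res h g - \<phi>" "\<phi> - g"]
      by (simp add: dist_norm norm_minus_commute)
  qed
qed

text \<open>Invariance of a closed set \<open>K\<close> under the resolvent: projecting the core into \<open>K\<close> without
  increasing the functional yields a minimising sequence inside \<open>K\<close>.\<close>

lemma res_mem_closed:
  assumes h: "0 < h" and K: "closed K"
    and trunc: "\<And>\<phi>. \<phi> \<in> C \<Longrightarrow> \<exists>\<psi>\<in>C. \<psi> \<in> K \<and> energy_fun h g \<psi> \<le> energy_fun h g \<phi>"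
  shows "res h g \<in> K"
proof -
  obtain \<phi> where \<phi>: "minimizing h g \<phi>"
    using ex_minimizing[OF h] by blast
  then have "\<forall>n. \<exists>\<psi>. \<psi> \<in> C \<and> \<psi> \<in> K \<and> energy_fun h g \<psi> \<le> energy_fun h g (\<phi> n)"
    using trunc unfolding minimizing_def by blast
  then obtain \<psi> where \<psi>: "\<And>n. \<psi> n \<in> C" "\<And>n. \<psi> n \<in> K"
    "\<And>n. energy_fun h g (\<psi> n) \<le> energy_fun h g (\<phi> n)"
    by metis
  have "(\<lambda>n. energy_fun h g (\<psi> n)) \<longlonglongrightarrow> Inf (energy_fun h g ` C)"
  proof (rule tendsto_sandwich[OF always_eventually always_eventually tendsto_const])
    show "(\<lambda>n. energy_fun h g (\<phi> n)) \<longlonglongrightarrow> Inf (energy_fun h g ` C)"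
      using \<phi> by (simp add: minimizing_def)
  qed (blast intro: \<psi> Inf_energy_fun_le[OF h])+
  then have "\<psi> \<longlonglongrightarrow> res h g"
    using \<psi>(1) by (intro minimizing_tendsto[OF h]) (simp add: minimizing_def)
  then show ?thesis
    using closed_sequentially[OF K] \<psi>(2) by blast
qed

sublocale accretive_operator friedrichs res
  by standard (auto intro: subspace_friedrichs res_mem_friedrichs res_friedrichs norm_res_le res_tendsto)

end

section \<open>The weighted space as a Hilbert space\<close>

locale graph =
  fixes b :: "'a \<Rightarrow> 'a \<Rightarrow> real" and m :: "'a \<Rightarrow> real"
  assumes weighted: "weighted_graph b m"
begin

lemma b_nonneg: "0 \<le> b x y" and b_commute: "b x y = b y x" and m_pos: "0 < m x"
  and locally_finite: "finite {y. 0 < b x y}"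
  using weighted unfolding weighted_graph_def by blast+

definition to_ell2 :: "('a \<Rightarrow> real) \<Rightarrow> 'a ell2" where
  "to_ell2 f = ell2_of (\<lambda>x. f x * sqrt (m x))"

definition from_ell2 :: "'a ell2 \<Rightarrow> 'a \<Rightarrow> real" where
  "from_ell2 F x = ell2_fun F x / sqrt (m x)"

lemma sqrt_m: "0 < sqrt (m x)" "sqrt (m x) * sqrt (m x) = m x" "sqrt (m x) \<noteq> 0"
  using m_pos[of x] by auto

lemma mem_l2_iff: "f \<in> l2 m \<longleftrightarrow> (\<lambda>x. (f x * sqrt (m x))\<^sup>2) summable_on UNIV"
  using m_pos by (simp add: l2_def power_mult_distrib less_imp_le)

lemma ell2_fun_to_ell2: "f \<in> l2 m \<Longrightarrow> ell2_fun (to_ell2 f) x = f x * sqrt (m x)"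
  by (simp add: mem_l2_iff to_ell2_def ell2_of_inverse)

lemma from_ell2_mem_l2: "from_ell2 F \<in> l2 m"
  using ell2_fun_summable[of F] sqrt_m by (simp add: mem_l2_iff from_ell2_def)

lemma from_ell2_to_ell2: "f \<in> l2 m \<Longrightarrow> from_ell2 (to_ell2 f) = f"
  using sqrt_m by (simp add: fun_eq_iff from_ell2_def ell2_fun_to_ell2)

lemma to_ell2_from_ell2: "to_ell2 (from_ell2 F) = F"
  by (rule ell2_eqI) (use sqrt_m in \<open>simp add: ell2_fun_to_ell2 from_ell2_mem_l2\<close>, simp add: from_ell2_def sqrt_m)

lemma from_ell2_simps:
  "from_ell2 0 x = 0" "from_ell2 (F + G) x = from_ell2 F x + from_ell2 G x"
  "from_ell2 (F - G) x = from_ell2 F x - from_ell2 G x" "from_ell2 (c *\<^sub>R F) x = c * from_ell2 F x"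
  "from_ell2 (- F) x = - from_ell2 F x"
  by (simp_all add: from_ell2_def ell2_fun_simps add_divide_distrib diff_divide_distrib)

lemma to_ell2_eqI: "(\<And>x. f x = from_ell2 F x) \<Longrightarrow> to_ell2 f = F"
  using to_ell2_from_ell2[of F] by (metis ext)

lemma l2_lincomb: "f \<in> l2 m \<Longrightarrow> g \<in> l2 m \<Longrightarrow> (\<lambda>x. c * f x + d * g x) \<in> l2 m"
  using from_ell2_mem_l2[of "c *\<^sub>R to_ell2 f + d *\<^sub>R to_ell2 g"] from_ell2_to_ell2
  by (simp add: from_ell2_simps[abs_def])

lemma to_ell2_lincomb:
  "f \<in> l2 m \<Longrightarrow> g \<in> l2 m \<Longrightarrow> to_ell2 (\<lambda>x. c * f x + d * g x) = c *\<^sub>R to_ell2 f + d *\<^sub>R to_ell2 g"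
  by (rule to_ell2_eqI) (simp add: from_ell2_simps from_ell2_to_ell2)

lemma to_ell2_diff: "f \<in> l2 m \<Longrightarrow> g \<in> l2 m \<Longrightarrow> to_ell2 (\<lambda>x. f x - g x) = to_ell2 f - to_ell2 g"
  using to_ell2_lincomb[of f g 1 "-1"] by simp

lemma l2_diff: "f \<in> l2 m \<Longrightarrow> g \<in> l2 m \<Longrightarrow> (\<lambda>x. f x - g x) \<in> l2 m"
  using l2_lincomb[of f g 1 "-1"] by simp

lemma inner_to_ell2: "f \<in> l2 m \<Longrightarrow> g \<in> l2 m \<Longrightarrow> inner (to_ell2 f) (to_ell2 g) = l2_inner m f g"
  using sqrt_m by (simp add: inner_ell2_def ell2_fun_to_ell2 l2_inner_def mult.assoc mult.left_commute)

lemma norm_to_ell2: "f \<in> l2 m \<Longrightarrow> norm (to_ell2 f) = l2_norm m f"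
  by (simp add: norm_eq_sqrt_inner inner_to_ell2 l2_norm_def)

lemma Cc_l2: "f \<in> Cc \<Longrightarrow> f \<in> l2 m"
  by (auto simp: Cc_def mem_l2_iff sqrt_m power2_eq_square intro!: finite_nonzero_values_imp_summable_on elim: finite_subset[rotated])

lemma l2_inner_Cc:
  assumes "finite S" "\<And>x. x \<notin> S \<Longrightarrow> g x = 0"
  shows "l2_inner m f g = (\<Sum>x\<in>S. f x * g x * m x)"
proof -
  have "l2_inner m f g = (\<Sum>\<^sub>\<infinity>x\<in>S. f x * g x * m x)"
    unfolding l2_inner_def by (rule infsum_cong_neutral) (use assms in auto)
  then show ?thesis using assms by simp
qed

lemma closed_from_ell2_le: "closed {F. \<forall>x. from_ell2 F x \<le> v x}"
  unfolding Collect_all_eq from_ell2_def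
  by (intro closed_INT ballI closed_Collect_le continuous_intros
      bounded_linear.continuous_on[OF bounded_linear_ell2_fun]) (use sqrt_m in auto)

section \<open>The Laplacian on finitely supported functions\<close>

definition lap :: "('a \<Rightarrow> real) \<Rightarrow> 'a \<Rightarrow> real" where
  "lap f x = (\<Sum>y | 0 < b x y. b x y * (f x - f y)) / m x"

lemma lap_diff: "lap (\<lambda>x. f x - g x) x = lap f x - lap g x"
  unfolding lap_def diff_divide_distrib[symmetric] sum_subtractf[symmetric]
  by (simp add: algebra_simps)

lemma Cc_lincomb: "f \<in> Cc \<Longrightarrow> g \<in> Cc \<Longrightarrow> (\<lambda>x. c * f x + d * g x) \<in> Cc"
  unfolding Cc_def mem_Collect_eq
  by (rule finite_subset[of _ "{x. f x \<noteq> 0} \<union> {x. g x \<noteq> 0}"]) auto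

lemma Cc_subset: "f \<in> Cc \<Longrightarrow> (\<And>x. f x = 0 \<Longrightarrow> g x = 0) \<Longrightarrow> g \<in> Cc"
  unfolding Cc_def mem_Collect_eq by (erule finite_subset[rotated]) auto

lemma lap_Cc:
  assumes "f \<in> Cc"
  shows "lap f \<in> Cc"
  unfolding Cc_def mem_Collect_eq
proof (rule finite_subset)
  let ?S = "{x. f x \<noteq> 0}"
  show "finite (?S \<union> (\<Union>x\<in>?S. {y. 0 < b x y}))"
    using assms locally_finite by (auto simp: Cc_def)
  show "{x. lap f x \<noteq> 0} \<subseteq> ?S \<union> (\<Union>x\<in>?S. {y. 0 < b x y})"
  proof
    fix x
    assume "x \<in> {x. lap f x \<noteq> 0}"
    then have "(\<Sum>y | 0 < b x y. b x y * (f x - f y)) \<noteq> 0"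
      by (auto simp: lap_def)
    then obtain y where "0 < b x y" "f x \<noteq> f y"
      by (auto elim: sum.not_neutral_contains_not_neutral)
    then show "x \<in> ?S \<union> (\<Union>x\<in>?S. {y. 0 < b x y})"
      using b_commute[of x y] by (cases "f x = 0") auto
  qed
qed

text \<open>Green's formula. As \<open>v\<close> is arbitrary, finitely supported functions can be tested against
  supersolutions that are not square summable.\<close>

lemma energy_eq_l2_inner_lap:
  assumes "\<phi> \<in> Cc"
  shows "energy b v \<phi> = l2_inner m (lap v) \<phi>"
proof -
  define S where "S = {x. \<phi> x \<noteq> 0}"
  define W where "W = S \<union> (\<Union>x\<in>S. {y. 0 < b x y})"
  have S: "finite S" "\<And>x. x \<notin> S \<Longrightarrow> \<phi> x = 0"
    using assms by (auto simp: S_def Cc_def)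
  have W: "finite W" "S \<subseteq> W"
    using S(1) locally_finite by (auto simp: W_def)
  have b0: "b x y = 0" if "\<not> 0 < b x y" for x y
    using b_nonneg[of x y] that by simp
  have nbr: "b x y * (v x - v y) * (\<phi> x - \<phi> y) = 0" if "\<not> (x \<in> W \<and> y \<in> W)" for x y
  proof (cases "0 < b x y \<and> \<phi> x \<noteq> \<phi> y")
    case True
    then have "x \<in> S \<or> y \<in> S"
      using S(2) by metis
    moreover have "0 < b x y" "0 < b y x"
      using True b_commute by metis+
    ultimately have "x \<in> W \<and> y \<in> W"
      by (auto simp: W_def)
    then show ?thesis using that by simp
  qed (use b0 in auto)
  have "(\<Sum>\<^sub>\<infinity>(x, y). b x y * (v x - v y) * (\<phi> x - \<phi> y))
      = (\<Sum>\<^sub>\<infinity>(x, y)\<in>W \<times> W. b x y * (v x - v y) * (\<phi> x - \<phi> y))"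
  proof (rule infsum_cong_neutral)
    fix p
    assume "p \<in> UNIV - W \<times> W"
    then show "(case p of (x, y) \<Rightarrow> b x y * (v x - v y) * (\<phi> x - \<phi> y)) = 0"
      using nbr[of "fst p" "snd p"] by (cases p) auto
  qed auto
  also have "\<dots> = (\<Sum>(x, y)\<in>W \<times> W. b x y * (v x - v y) * (\<phi> x - \<phi> y))"
    using W(1) by (intro infsum_finite) simp
  also have "\<dots> = (\<Sum>x\<in>W. \<Sum>y\<in>W. b x y * (v x - v y) * (\<phi> x - \<phi> y))"
    by (rule sum.cartesian_product[symmetric])
  also have "\<dots> = (\<Sum>x\<in>W. \<Sum>y\<in>W. b x y * (v x - v y) * \<phi> x) - (\<Sum>x\<in>W. \<Sum>y\<in>W. b x y * (v x - v y) * \<phi> y)"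
    by (simp add: right_diff_distrib sum_subtractf)
  also have "(\<Sum>x\<in>W. \<Sum>y\<in>W. b x y * (v x - v y) * \<phi> y) = (\<Sum>y\<in>W. \<Sum>x\<in>W. b x y * (v x - v y) * \<phi> y)"
    by (rule sum.swap)
  also have "\<dots> = (\<Sum>x\<in>W. \<Sum>y\<in>W. - (b x y * (v x - v y) * \<phi> x))"
    by (intro sum.cong refl) (subst b_commute, simp add: algebra_simps)
  also have "(\<Sum>x\<in>W. \<Sum>y\<in>W. b x y * (v x - v y) * \<phi> x) - \<dots>
      = 2 * (\<Sum>x\<in>W. (\<Sum>y\<in>W. b x y * (v x - v y)) * \<phi> x)"
    by (simp add: sum_negf sum_distrib_right)
  also have "(\<Sum>x\<in>W. (\<Sum>y\<in>W. b x y * (v x - v y)) * \<phi> x) = (\<Sum>x\<in>S. lap v x * \<phi> x * m x)"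
  proof (rule sum.mono_neutral_cong_right[OF W(1,2)])
    fix x
    assume x: "x \<in> S"
    have "(\<Sum>y\<in>W. b x y * (v x - v y)) = (\<Sum>y | 0 < b x y. b x y * (v x - v y))"
      by (rule sum.mono_neutral_right[OF W(1)]) (use x b0 in \<open>auto simp: W_def\<close>)
    then show "(\<Sum>y\<in>W. b x y * (v x - v y)) * \<phi> x = lap v x * \<phi> x * m x"
      using m_pos[of x] by (simp add: lap_def)
  qed (use S in auto)
  finally show ?thesis
    using l2_inner_Cc[OF S] by (simp add: energy_def)
qed

lemma energy_commute: "energy b f g = energy b g f"
  by (simp add: energy_def mult.commute mult.left_commute)

text \<open>Holds for all functions, as the infinite sum of a divergent family is \<open>0\<close>.\<close>

lemma energy_nonneg:
  assumes "\<And>x y. 0 \<le> (f x - f y) * (g x - g y)"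
  shows "0 \<le> energy b f g"
proof -
  have "0 \<le> (case p of (x, y) \<Rightarrow> b x y * (f x - f y) * (g x - g y))" for p
    by (cases p) (simp only: prod.case mult.assoc mult_nonneg_nonneg b_nonneg assms)
  then show ?thesis
    by (simp add: energy_def infsum_nonneg)
qed

text \<open>The symmetric operator whose Friedrichs extension is the Laplacian, transported to \<open>ell2\<close>.\<close>

definition core :: "'a ell2 set" where "core = to_ell2 ` Cc"

definition lap_ell2 :: "'a ell2 \<Rightarrow> 'a ell2" where "lap_ell2 F = to_ell2 (lap (from_ell2 F))"

lemma inner_lap_ell2: "\<phi> \<in> Cc \<Longrightarrow> \<psi> \<in> Cc \<Longrightarrow> inner (lap_ell2 (to_ell2 \<phi>)) (to_ell2 \<psi>) = energy b \<phi> \<psi>"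
  by (simp add: lap_ell2_def from_ell2_to_ell2 Cc_l2 inner_to_ell2 lap_Cc energy_eq_l2_inner_lap)

lemma closure_core: "closure core = UNIV"
proof -
  have "\<exists>G\<in>core. dist G F < e" if e: "0 < e" for F :: "'a ell2" and e
  proof -
    let ?f = "\<lambda>x. (ell2_fun F x)\<^sup>2"
    have "0 < (e/2)\<^sup>2" using e by simp
    from infsum_finite_approximation[OF ell2_fun_summable[of F] this]
    obtain S where S: "finite S" "dist (sum ?f S) (infsum ?f UNIV) \<le> (e/2)\<^sup>2"
      by auto
    define \<phi> where "\<phi> x = (if x \<in> S then from_ell2 F x else 0)" for x
    have \<phi>: "\<phi> \<in> Cc"
      using S(1) by (auto simp: \<phi>_def Cc_def)
    have fun_\<phi>: "ell2_fun (to_ell2 \<phi>) x = (if x \<in> S then ell2_fun F x else 0)" for x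
      using sqrt_m by (simp add: ell2_fun_to_ell2 Cc_l2[OF \<phi>]) (simp add: \<phi>_def from_ell2_def sqrt_m)
    have "(norm (to_ell2 \<phi> - F))\<^sup>2 = (\<Sum>\<^sub>\<infinity>x\<in>- S. ?f x)"
      unfolding norm_ell2_power2 ell2_fun_diff fun_\<phi>
      by (rule infsum_cong_neutral) auto
    also have "\<dots> = infsum ?f UNIV - sum ?f S"
      using infsum_Un_disjoint[OF summable_on_finite[OF S(1)]
          summable_on_subset_banach[OF ell2_fun_summable[of F], of "- S"]] S(1)
      by (simp add: Compl_partition)
    also have "\<dots> \<le> (e/2)\<^sup>2"
      using S(2) by (simp add: dist_real_def)
    finally have "norm (to_ell2 \<phi> - F) \<le> e/2"
      by (rule power2_le_imp_le) (use e in simp)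
    then show ?thesis
      using \<phi> e by (intro bexI[of _ "to_ell2 \<phi>"]) (auto simp: dist_norm core_def)
  qed
  then show ?thesis
    by (auto simp: closure_approachable)
qed

sublocale nonneg_symmetric_operator core lap_ell2
proof
  show "subspace core"
    unfolding subspace_def
  proof (intro conjI ballI allI)
    show "0 \<in> core"
      unfolding core_def
    proof (rule image_eqI)
      show "0 = to_ell2 (\<lambda>_. 0)"
        by (rule to_ell2_eqI[symmetric]) (simp add: from_ell2_simps)
    qed (simp add: Cc_def)
    fix F G c
    assume "F \<in> core" "G \<in> core"
    then obtain f g where fg: "f \<in> Cc" "g \<in> Cc" "F = to_ell2 f" "G = to_ell2 g"
      by (auto simp: core_def)
    have *: "c *\<^sub>R F + d *\<^sub>R G \<in> core" for c d
      using imageI[OF Cc_lincomb[OF fg(1,2), of c d], of to_ell2]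
      by (simp only: core_def fg(3,4) to_ell2_lincomb[OF fg(1,2)[THEN Cc_l2]])
    show "F + G \<in> core" "c *\<^sub>R F \<in> core"
      using *[of 1 1] *[of c 0] by simp_all
  qed
  show "closure core = UNIV"
    by (rule closure_core)
  show "inner (lap_ell2 F) G = inner (lap_ell2 G) F" if "F \<in> core" "G \<in> core" for F G
    using that by (auto simp: core_def inner_lap_ell2 energy_commute)
  show "0 \<le> inner (lap_ell2 F) F" if "F \<in> core" for F
    using that by (auto simp: core_def inner_lap_ell2 intro!: energy_nonneg zero_le_square)
qed

section \<open>The heat semigroup\<close>

lemma E_to_ell2: "\<phi> \<in> Cc \<Longrightarrow> \<psi> \<in> Cc \<Longrightarrow> E (to_ell2 \<phi>) (to_ell2 \<psi>) = energy b \<phi> \<psi>"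
  by (simp add: E_def inner_lap_ell2)

lemma to_ell2_mem_core_iff:
  assumes f: "f \<in> l2 m"
  shows "(to_ell2 f \<in> core) = (f \<in> Cc)"
proof
  assume "to_ell2 f \<in> core"
  then obtain g where g: "g \<in> Cc" "to_ell2 f = to_ell2 g"
    by (auto simp: core_def)
  have "f = g"
    using arg_cong[OF g(2), of from_ell2] by (simp add: from_ell2_to_ell2 f Cc_l2 g(1))
  then show "f \<in> Cc" using g(1) by simp
qed (simp add: core_def)

lemma form_approx_iff:
  "form_approx b m \<phi> f \<longleftrightarrow> f \<in> l2 m \<and> (\<forall>n. \<phi> n \<in> Cc) \<and> approx (\<lambda>n. to_ell2 (\<phi> n)) (to_ell2 f)"
proof (cases "f \<in> l2 m \<and> (\<forall>n. \<phi> n \<in> Cc)")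
  case True
  then have f: "f \<in> l2 m" and \<phi>: "\<phi> n \<in> Cc" for n by auto
  have "E (to_ell2 (\<phi> i) - to_ell2 (\<phi> j)) (to_ell2 (\<phi> i) - to_ell2 (\<phi> j))
      = energy b (\<lambda>x. \<phi> i x - \<phi> j x) (\<lambda>x. \<phi> i x - \<phi> j x)" for i j
    using \<phi> Cc_lincomb[OF \<phi> \<phi>, of 1 i "-1" j] by (simp add: E_to_ell2 flip: to_ell2_diff[OF Cc_l2 Cc_l2])
  moreover have "l2_norm m (\<lambda>x. \<phi> n x - f x) = norm (to_ell2 (\<phi> n) - to_ell2 f)" for n
    by (simp add: to_ell2_diff norm_to_ell2 l2_diff f \<phi> Cc_l2 flip: norm_to_ell2)
  ultimately show ?thesis
    using True by (simp add: form_approx_def approx_def to_ell2_mem_core_iff Cc_l2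
        tendsto_norm_zero_iff LIM_zero_iff)
qed (auto simp: form_approx_def)

lemma approx_to_ell2:
  assumes "approx \<Phi> F"
  shows "form_approx b m (\<lambda>n. from_ell2 (\<Phi> n)) (from_ell2 F)"
proof -
  have "from_ell2 (\<Phi> n) \<in> Cc" for n
    using approxD(1)[OF assms, of n] to_ell2_mem_core_iff[OF from_ell2_mem_l2, of "\<Phi> n"] by (simp add: to_ell2_from_ell2)
  then show ?thesis
    using assms by (simp add: form_approx_iff from_ell2_mem_l2 to_ell2_from_ell2)
qed

lemma form_dom_iff: "f \<in> form_dom b m \<longleftrightarrow> f \<in> l2 m \<and> to_ell2 f \<in> closure_dom"
  unfolding form_dom_def closure_dom_def mem_Collect_eq
  using approx_to_ell2[of _ "to_ell2 f"] from_ell2_to_ell2[of f] form_approx_iff by metis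

lemma closed_form_eq:
  assumes f: "f \<in> l2 m" and g: "g \<in> l2 m"
  shows "closed_form b m f g = closure_form (to_ell2 f) (to_ell2 g)"
proof -
  have "(\<forall>\<phi> \<psi>. form_approx b m \<phi> f \<longrightarrow> form_approx b m \<psi> g \<longrightarrow> (\<lambda>n. energy b (\<phi> n) (\<psi> n)) \<longlonglongrightarrow> c) \<longleftrightarrow>
      (\<forall>\<Phi> \<Psi>. approx \<Phi> (to_ell2 f) \<longrightarrow> approx \<Psi> (to_ell2 g) \<longrightarrow> (\<lambda>n. E (\<Phi> n) (\<Psi> n)) \<longlonglongrightarrow> c)" (is "?l \<longleftrightarrow> ?r") for c
  proof
    assume l: ?l
    show ?r
    proof (intro allI impI)
      fix \<Phi> \<Psi>
      assume "approx \<Phi> (to_ell2 f)" "approx \<Psi> (to_ell2 g)"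
      from this[THEN approx_to_ell2] have fa: "form_approx b m (\<lambda>n. from_ell2 (\<Phi> n)) f" "form_approx b m (\<lambda>n. from_ell2 (\<Psi> n)) g"
        using f g by (simp_all add: from_ell2_to_ell2)
      then have "(\<lambda>n. energy b (from_ell2 (\<Phi> n)) (from_ell2 (\<Psi> n))) \<longlonglongrightarrow> c"
        using l by blast
      then show "(\<lambda>n. E (\<Phi> n) (\<Psi> n)) \<longlonglongrightarrow> c"
        using fa E_to_ell2[of "from_ell2 (\<Phi> _)" "from_ell2 (\<Psi> _)"] by (simp add: form_approx_iff to_ell2_from_ell2)
    qed
  next
    assume r: ?r
    show ?l
    proof (intro allI impI)
      fix \<phi> \<psi>
      assume fa: "form_approx b m \<phi> f" "form_approx b m \<psi> g"
      then have "(\<lambda>n. E (to_ell2 (\<phi> n)) (to_ell2 (\<psi> n))) \<longlonglongrightarrow> c"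
        using r by (simp add: form_approx_iff)
      then show "(\<lambda>n. energy b (\<phi> n) (\<psi> n)) \<longlonglongrightarrow> c"
        using fa by (simp add: form_approx_iff E_to_ell2)
    qed
  qed
  then show ?thesis
    by (simp only: closed_form_def closure_form_def)
qed

lemma friedrichs_laplacian_iff:
  "friedrichs_laplacian b m f g \<longleftrightarrow> f \<in> l2 m \<and> g \<in> l2 m \<and> (to_ell2 f, to_ell2 g) \<in> friedrichs"
proof (cases "f \<in> l2 m \<and> g \<in> l2 m")
  case True
  then have fg: "f \<in> l2 m" "g \<in> l2 m" by auto
  have "(\<forall>h\<in>form_dom b m. closed_form b m f h = l2_inner m g h) \<longleftrightarrow>
      (\<forall>H\<in>closure_dom. closure_form (to_ell2 f) H = inner (to_ell2 g) H)" (is "?l \<longleftrightarrow> ?r")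
  proof
    assume l: ?l
    show ?r
    proof
      fix H
      assume "H \<in> closure_dom"
      then have "from_ell2 H \<in> form_dom b m"
        by (simp add: form_dom_iff from_ell2_mem_l2 to_ell2_from_ell2)
      then show "closure_form (to_ell2 f) H = inner (to_ell2 g) H"
        using l fg by (auto simp: closed_form_eq from_ell2_mem_l2 to_ell2_from_ell2 simp flip: inner_to_ell2)
    qed
  next
    assume ?r
    then show ?l
      using fg by (auto simp: form_dom_iff closed_form_eq inner_to_ell2)
  qed
  then show ?thesis
    using fg by (simp add: friedrichs_laplacian_def form_dom_iff friedrichs_def)
qed (auto simp: friedrichs_laplacian_def form_dom_iff)

lemma generator_iff:
  assumes P: "\<And>t f. 0 \<le> t \<Longrightarrow> f \<in> l2 m \<Longrightarrow> P t f \<in> l2 m"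
  shows "generator m P f g \<longleftrightarrow> f \<in> l2 m \<and> g \<in> l2 m \<and>
    ((\<lambda>t. (to_ell2 (P t f) - to_ell2 f) /\<^sub>R t) \<longlongrightarrow> to_ell2 g) (at_right 0)"
proof (cases "f \<in> l2 m \<and> g \<in> l2 m")
  case True
  then have fg: "f \<in> l2 m" "g \<in> l2 m" by auto
  have eq: "l2_norm m (\<lambda>x. (P t f x - f x) / t - g x) = norm ((to_ell2 (P t f) - to_ell2 f) /\<^sub>R t - to_ell2 g)"
    if "0 < t" for t
  proof -
    have Pt: "P t f \<in> l2 m" using P fg that by simp
    have "to_ell2 (\<lambda>x. (P t f x - f x) / t - g x) = (to_ell2 (P t f) - to_ell2 f) /\<^sub>R t - to_ell2 g"
      by (rule to_ell2_eqI) (simp add: from_ell2_simps from_ell2_to_ell2 fg Pt divide_inverse)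
    moreover have "(\<lambda>x. (P t f x - f x) / t - g x) \<in> l2 m"
      using l2_lincomb[OF l2_diff[OF Pt fg(1)] fg(2), of "1/t" "-1"] by simp
    ultimately show ?thesis
      by (metis norm_to_ell2)
  qed
  have "((\<lambda>t. l2_norm m (\<lambda>x. (P t f x - f x) / t - g x)) \<longlongrightarrow> 0) (at_right 0)
      \<longleftrightarrow> ((\<lambda>t. norm ((to_ell2 (P t f) - to_ell2 f) /\<^sub>R t - to_ell2 g)) \<longlongrightarrow> 0) (at_right 0)"
    using eventually_at_right_less[of "0 :: real"] by (intro tendsto_cong) (auto elim!: eventually_mono simp: eq)
  then show ?thesis
    using fg by (simp add: generator_def tendsto_norm_zero_iff LIM_zero_iff)
qed (auto simp: generator_def)

lemma C0_semigroup_semi: "C0_semigroup m (\<lambda>t f. from_ell2 (semi t (to_ell2 f)))"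
  unfolding C0_semigroup_def
proof (intro conjI allI impI ballI)
  fix f :: "'a \<Rightarrow> real" and t :: real
  assume f: "f \<in> l2 m"
  have "((\<lambda>t. norm (semi t (to_ell2 f) - to_ell2 f)) \<longlongrightarrow> 0) (at_right 0)"
    using semi_tendsto by (simp add: LIM_zero tendsto_norm_zero)
  moreover have "l2_norm m (\<lambda>x. from_ell2 (semi t (to_ell2 f)) x - f x) = norm (semi t (to_ell2 f) - to_ell2 f)" for t
    using f by (simp add: to_ell2_diff from_ell2_mem_l2 to_ell2_from_ell2 l2_diff flip: norm_to_ell2)
  ultimately show "((\<lambda>t. l2_norm m (\<lambda>x. from_ell2 (semi t (to_ell2 f)) x - f x)) \<longlongrightarrow> 0) (at_right 0)"
    by (simp only:)
next
  fix t :: real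
  show "\<exists>K. \<forall>f\<in>l2 m. l2_norm m (from_ell2 (semi t (to_ell2 f))) \<le> K * l2_norm m f"
    by (rule exI[of _ 1]) (simp add: from_ell2_mem_l2 to_ell2_from_ell2 norm_semi_le flip: norm_to_ell2)
next
  fix s t :: real and f :: "'a \<Rightarrow> real"
  assume "0 \<le> s" "0 \<le> t"
  then show "from_ell2 (semi (s + t) (to_ell2 f)) = from_ell2 (semi s (to_ell2 (from_ell2 (semi t (to_ell2 f)))))"
    by (simp add: to_ell2_from_ell2 semi_mult)
next
  fix t c d :: real and f g :: "'a \<Rightarrow> real"
  assume "f \<in> l2 m" "g \<in> l2 m"
  then show "from_ell2 (semi t (to_ell2 (\<lambda>x. c * f x + d * g x))) = (\<lambda>x. c * from_ell2 (semi t (to_ell2 f)) x + d * from_ell2 (semi t (to_ell2 g)) x)"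
    by (simp add: to_ell2_lincomb semi_add semi_scale from_ell2_simps[abs_def])
qed (simp_all add: from_ell2_mem_l2 semi_zero from_ell2_to_ell2)

lemma generator_semi:
  "generator m (\<lambda>t f. from_ell2 (semi t (to_ell2 f))) f g \<longleftrightarrow> friedrichs_laplacian b m f (\<lambda>x. - g x)"
proof -
  have neg: "(\<lambda>x. - g x) \<in> l2 m \<longleftrightarrow> g \<in> l2 m" for g
    by (simp add: l2_def)
  have "to_ell2 (\<lambda>x. - g x) = - to_ell2 g" if "g \<in> l2 m" for g
    using that by (intro to_ell2_eqI) (simp add: from_ell2_simps from_ell2_to_ell2)
  then show ?thesis
    using semi_deriv[of "to_ell2 f" "- to_ell2 g"] semi_deriv_imp_A[of "to_ell2 f" "- to_ell2 g"]
    by (auto simp: generator_iff from_ell2_mem_l2 friedrichs_laplacian_iff to_ell2_from_ell2 neg)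
qed

text \<open>The Euler limit has the prescribed generator, so the chosen semigroup exists and has it as well;
  by uniqueness it is the Euler limit.\<close>

theorem heat_semigroup_eq:
  assumes t: "0 \<le> t" and f: "f \<in> l2 m"
  shows "heat_semigroup b m t f = from_ell2 (semi t (to_ell2 f))"
proof -
  let ?Q = "\<lambda>P. C0_semigroup m P \<and> (\<forall>f g. generator m P f g \<longleftrightarrow> friedrichs_laplacian b m f (\<lambda>x. - g x))"
  define P where "P = heat_semigroup b m"
  have "?Q P"
    unfolding P_def heat_semigroup_def
    using C0_semigroup_semi generator_semi
    by (intro someI[of ?Q "\<lambda>t f. from_ell2 (semi t (to_ell2 f))"]) simp
  then have c0: "C0_semigroup m P"
    and gen: "\<And>f g. generator m P f g \<longleftrightarrow> friedrichs_laplacian b m f (\<lambda>x. - g x)" by blast+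
  have P_l2: "P t f \<in> l2 m" if "0 \<le> t" "f \<in> l2 m" for t f
    using c0 that unfolding C0_semigroup_def by blast
  define Q where "Q t F = to_ell2 (P t (from_ell2 F))" for t F
  have from_ell2_lincomb: "from_ell2 (c *\<^sub>R F + d *\<^sub>R G) = (\<lambda>x. c * from_ell2 F x + d * from_ell2 G x)" for c d F G
    by (simp add: fun_eq_iff from_ell2_simps)
  have lin: "Q t (c *\<^sub>R F + d *\<^sub>R G) = c *\<^sub>R Q t F + d *\<^sub>R Q t G" if "0 \<le> t" for t c d F G
  proof -
    have "P t (from_ell2 (c *\<^sub>R F + d *\<^sub>R G)) = (\<lambda>x. c * P t (from_ell2 F) x + d * P t (from_ell2 G) x)"
      using c0 that from_ell2_mem_l2 unfolding C0_semigroup_def from_ell2_lincomb by blast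
    then show ?thesis
      using that by (simp add: Q_def to_ell2_lincomb P_l2 from_ell2_mem_l2)
  qed
  have "Q t (to_ell2 f) = semi t (to_ell2 f)"
  proof (rule semi_unique[OF _ _ _ _ _ _ t])
    show "linear (Q t)" if "0 \<le> t" for t
      using lin[OF that, of 1 _ 1] lin[OF that, of _ _ 0 0] by (intro linearI) simp_all
    show "\<exists>K. \<forall>F. norm (Q t F) \<le> K * norm F" if t0: "0 \<le> t" for t
    proof -
      have "\<forall>t\<ge>0. \<exists>K. \<forall>f\<in>l2 m. l2_norm m (P t f) \<le> K * l2_norm m f"
        using c0 unfolding C0_semigroup_def by (elim conjE)
      then obtain K where "\<forall>f\<in>l2 m. l2_norm m (P t f) \<le> K * l2_norm m f"
        using t0 by blast
      then have "norm (Q t F) \<le> K * norm F" for F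
        using from_ell2_mem_l2[of F] t0 norm_to_ell2[OF from_ell2_mem_l2[of F]]
        by (simp add: Q_def norm_to_ell2 P_l2 to_ell2_from_ell2)
      then show ?thesis by blast
    qed
    show "Q 0 F = F" for F
      using c0 from_ell2_mem_l2[of F] by (simp add: C0_semigroup_def Q_def to_ell2_from_ell2)
    show "Q (s + t) F = Q s (Q t F)" if "0 \<le> s" "0 \<le> t" for s t F
      using c0 that from_ell2_mem_l2[of F] by (simp add: C0_semigroup_def Q_def from_ell2_to_ell2)
    show "((\<lambda>t. Q t F) \<longlongrightarrow> F) (at_right 0)" for F
    proof -
      have lim: "((\<lambda>t. l2_norm m (\<lambda>x. P t (from_ell2 F) x - from_ell2 F x)) \<longlongrightarrow> 0) (at_right 0)"
        using c0 from_ell2_mem_l2[of F] by (simp add: C0_semigroup_def)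
      have eq: "l2_norm m (\<lambda>x. P t (from_ell2 F) x - from_ell2 F x) = norm (Q t F - F)" if "0 < t" for t
        using norm_to_ell2[OF l2_diff[OF P_l2 from_ell2_mem_l2], of t "from_ell2 F" F] that
        by (simp add: to_ell2_diff P_l2 from_ell2_mem_l2 to_ell2_from_ell2 Q_def)
      have "eventually (\<lambda>t. l2_norm m (\<lambda>x. P t (from_ell2 F) x - from_ell2 F x) = norm (Q t F - F)) (at_right 0)"
        using eventually_at_right_less[of "0 :: real"] by (rule eventually_mono) (rule eq)
      with lim have "((\<lambda>t. norm (Q t F - F)) \<longlongrightarrow> 0) (at_right 0)"
        by (rule Lim_transform_eventually)
      then show ?thesis
        by (simp add: tendsto_norm_zero_iff LIM_zero_iff)
    qed
    show "((\<lambda>t. (Q t U - U) /\<^sub>R t) \<longlongrightarrow> - W) (at_right 0) \<longleftrightarrow> (U, W) \<in> friedrichs" for U W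
    proof -
      have "generator m P (from_ell2 U) (from_ell2 (- W)) \<longleftrightarrow> ((\<lambda>t. (Q t U - U) /\<^sub>R t) \<longlongrightarrow> - W) (at_right 0)"
        by (simp add: generator_iff P_l2 from_ell2_mem_l2 to_ell2_from_ell2 Q_def)
      moreover have "(\<lambda>x. - from_ell2 (- W) x) = from_ell2 W"
        by (simp add: fun_eq_iff from_ell2_simps)
      ultimately show ?thesis
        unfolding gen by (simp add: friedrichs_laplacian_iff from_ell2_mem_l2 to_ell2_from_ell2)
    qed
  qed
  then show ?thesis
    using from_ell2_to_ell2[OF P_l2[OF t f]] by (simp add: Q_def from_ell2_to_ell2[OF f] flip: P_def)
qed

end

lemma (in accretive_operator) semi_mem_closed:
  assumes t: "0 < t" and K: "closed K" and ev: "eventually (\<lambda>k. euler t k u \<in> K) sequentially"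
  shows "semi t u \<in> K"
  using Lim_in_closed_set[OF K ev _ euler_tendsto[OF t]] by simp

section \<open>Comparison principles\<close>

context graph
begin

text \<open>The maximum principle for the resolvent. Replacing \<open>\<phi>\<close> by \<open>\<psi> = min \<phi> v\<close>
  does not increase the functional: the change is controlled by
  \<open>\<langle>\<psi> - g, z\<rangle> + h E(\<psi>, z)\<close> with \<open>z = \<phi> - \<psi> \<ge> 0\<close>, where
  \<open>E(\<psi>, z) \<ge> E(v, z)\<close> because \<open>\<psi> - v\<close> and \<open>z\<close> have disjoint supports and opposite
  signs, and Green's formula turns the lower bound into the integral of
  \<open>v + h \<Delta>v - g \<ge> 0\<close> against \<open>z\<close>.\<close>

lemma res_le:
  assumes h: "0 < h" and g: "g \<in> l2 m" and v: "\<And>x. 0 \<le> v x" and super: "\<And>x. g x \<le> v x + h * lap v x"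
  shows "from_ell2 (res h (to_ell2 g)) x \<le> v x"
proof -
  have "res h (to_ell2 g) \<in> {F. \<forall>x. from_ell2 F x \<le> v x}"
  proof (rule res_mem_closed[OF h closed_from_ell2_le])
    fix \<Phi>
    assume "\<Phi> \<in> core"
    then obtain \<phi> where \<phi>: "\<phi> \<in> Cc" and \<Phi>: "\<Phi> = to_ell2 \<phi>"
      by (auto simp: core_def)
    define \<psi> where "\<psi> x = min (\<phi> x) (v x)" for x
    define z where "z x = \<phi> x - \<psi> x" for x
    have \<psi>: "\<psi> \<in> Cc"
      using v by (intro Cc_subset[OF \<phi>]) (simp add: \<psi>_def min_def)
    have z: "z \<in> Cc"
      using v by (intro Cc_subset[OF \<phi>]) (simp add: z_def \<psi>_def min_def)
    note l2 = Cc_l2[OF \<psi>] Cc_l2[OF z]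
    have core: "to_ell2 \<psi> \<in> core" "to_ell2 z \<in> core"
      using \<psi> z by (auto simp: core_def)
    have \<Phi>_eq: "to_ell2 \<phi> = to_ell2 \<psi> + to_ell2 z"
      using to_ell2_lincomb[OF l2, of 1 1] by (simp add: z_def)
    have "0 \<le> energy b (\<lambda>x. \<psi> x - v x) z"
    proof (rule energy_nonneg)
      fix x y
      have neg: "\<psi> x - v x \<le> 0" "0 \<le> z x" "(\<psi> x - v x) * z x = 0" for x
        by (auto simp: \<psi>_def z_def min_def)
      have "(\<psi> x - v x - (\<psi> y - v y)) * (z x - z y)
          = (\<psi> x - v x) * z x - (\<psi> x - v x) * z y - (\<psi> y - v y) * z x + (\<psi> y - v y) * z y"
        by (simp add: algebra_simps)
      also have "\<dots> = - ((\<psi> x - v x) * z y) - (\<psi> y - v y) * z x"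
        by (simp add: neg(3) del: mult_eq_0_iff)
      finally have "(\<psi> x - v x - (\<psi> y - v y)) * (z x - z y) = - ((\<psi> x - v x) * z y) - (\<psi> y - v y) * z x" .
      moreover have "(\<psi> x - v x) * z y \<le> 0" "(\<psi> y - v y) * z x \<le> 0"
        by (intro mult_nonpos_nonneg neg)+
      ultimately show "0 \<le> (\<psi> x - v x - (\<psi> y - v y)) * (z x - z y)"
        by simp
    qed
    define S where "S = {x. z x \<noteq> 0}"
    have S: "finite S" "\<And>x. x \<notin> S \<Longrightarrow> z x = 0"
      using z by (auto simp: S_def Cc_def)
    have "energy b \<psi> z = energy b (\<lambda>x. \<psi> x - v x) z + energy b v z"
      by (simp add: energy_eq_l2_inner_lap[OF z] l2_inner_Cc[OF S] lap_diff left_diff_distrib sum_subtractf)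
    then have "(\<Sum>x\<in>S. lap v x * z x * m x) \<le> energy b \<psi> z"
      using \<open>0 \<le> energy b (\<lambda>x. \<psi> x - v x) z\<close>
      by (simp add: energy_eq_l2_inner_lap[OF z, of v] l2_inner_Cc[OF S])
    then have "(\<Sum>x\<in>S. (\<psi> x - g x) * z x * m x) + h * (\<Sum>x\<in>S. lap v x * z x * m x)
        \<le> inner (to_ell2 \<psi> - to_ell2 g) (to_ell2 z) + h * E (to_ell2 \<psi>) (to_ell2 z)"
      using h inner_to_ell2[OF l2_diff[OF l2(1) g] l2(2)]
      by (simp add: E_to_ell2[OF \<psi> z] l2_inner_Cc[OF S] to_ell2_diff[OF l2(1) g])
    moreover have "0 \<le> (\<Sum>x\<in>S. (\<psi> x - g x) * z x * m x) + h * (\<Sum>x\<in>S. lap v x * z x * m x)"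
      unfolding sum_distrib_left sum.distrib[symmetric]
    proof (rule sum_nonneg)
      fix x
      assume "x \<in> S"
      then have "z x > 0" "\<psi> x = v x"
        by (auto simp: S_def z_def \<psi>_def min_def split: if_splits)
      then have "0 \<le> (v x + h * lap v x - g x) * z x * m x"
        using super[of x] m_pos[of x] by simp
      then show "0 \<le> (\<psi> x - g x) * z x * m x + h * (lap v x * z x * m x)"
        using \<open>\<psi> x = v x\<close> by (simp add: algebra_simps)
    qed
    ultimately have *: "0 \<le> inner (to_ell2 \<psi> - to_ell2 g) (to_ell2 z) + h * E (to_ell2 \<psi>) (to_ell2 z)"
      by linarith
    have "to_ell2 \<phi> - to_ell2 g = (to_ell2 \<psi> - to_ell2 g) + to_ell2 z"
      by (simp add: \<Phi>_eq)
    then have "(norm (to_ell2 \<phi> - to_ell2 g))\<^sup>2 = (norm (to_ell2 \<psi> - to_ell2 g))\<^sup>2 + 2 * inner (to_ell2 \<psi> - to_ell2 g) (to_ell2 z) + (norm (to_ell2 z))\<^sup>2"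
      by (simp only: power2_norm_eq_inner inner_add inner_commute[of "to_ell2 z" "to_ell2 \<psi> - to_ell2 g"])
    moreover have "E (to_ell2 \<phi>) (to_ell2 \<phi>) = E (to_ell2 \<psi>) (to_ell2 \<psi>) + 2 * E (to_ell2 \<psi>) (to_ell2 z) + E (to_ell2 z) (to_ell2 z)"
      unfolding \<Phi>_eq using core E_commute[OF core] by (simp add: E_left E_right C_add)
    ultimately have "energy_fun h (to_ell2 g) (to_ell2 \<phi>) = energy_fun h (to_ell2 g) (to_ell2 \<psi>)
        + 2 * (inner (to_ell2 \<psi> - to_ell2 g) (to_ell2 z) + h * E (to_ell2 \<psi>) (to_ell2 z)) + ((norm (to_ell2 z))\<^sup>2 + h * E (to_ell2 z) (to_ell2 z))"
      by (simp add: energy_fun_def algebra_simps)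
    moreover have "0 \<le> h * E (to_ell2 z) (to_ell2 z)"
      using h E_nonneg[OF core(2)] by simp
    moreover have "Y \<le> X" if "X = Y + 2 * p + (n + q)" "0 \<le> q" "0 \<le> p" "0 \<le> n" for X Y p q n :: real
      using that by linarith
    ultimately have "energy_fun h (to_ell2 g) (to_ell2 \<psi>) \<le> energy_fun h (to_ell2 g) \<Phi>"
      unfolding \<Phi> using * zero_le_power2 by blast
    moreover have "\<forall>x. from_ell2 (to_ell2 \<psi>) x \<le> v x"
      by (simp add: from_ell2_to_ell2 l2) (simp add: \<psi>_def)
    ultimately show "\<exists>\<Psi>\<in>core. \<Psi> \<in> {F. \<forall>x. from_ell2 F x \<le> v x} \<and> energy_fun h (to_ell2 g) \<Psi> \<le> energy_fun h (to_ell2 g) \<Phi>"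
      using core(1) by blast
  qed
  then show ?thesis by simp
qed

lemma res_from_ell2_le:
  assumes "0 < h" and "\<And>x. 0 \<le> v x" and "\<And>x. from_ell2 G x \<le> v x + h * lap v x"
  shows "from_ell2 (res h G) x \<le> v x"
  using res_le[OF assms(1) from_ell2_mem_l2[of G] assms(2,3)] by (simp add: to_ell2_from_ell2)

lemma semi_from_ell2_le:
  assumes t: "0 \<le> t" and w: "\<And>x. 0 \<le> w x"
    and res: "\<And>h F. 0 < h \<Longrightarrow> (\<And>x. from_ell2 F x \<le> w x) \<Longrightarrow> (\<And>x. from_ell2 (res h F) x \<le> w x)"
    and G: "\<And>x. from_ell2 G x \<le> w x"
  shows "from_ell2 (semi t G) x \<le> w x"
proof (cases "t = 0")
  case False
  then have t: "0 < t" using t by simp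
  have "from_ell2 ((res h ^^ n) G) x \<le> w x" if "0 < h" for h n x
    by (induction n arbitrary: x) (simp_all add: G res[OF that])
  then have "semi t G \<in> {F. \<forall>x. from_ell2 F x \<le> w x}"
    by (intro semi_mem_closed t closed_from_ell2_le always_eventually) (simp add: euler_def t)
  then show ?thesis by simp
qed (simp add: semi_zero G)

lemma lap_const: "lap (\<lambda>_. c) x = 0"
  by (simp add: lap_def)

lemma semi_le_one:
  "0 \<le> t \<Longrightarrow> (\<And>x. from_ell2 G x \<le> 1) \<Longrightarrow> from_ell2 (semi t G) x \<le> 1"
  by (rule semi_from_ell2_le[where w = "\<lambda>_. 1"]) (auto intro: res_from_ell2_le[where v = "\<lambda>_. 1"] simp: lap_const)

lemma semi_nonneg:
  assumes "0 \<le> t" "\<And>x. 0 \<le> from_ell2 G x"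
  shows "0 \<le> from_ell2 (semi t G) x"
proof -
  have "from_ell2 (semi t (- G)) x \<le> 0"
    by (rule semi_from_ell2_le[where w = "\<lambda>_. 0"])
      (use assms in \<open>auto intro: res_from_ell2_le[where v = "\<lambda>_. 0"] simp: lap_const from_ell2_simps\<close>)
  moreover have "semi t (- G) = - semi t G"
    using semi_scale[of t "-1" G] by simp
  ultimately show ?thesis
    by (simp add: from_ell2_simps)
qed

text \<open>Where \<open>c f \<ge> 1\<close>, in particular on \<open>K\<close>, the truncation \<open>v = min (d f) 1\<close> with \<open>d \<ge> c\<close>
  attains its maximum \<open>1\<close>, so its Laplacian is nonnegative there. Elsewhere \<open>f\<close> is a
  supersolution, and enlarging \<open>c\<close> to \<open>d = c (1 + 2 \<alpha> h)\<close> absorbs the loss \<open>\<alpha> f\<close>. The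
  minimum therefore is a supersolution everywhere.\<close>

lemma res_le_min:
  assumes h: "0 < h" "h * \<alpha> \<le> 1/2" and \<alpha>: "0 < \<alpha>" and c: "0 < c" and f: "\<And>x. 0 < f x"
    and K: "\<And>x. x \<in> K \<Longrightarrow> 1 \<le> c * f x" and super: "\<And>x. x \<notin> K \<Longrightarrow> - \<alpha> * f x \<le> lap f x"
    and G: "\<And>x. from_ell2 G x \<le> min (c * f x) 1"
  shows "from_ell2 (res h G) x \<le> min (c * (1 + 2 * \<alpha> * h) * f x) 1"
proof (rule res_from_ell2_le[OF h(1)])
  define d where "d = c * (1 + 2 * \<alpha> * h)"
  have d: "0 < d" "c \<le> d"
    using c \<alpha> h by (auto simp: d_def intro!: mult_pos_pos add_pos_pos)
  \<comment> \<open>\<open>(1 + 2 a) (1 - a) \<ge> 1\<close> for \<open>0 \<le> a \<le> 1/2\<close>, with \<open>a = \<alpha> h\<close>.\<close>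
  have cd: "c \<le> d * (1 - \<alpha> * h)"
  proof -
    have "0 \<le> \<alpha> * h * (1 - 2 * (h * \<alpha>))"
      using \<alpha> h by (intro mult_nonneg_nonneg) auto
    then have "1 \<le> (1 + 2 * \<alpha> * h) * (1 - \<alpha> * h)"
      by (simp add: algebra_simps)
    from mult_left_mono[OF this, of c] show ?thesis
      using c by (simp add: d_def mult.assoc)
  qed
  let ?v = "\<lambda>x. min (c * (1 + 2 * \<alpha> * h) * f x) 1"
  show "0 \<le> ?v x" for x
    using d(1) f[of x] by (simp add: d_def less_imp_le)
  show "from_ell2 G x \<le> ?v x + h * lap ?v x" for x
  proof (cases "1 \<le> d * f x")
    case True
    have "0 \<le> lap ?v x"
      unfolding lap_def using True m_pos[of x] b_nonneg
      by (intro divide_nonneg_pos sum_nonneg mult_nonneg_nonneg) (auto simp: d_def)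
    then have "0 \<le> h * lap ?v x"
      using h(1) by simp
    then show ?thesis
      using True G[of x] by (simp add: d_def)
  next
    case False
    have "x \<notin> K"
    proof
      assume "x \<in> K"
      then have "1 \<le> c * f x" by (rule K)
      also have "\<dots> \<le> d * f x"
        using d(2) f[of x] by (intro mult_right_mono) auto
      finally show False using False by simp
    qed
    have vx: "?v x = d * f x"
      using False by (simp add: d_def)
    have "d * lap f x = (\<Sum>y | 0 < b x y. b x y * (d * f x - d * f y)) / m x"
      by (simp add: lap_def sum_distrib_left algebra_simps)
    also have "\<dots> \<le> lap ?v x"
      unfolding lap_def vx using m_pos[of x] b_nonneg
      by (intro divide_right_mono sum_mono mult_left_mono) (auto simp: d_def)
    finally have "d * (- \<alpha> * f x) \<le> lap ?v x"
      using mult_left_mono[OF super[OF \<open>x \<notin> K\<close>], of d] d(1) by linarith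
    from mult_left_mono[OF this, of h] have "- (d * \<alpha> * h * f x) \<le> h * lap ?v x"
      using h(1) by (simp add: algebra_simps)
    moreover have "c * f x \<le> d * (1 - \<alpha> * h) * f x"
      using f[of x] by (intro mult_right_mono cd) simp
    ultimately show ?thesis
      using G[of x] unfolding vx by (simp add: algebra_simps)
  qed
qed

text \<open>Each Euler step of small size \<open>h\<close> multiplies the constant in the bound by
  \<open>1 + 2 \<alpha> h\<close>, which stays below \<open>exp (2 \<alpha> t)\<close> in total.\<close>

lemma semi_le_supersolution:
  assumes t: "0 \<le> t" and \<alpha>: "0 < \<alpha>" and c: "0 < c" and f: "\<And>x. 0 < f x"
    and K: "\<And>x. x \<in> K \<Longrightarrow> 1 \<le> c * f x" and super: "\<And>x. x \<notin> K \<Longrightarrow> - \<alpha> * f x \<le> lap f x"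
    and G: "\<And>x. from_ell2 G x \<le> min (c * f x) 1"
  shows "from_ell2 (semi t G) x \<le> c * exp (2 * \<alpha> * t) * f x"
proof (cases "t = 0")
  case True
  then show ?thesis using G[of x] by (simp add: semi_zero)
next
  case False
  then have t: "0 < t" using t by simp
  have pow: "from_ell2 ((res h ^^ n) G) x \<le> min (c * (1 + 2 * \<alpha> * h) ^ n * f x) 1"
    if h: "0 < h" "h * \<alpha> \<le> 1/2" for h n x
  proof (induction n arbitrary: x)
    case 0
    then show ?case using G by simp
  next
    case (Suc n)
    let ?c = "c * (1 + 2 * \<alpha> * h) ^ n"
    have one: "1 \<le> (1 + 2 * \<alpha> * h) ^ n"
      using \<alpha> h by (intro one_le_power) simp
    have "from_ell2 (res h ((res h ^^ n) G)) x \<le> min (?c * (1 + 2 * \<alpha> * h) * f x) 1"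
    proof (rule res_le_min[OF h \<alpha> _ f _ super Suc])
      show "0 < ?c"
        using c one by simp
      show "1 \<le> ?c * f x" if "x \<in> K" for x
      proof -
        have "c * f x \<le> c * f x * (1 + 2 * \<alpha> * h) ^ n"
          using c f[of x] one by (simp add: less_imp_le)
        then show ?thesis
          using K[OF that] by (simp add: mult_ac)
      qed
    qed
    then show ?case
      by (simp add: mult_ac)
  qed
  have "semi t G \<in> {F. \<forall>x. from_ell2 F x \<le> c * exp (2 * \<alpha> * t) * f x}"
  proof (rule semi_mem_closed[OF t closed_from_ell2_le])
    have "(\<lambda>k. t * \<alpha> * (1/2) ^ k) \<longlonglongrightarrow> 0"
      by (intro tendsto_mult_right_zero LIMSEQ_power_zero) simp
    then have "eventually (\<lambda>k. t * \<alpha> * (1/2) ^ k < 1/2) sequentially"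
      by (rule order_tendstoD) simp
    then show "eventually (\<lambda>k. euler t k G \<in> {F. \<forall>x. from_ell2 F x \<le> c * exp (2 * \<alpha> * t) * f x}) sequentially"
    proof eventually_elim
      case (elim k)
      show ?case
      proof (intro CollectI allI)
        fix x
        have "from_ell2 (euler t k G) x \<le> c * (1 + 2 * \<alpha> * (t / 2 ^ k)) ^ (2 ^ k) * f x"
          using pow[of "t / 2 ^ k" "2 ^ k" x] t elim by (simp add: euler_def power_one_over field_simps)
        also have "(1 + 2 * \<alpha> * (t / 2 ^ k)) ^ (2 ^ k) \<le> exp (2 * \<alpha> * t)"
          using exp_ge_one_plus_x_over_n_power_n[of "2 ^ k" "2 * \<alpha> * t"] \<alpha> t
          by (simp add: order_trans[OF _ mult_nonneg_nonneg])
        finally show "from_ell2 (euler t k G) x \<le> c * exp (2 * \<alpha> * t) * f x"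
          using c f[of x] by (simp add: mult_left_mono mult_right_mono less_imp_le)
      qed
    qed
  qed
  then show ?thesis by simp
qed

end

section \<open>The Feller property\<close>

text \<open>Membership in \<open>C0\<close> in a form that is visibly stable under sums and uniform limits.\<close>

lemma C0_iff: "f \<in> C0 \<longleftrightarrow> (\<forall>\<epsilon>>0. finite {x. \<epsilon> < \<bar>f x\<bar>})"
proof
  assume f: "f \<in> C0"
  show "\<forall>\<epsilon>>0. finite {x. \<epsilon> < \<bar>f x\<bar>}"
  proof (intro allI impI)
    fix \<epsilon> :: real
    assume "0 < \<epsilon>"
    then obtain \<phi> where \<phi>: "\<phi> \<in> Cc" and le: "\<And>x. \<bar>f x - \<phi> x\<bar> \<le> \<epsilon>"
      using f by (auto simp: C0_def)
    have "{x. \<epsilon> < \<bar>f x\<bar>} \<subseteq> {x. \<phi> x \<noteq> 0}"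
    proof clarify
      fix x
      assume "\<epsilon> < \<bar>f x\<bar>" "\<phi> x = 0"
      then show False using le[of x] by simp
    qed
    then show "finite {x. \<epsilon> < \<bar>f x\<bar>}"
      using \<phi> finite_subset by (auto simp: Cc_def)
  qed
next
  assume f: "\<forall>\<epsilon>>0. finite {x. \<epsilon> < \<bar>f x\<bar>}"
  show "f \<in> C0"
    unfolding C0_def mem_Collect_eq
  proof (intro allI impI)
    fix \<epsilon> :: real
    assume e: "0 < \<epsilon>"
    have "{x. (if \<epsilon> < \<bar>f x\<bar> then f x else 0) \<noteq> 0} \<subseteq> {x. \<epsilon> < \<bar>f x\<bar>}"
      by auto
    then have "(\<lambda>x. if \<epsilon> < \<bar>f x\<bar> then f x else 0) \<in> Cc"
      using f e finite_subset unfolding Cc_def by blast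
    then show "\<exists>\<phi>\<in>Cc. \<forall>x. \<bar>f x - \<phi> x\<bar> \<le> \<epsilon>"
      by (rule bexI[rotated]) (use e in auto)
  qed
qed

lemma C0_sum:
  assumes "finite S" "\<And>y. y \<in> S \<Longrightarrow> q y \<in> C0"
  shows "(\<lambda>x. \<Sum>y\<in>S. q y x * c y) \<in> C0"
  using assms
proof (induction S rule: finite_induct)
  case empty
  then show ?case by (simp add: C0_iff)
next
  case (insert a S)
  let ?s = "\<lambda>x. \<Sum>y\<in>S. q y x * c y"
  have s: "?s \<in> C0" and a: "q a \<in> C0"
    using insert by auto
  show ?case
    unfolding C0_iff
  proof (intro allI impI)
    fix \<epsilon> :: real
    assume e: "0 < \<epsilon>"
    have d: "0 < \<epsilon> / (2 * (\<bar>c a\<bar> + 1))"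
      using e by simp
    have "{x. \<epsilon> < \<bar>\<Sum>y\<in>insert a S. q y x * c y\<bar>}
        \<subseteq> {x. \<epsilon>/2 < \<bar>?s x\<bar>} \<union> {x. \<epsilon> / (2 * (\<bar>c a\<bar> + 1)) < \<bar>q a x\<bar>}"
    proof (intro subsetI, rule ccontr)
      fix x
      assume x: "x \<in> {x. \<epsilon> < \<bar>\<Sum>y\<in>insert a S. q y x * c y\<bar>}"
        and "x \<notin> {x. \<epsilon>/2 < \<bar>?s x\<bar>} \<union> {x. \<epsilon> / (2 * (\<bar>c a\<bar> + 1)) < \<bar>q a x\<bar>}"
      then have 1: "\<bar>?s x\<bar> \<le> \<epsilon>/2" and 2: "\<bar>q a x\<bar> \<le> \<epsilon> / (2 * (\<bar>c a\<bar> + 1))"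
        by auto
      have "\<bar>q a x * c a\<bar> \<le> \<bar>q a x\<bar> * (\<bar>c a\<bar> + 1)"
        by (simp add: abs_mult mult_left_mono)
      also have "\<dots> \<le> \<epsilon> / (2 * (\<bar>c a\<bar> + 1)) * (\<bar>c a\<bar> + 1)"
        by (rule mult_right_mono[OF 2]) simp
      also have "\<dots> = \<epsilon>/2"
      proof -
        have "\<epsilon> / (2 * k) * k = \<epsilon>/2" if "0 < k" for k :: real
          using that by simp
        then show ?thesis using abs_add_one_gt_zero[of "c a"] by (simp only: add.commute)
      qed
      finally have "\<bar>q a x * c a + ?s x\<bar> \<le> \<epsilon>"
        using 1 by linarith
      then show False
        using x insert.hyps by simp
    qed
    moreover have "finite {x. \<epsilon>/2 < \<bar>?s x\<bar>}" "finite {x. \<epsilon> / (2 * (\<bar>c a\<bar> + 1)) < \<bar>q a x\<bar>}"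
      using s[unfolded C0_iff, rule_format, OF half_gt_zero[OF e]] a[unfolded C0_iff, rule_format, OF d]
      by blast+
    ultimately show "finite {x. \<epsilon> < \<bar>\<Sum>y\<in>insert a S. q y x * c y\<bar>}"
      by (meson finite_UnI finite_subset)
  qed
qed

context graph
begin

text \<open>The kernel is nonnegative with row sums at most one, so the action is a sup norm contraction
  and finitely supported functions suffice; for those the action is a finite combination of
  columns of the kernel.\<close>

lemma heat_action_C0:
  assumes t: "0 \<le> t" and column: "\<And>y. heat_semigroup b m t (indicator {y}) \<in> C0" and g: "g \<in> C0"
  shows "heat_action b m t g \<in> C0"
proof -
  define q where "q y = heat_semigroup b m t (indicator {y})" for y
  have ind_Cc: "indicator S \<in> Cc" if "finite S" for S :: "'a set"
    using that by (simp add: Cc_def indicator_def)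
  have q_eq: "q y = from_ell2 (semi t (to_ell2 (indicator {y})))" for y
    using heat_semigroup_eq[OF t Cc_l2[OF ind_Cc]] by (simp add: q_def)
  have q_nonneg: "0 \<le> q y x" for x y
    unfolding q_eq by (rule semi_nonneg[OF t]) (simp add: from_ell2_to_ell2 Cc_l2 ind_Cc)
  have q_sum: "(\<Sum>y\<in>S. q y x) \<le> 1" if S: "finite S" for S x
  proof -
    have "from_ell2 (semi t (to_ell2 (indicator S))) = (\<lambda>x. \<Sum>y\<in>S. q y x)"
      using S
    proof (induction S rule: finite_induct)
      case empty
      have "to_ell2 (indicator {}) = 0"
        by (rule to_ell2_eqI) (simp add: from_ell2_simps)
      then show ?case
        using semi_scale[of t 0 0] by (simp only: fun_eq_iff sum.empty scaleR_zero_left from_ell2_simps simp_thms)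
    next
      case (insert a S)
      have "to_ell2 (indicator (insert a S)) = to_ell2 (indicator {a}) + to_ell2 (indicator S)"
        using insert.hyps
        by (intro to_ell2_eqI) (auto simp: from_ell2_simps from_ell2_to_ell2 Cc_l2 ind_Cc indicator_def)
      then show ?case
        using insert by (simp add: fun_eq_iff semi_add from_ell2_simps q_eq)
    qed
    moreover have "from_ell2 (semi t (to_ell2 (indicator S))) x \<le> 1"
      by (rule semi_le_one[OF t]) (simp add: from_ell2_to_ell2 Cc_l2 ind_Cc S indicator_def)
    ultimately show ?thesis by simp
  qed
  have q_summable: "(\<lambda>y. q y x) summable_on UNIV" for x
    by (rule nonneg_bdd_above_summable_on) (use q_nonneg q_sum in \<open>auto intro!: bdd_aboveI2\<close>)
  have q_infsum: "(\<Sum>\<^sub>\<infinity>y. q y x) \<le> 1" for x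
    by (rule infsum_le_finite_sums[OF q_summable]) (rule q_sum)
  have action: "heat_action b m t g x = (\<Sum>\<^sub>\<infinity>y. q y x * g y)" for g x
    using m_pos[THEN less_imp_neq] by (simp add: heat_action_def heat_kernel_def q_def)
  show ?thesis
    unfolding C0_iff
  proof (intro allI impI)
    fix \<epsilon> :: real
    assume e: "0 < \<epsilon>"
    then obtain \<phi> where \<phi>: "\<phi> \<in> Cc" and le: "\<And>x. \<bar>g x - \<phi> x\<bar> \<le> \<epsilon>/2"
      using g unfolding C0_def by (auto dest: spec[of _ "\<epsilon>/2"])
    define S where "S = {y. \<phi> y \<noteq> 0}"
    have S: "finite S"
      using \<phi> by (simp add: S_def Cc_def)
    let ?s = "\<lambda>x. \<Sum>y\<in>S. q y x * \<phi> y"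
    have main: "\<bar>heat_action b m t g x\<bar> \<le> \<bar>?s x\<bar> + \<epsilon>/2" for x
    proof -
      have bound: "norm (q y x * (g y - \<phi> y)) \<le> \<epsilon>/2 * q y x" for y
        using mult_left_mono[OF le[of y] q_nonneg[of y x]] q_nonneg[of y x] by (simp add: abs_mult mult.commute)
      have sm: "(\<lambda>y. \<epsilon>/2 * q y x) summable_on UNIV"
        by (intro summable_on_cmult_right q_summable)
      have ab: "(\<lambda>y. norm (q y x * (g y - \<phi> y))) summable_on UNIV"
        by (rule summable_on_comparison_test[OF sm bound]) simp
      then have d: "(\<lambda>y. q y x * (g y - \<phi> y)) summable_on UNIV"
        by (rule abs_summable_summable)
      have "\<bar>\<Sum>\<^sub>\<infinity>y. q y x * (g y - \<phi> y)\<bar> \<le> (\<Sum>\<^sub>\<infinity>y. norm (q y x * (g y - \<phi> y)))"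
        using norm_infsum_bound[OF ab] by simp
      also have "\<dots> \<le> (\<Sum>\<^sub>\<infinity>y. \<epsilon>/2 * q y x)"
        by (rule infsum_mono[OF ab sm bound])
      also have "\<dots> \<le> \<epsilon>/2"
        using mult_left_mono[OF q_infsum[of x], of "\<epsilon>/2"] e by (simp only: infsum_cmult_right') simp
      finally have 1: "\<bar>\<Sum>\<^sub>\<infinity>y. q y x * (g y - \<phi> y)\<bar> \<le> \<epsilon>/2" .
      have 2: "(\<Sum>\<^sub>\<infinity>y. q y x * \<phi> y) = (\<Sum>\<^sub>\<infinity>y\<in>S. q y x * \<phi> y)"
        by (rule infsum_cong_neutral) (auto simp: S_def)
      have 3: "(\<lambda>y. q y x * \<phi> y) summable_on UNIV"
        by (rule finite_nonzero_values_imp_summable_on) (rule finite_subset[OF _ S], auto simp: S_def)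
      have "heat_action b m t g x = (\<Sum>\<^sub>\<infinity>y. q y x * (g y - \<phi> y) + q y x * \<phi> y)"
        by (simp add: action right_diff_distrib)
      also have "\<dots> = (\<Sum>\<^sub>\<infinity>y. q y x * (g y - \<phi> y)) + ?s x"
        using S by (subst infsum_add[OF d 3]) (simp add: 2)
      finally show ?thesis
        using 1 by linarith
    qed
    have "{x. \<epsilon> < \<bar>heat_action b m t g x\<bar>} \<subseteq> {x. \<epsilon>/2 < \<bar>?s x\<bar>}"
    proof clarify
      fix x
      assume "\<epsilon> < \<bar>heat_action b m t g x\<bar>"
      then show "\<epsilon>/2 < \<bar>?s x\<bar>" using main[of x] by linarith
    qed
    moreover have "?s \<in> C0"
      by (rule C0_sum[OF S]) (use column in \<open>simp add: q_def\<close>)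
    ultimately show "finite {x. \<epsilon> < \<bar>heat_action b m t g x\<bar>}"
      using e finite_subset unfolding C0_iff by (meson half_gt_zero)
  qed
qed

text \<open>A column of the heat kernel is dominated by a multiple of \<open>f\<close>, which vanishes at
  infinity. The constant \<open>c\<close> makes \<open>c f \<ge> 1\<close> on \<open>K\<close> and at the starting
  point \<open>y\<close>.\<close>

theorem feller_if_supersolution:
  assumes f: "\<And>x. 0 < f x" and f0: "f \<in> C0" and K: "finite K" and \<alpha>: "0 < \<alpha>"
    and super: "\<And>x. x \<notin> K \<Longrightarrow> - \<alpha> * f x \<le> lap f x"
  shows "feller b m"
  unfolding feller_def
proof (intro allI impI ballI heat_action_C0)
  fix t :: real and y
  assume t: "0 \<le> t"
  have "\<exists>c>0. \<forall>x\<in>insert y K. 1 \<le> c * f x"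
  proof (intro exI conjI ballI)
    let ?c = "\<Sum>x\<in>insert y K. 1 / f x"
    show "0 < ?c"
      using K f by (intro sum_pos) auto
    fix x
    assume "x \<in> insert y K"
    then have "1 / f x \<le> ?c"
      using K f by (intro member_le_sum) (auto simp: less_imp_le)
    then show "1 \<le> ?c * f x"
      using f[of x] by (simp add: pos_divide_le_eq)
  qed
  then obtain c where c: "0 < c" "\<And>x. x \<in> insert y K \<Longrightarrow> 1 \<le> c * f x" by blast
  define u where "u = heat_semigroup b m t (indicator {y})"
  have ind: "indicator {y} \<in> l2 m"
    by (intro Cc_l2) (simp add: Cc_def indicator_def)
  have u: "u = from_ell2 (semi t (to_ell2 (indicator {y})))"
    using heat_semigroup_eq[OF t ind] by (simp add: u_def)
  have nonneg: "0 \<le> u x" for x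
    unfolding u by (rule semi_nonneg[OF t]) (simp add: from_ell2_to_ell2 ind)
  have le: "u x \<le> c * exp (2 * \<alpha> * t) * f x" for x
    unfolding u
  proof (rule semi_le_supersolution[OF t \<alpha> c(1) f _ super])
    show "from_ell2 (to_ell2 (indicator {y})) x \<le> min (c * f x) 1" for x
      using c f[of x] by (auto simp: from_ell2_to_ell2 ind indicator_def less_imp_le)
  qed (use c in auto)
  define d where "d = c * exp (2 * \<alpha> * t)"
  have d: "0 < d" using c by (simp add: d_def)
  show "u \<in> C0"
    unfolding C0_iff
  proof (intro allI impI)
    fix \<epsilon> :: real
    assume e: "0 < \<epsilon>"
    have "{x. \<epsilon> < \<bar>u x\<bar>} \<subseteq> {x. \<epsilon> / d < \<bar>f x\<bar>}"
    proof clarify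
      fix x
      assume "\<epsilon> < \<bar>u x\<bar>"
      also have "\<bar>u x\<bar> \<le> d * f x"
        using le[of x] nonneg[of x] by (simp add: d_def)
      finally show "\<epsilon> / d < \<bar>f x\<bar>"
        using d f[of x] by (simp add: pos_divide_less_eq mult.commute)
    qed
    moreover have "finite \<dots>"
      using f0 d e by (simp add: C0_iff)
    ultimately show "finite {x. \<epsilon> < \<bar>u x\<bar>}"
      by (rule finite_subset)
  qed
qed

end

section \<open>Distances and curvatures\<close>

locale connected_graph = graph +
  fixes x0 :: 'a
  assumes connected: "graph_connected b"
begin

abbreviation dist0 :: "'a \<Rightarrow> nat" where "dist0 x \<equiv> graph_dist b x x0"

lemma path_dist0: "(x, x0) \<in> adj b ^^ dist0 x"
proof -
  have "(x, x0) \<in> (adj b)\<^sup>*"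
    using connected by (simp add: graph_connected_def)
  then obtain n where "(x, x0) \<in> adj b ^^ n"
    using rtrancl_imp_relpow by blast
  then show ?thesis
    unfolding graph_dist_def by (rule LeastI)
qed

lemma dist0_le: "(x, x0) \<in> adj b ^^ n \<Longrightarrow> dist0 x \<le> n"
  unfolding graph_dist_def by (rule Least_le)

lemma dist0_adj: "0 < b x y \<Longrightarrow> dist0 x \<le> Suc (dist0 y)"
  by (rule dist0_le, rule relpow_Suc_I2[OF _ path_dist0]) (simp add: adj_def)

text \<open>Every vertex at distance \<open>n + 1\<close> is a neighbour of one at distance at most
  \<open>n\<close>.\<close>

lemma finite_ball: "finite {x. dist0 x \<le> n}"
proof (induction n)
  case 0
  have "{x. dist0 x \<le> 0} \<subseteq> {x0}"
  proof
    fix x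
    assume "x \<in> {x. dist0 x \<le> 0}"
    then show "x \<in> {x0}" using path_dist0[of x] by simp
  qed
  then show ?case using finite_subset by blast
next
  case (Suc n)
  have "{x. dist0 x \<le> Suc n} \<subseteq> {x. dist0 x \<le> n} \<union> (\<Union>z\<in>{x. dist0 x \<le> n}. {x. 0 < b z x})"
  proof clarify
    fix x
    assume "dist0 x \<le> Suc n" and x: "x \<notin> (\<Union>z\<in>{x. dist0 x \<le> n}. {x. 0 < b z x})"
    show "dist0 x \<le> n"
    proof (rule ccontr)
      assume "\<not> dist0 x \<le> n"
      then have "dist0 x = Suc n" using \<open>dist0 x \<le> Suc n\<close> by simp
      then obtain z where "0 < b x z" "(z, x0) \<in> adj b ^^ n"
        using path_dist0[of x] relpow_Suc_D2[of x x0 n "adj b"] by (auto simp: adj_def)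
      then have "0 < b z x" "dist0 z \<le> n"
        using b_commute[of x z] dist0_le by auto
      then show False using x by auto
    qed
  qed
  then show ?case
    using Suc locally_finite by (auto intro: finite_subset)
qed

lemma finite_sphere: "finite (graph_sphere b x0 r)"
  by (rule finite_subset[OF _ finite_ball[of "nat r"]]) (auto simp: graph_sphere_def)

lemma radial_eq:
  assumes "spherically_symmetric b x0 f"
  shows "radial b x0 f (dist0 x) = f x"
proof -
  have "x \<in> graph_sphere b x0 (int (dist0 x))"
    by (simp add: graph_sphere_def)
  moreover have "f y = f x" if "y \<in> graph_sphere b x0 (int (dist0 x))" for y
  proof -
    have "dist0 y = dist0 x"
      using that by (simp add: graph_sphere_def)
    then show ?thesis
      using assms unfolding spherically_symmetric_def by blast
  qed
  ultimately have "f ` graph_sphere b x0 (int (dist0 x)) = {f x}"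
    by blast
  then show ?thesis
    unfolding radial_def by (intro the_equality) auto
qed

text \<open>A spherically symmetric function only feels the edges between neighbouring spheres.\<close>

lemma lap_radial:
  assumes f: "spherically_symmetric b x0 f" and x: "0 < dist0 x"
  shows "lap f x = outer_curvature b m x0 x * radial_diff b x0 f (dist0 x)
    - inner_curvature b m x0 x * radial_diff b x0 f (dist0 x - 1)"
proof -
  let ?N = "{y. 0 < b x y}" and ?p = "graph_sphere b x0 (int (dist0 x) + 1)"
    and ?m = "graph_sphere b x0 (int (dist0 x) - 1)"
  have b0: "b x y = 0" if "\<not> 0 < b x y" for y
    using b_nonneg[of x y] that by simp
  have p: "f x - f y = radial_diff b x0 f (dist0 x)" if "y \<in> ?p" for y
  proof -
    have "dist0 y = dist0 x + 1" using that by (auto simp: graph_sphere_def)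
    then show ?thesis
      using radial_eq[OF f, of x] radial_eq[OF f, of y] by (simp add: radial_diff_def)
  qed
  have n: "f x - f y = - radial_diff b x0 f (dist0 x - 1)" if "y \<in> ?m" for y
  proof -
    have "dist0 x - 1 = dist0 y" "dist0 x - 1 + 1 = dist0 x"
      using that x by (auto simp: graph_sphere_def)
    then show ?thesis
      unfolding radial_diff_def using radial_eq[OF f, of x] radial_eq[OF f, of y] by simp
  qed
  have same: "f x - f y = 0" if "0 < b x y" "y \<notin> ?p \<union> ?m" for y
  proof -
    have "dist0 x \<le> Suc (dist0 y)" "dist0 y \<le> Suc (dist0 x)"
      using dist0_adj[of x y] dist0_adj[of y x] that(1) b_commute[of x y] by simp_all
    then have "dist0 y = dist0 x"
      using that(2) by (auto simp: graph_sphere_def)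
    then have "f y = f x"
      using f unfolding spherically_symmetric_def by blast
    then show ?thesis by simp
  qed
  have "(\<Sum>y\<in>?N. b x y * (f x - f y)) = (\<Sum>y\<in>?p \<union> ?m. b x y * (f x - f y))"
  proof (rule sum.mono_neutral_cong)
    show "b x y * (f x - f y) = 0" if "y \<in> (?p \<union> ?m) - ?N" for y
      using b0[of y] that by simp
    show "b x y * (f x - f y) = 0" if "y \<in> ?N - (?p \<union> ?m)" for y
      using same[of y] that by simp
  qed (simp_all add: locally_finite finite_sphere)
  also have "\<dots> = (\<Sum>y\<in>?p. b x y * (f x - f y)) + (\<Sum>y\<in>?m. b x y * (f x - f y))"
    by (rule sum.union_disjoint) (auto simp: finite_sphere, auto simp: graph_sphere_def)
  also have "\<dots> = (\<Sum>y\<in>?p. b x y) * radial_diff b x0 f (dist0 x) - (\<Sum>y\<in>?m. b x y) * radial_diff b x0 f (dist0 x - 1)"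
    by (simp add: p n sum_distrib_right sum_negf)
  finally show ?thesis
    by (simp add: lap_def outer_curvature_def inner_curvature_def diff_divide_distrib)
qed

lemma radial_C0:
  assumes f: "spherically_symmetric b x0 f" and lim: "(\<lambda>r. radial b x0 f r) \<longlonglongrightarrow> 0"
  shows "f \<in> C0"
  unfolding C0_iff
proof (intro allI impI)
  fix \<epsilon> :: real
  assume "0 < \<epsilon>"
  then obtain N where N: "\<And>r. r \<ge> N \<Longrightarrow> \<bar>radial b x0 f r\<bar> < \<epsilon>"
    using LIMSEQ_D[OF lim] by fastforce
  have "{x. \<epsilon> < \<bar>f x\<bar>} \<subseteq> {x. dist0 x \<le> N}"
  proof clarify
    fix x
    assume "\<epsilon> < \<bar>f x\<bar>"
    then have "\<not> N \<le> dist0 x"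
      using N[of "dist0 x"] by (auto simp: radial_eq[OF f])
    then show "dist0 x \<le> N" by simp
  qed
  then show "finite {x. \<epsilon> < \<bar>f x\<bar>}"
    using finite_ball finite_subset by blast
qed

end

text \<open>Multiplying the curvature condition by the positive number \<open>radial_diff b x0 f r\<close> turns it
  into \<open>lap f x \<ge> l * f x\<close> outside the ball of radius \<open>R\<close>.\<close>

theorem theorem4p8:
  fixes b :: "'a \<Rightarrow> 'a \<Rightarrow> real" and m :: "'a \<Rightarrow> real" and x0 :: 'a
    and f :: "'a \<Rightarrow> real" and R :: nat and l :: real
  assumes "weighted_graph b m"
    and "graph_connected b"
    and "\<forall>x. f x > 0"
    and "spherically_symmetric b x0 f"
    and "\<forall>r>R. radial_diff b x0 f r > 0"
    and "(\<lambda>r. radial b x0 f r) \<longlonglongrightarrow> 0"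
    and "l < 0"
    and "\<forall>r>R. \<forall>x \<in> graph_sphere b x0 (int r).
           outer_curvature b m x0 x
             - inner_curvature b m x0 x * (radial_diff b x0 f (r - 1) / radial_diff b x0 f r)
           \<ge> l * (radial b x0 f r / radial_diff b x0 f r)"
  shows "feller b m"
proof -
  interpret connected_graph b m x0
    by standard (use assms in auto)
  show ?thesis
  proof (rule feller_if_supersolution)
    show "0 < f x" for x using assms(3) by simp
    show "f \<in> C0" by (rule radial_C0[OF assms(4,6)])
    show "finite {x. dist0 x \<le> R}" by (rule finite_ball)
    show "0 < - l" using assms(7) by simp
    show "- (- l) * f x \<le> lap f x" if "x \<notin> {x. dist0 x \<le> R}" for x
    proof -
      define r where "r = dist0 x"
      have r: "r > R" "x \<in> graph_sphere b x0 (int r)"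
        using that by (auto simp: r_def graph_sphere_def)
      define k where "k = radial_diff b x0 f r"
      have k: "0 < k" using assms(5) r(1) by (simp add: k_def)
      have "l * (radial b x0 f r / k)
          \<le> outer_curvature b m x0 x - inner_curvature b m x0 x * (radial_diff b x0 f (r - 1) / k)"
        using assms(8) r by (simp add: k_def)
      from mult_right_mono[OF this less_imp_le[OF k]]
      have "l * radial b x0 f r \<le> outer_curvature b m x0 x * k - inner_curvature b m x0 x * radial_diff b x0 f (r - 1)"
        using k by (simp add: left_diff_distrib)
      then show ?thesis
        using lap_radial[OF assms(4), of x] radial_eq[OF assms(4), of x] r(1) by (simp add: k_def r_def)
    qed
  qed
qed

end
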